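(* Let $p$ be an odd prime, and let $\alpha\colon S^{b-1}\to S^a$ be a $p$-local map with $3\le a<b$, where $a$ and $b$ are odd. If $p>\frac{b+3}{2}$, then $\alpha$ is not inert at $p$.
   Context: A $p$-local map between spheres is a map between the $p$-localisations of the spheres. For a homotopy cofibration $\Sigma A'\xrightarrow{u}Y\xrightarrow{v}Z$, the map $u$ is inert if $\Omega v$ has a right homotopy inverse. So, working $p$-locally with the homotopy cofibration $S^{b-1}\xrightarrow{\alpha}S^a\xrightarrow{v}A$ defining the cofibre $A$ of $\alpha$, "$\alpha$ is inert at $p$" means that $\Omega v\colon\Omega S^a\to\Omega A$ has a right homotopy inverse ($p$-locally). *)

theory Defs
  imports
    "HOL-Analysis.Analysis"
    "HOL-Homology.Homology"
    "HOL-Computational_Algebra.Primes"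
begin

section \<open>CW complexes\<close>

definition disc :: "nat \<Rightarrow> (nat \<Rightarrow> real) topology" where
  "disc n = subtopology (Euclidean_space n) {z. (\<Sum>i<n. (z i)\<^sup>2) \<le> 1}"

definition disc_interior :: "nat \<Rightarrow> (nat \<Rightarrow> real) set" where
  "disc_interior n = {z \<in> topspace (Euclidean_space n). (\<Sum>i<n. (z i)\<^sup>2) < 1}"

definition disc_boundary :: "nat \<Rightarrow> (nat \<Rightarrow> real) set" where
  "disc_boundary n = {z \<in> topspace (Euclidean_space n). (\<Sum>i<n. (z i)\<^sup>2) = 1}"

text \<open>A cell is a pair of its dimension and its characteristic map, of which only the values on
  the closed disc matter.\<close>

type_synonym 'a cell = "nat \<times> ((nat \<Rightarrow> real) \<Rightarrow> 'a)"

definition open_cell :: "'a cell \<Rightarrow> 'a set" where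
  "open_cell e = snd e ` disc_interior (fst e)"

text \<open>J. H. C. Whitehead's definition. The next-to-last conjunct is closure-finiteness together
  with the condition that cells are attached to cells of lower dimension; the last one is the
  weak topology.\<close>

definition CW_structure :: "'a topology \<Rightarrow> 'a cell set \<Rightarrow> bool" where
  "CW_structure X C \<longleftrightarrow>
     Hausdorff_space X \<and>
     (\<forall>(n, \<Phi>) \<in> C. continuous_map (disc n) X \<Phi> \<and>
                   embedding_map (subtopology (disc n) (disc_interior n)) X \<Phi>) \<and>
     topspace X = (\<Union>e \<in> C. open_cell e) \<and>
     disjoint_family_on open_cell C \<and>
     (\<forall>(n, \<Phi>) \<in> C. \<exists>F \<subseteq> C. finite F \<and> (\<forall>e \<in> F. fst e < n) \<and>
                   \<Phi> ` disc_boundary n \<subseteq> (\<Union>e \<in> F. open_cell e)) \<and>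
     (\<forall>A \<subseteq> topspace X. closedin X A \<longleftrightarrow>
        (\<forall>(n, \<Phi>) \<in> C. closedin (disc n) {z \<in> topspace (disc n). \<Phi> z \<in> A}))"

definition pointed_CW_complex :: "'a topology \<Rightarrow> 'a \<Rightarrow> bool" where
  "pointed_CW_complex X x0 \<longleftrightarrow>
     (\<exists>C. CW_structure X C \<and> (\<exists>e \<in> C. fst e = 0 \<and> x0 \<in> open_cell e))"


section \<open>Localisation at a prime\<close>

text \<open>Both path-connectedness and triviality of the fundamental group are contained in the
  requirement that any two loops are freely homotopic (compare \<^const>\<open>simply_connected\<close>,
  which covers only subsets of type-class spaces).\<close>

definition simply_connected_space :: "'a topology \<Rightarrow> bool" where
  "simply_connected_space X \<longleftrightarrow>
     (\<forall>g h. pathin X g \<and> g 1 = g 0 \<and> pathin X h \<and> h 1 = h 0 \<longrightarrow>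
        homotopic_with (\<lambda>r. r 1 = r 0) (top_of_set {0..1::real}) X g h)"

text \<open>For an abelian group \<open>G\<close> (written multiplicatively, as homology groups are in the library):
  \<open>G\<close> is a module over the integers localised at \<open>p\<close>, i.e. it is uniquely divisible by every
  natural number prime to \<open>p\<close>.\<close>

definition p_local_group :: "nat \<Rightarrow> ('g, 'm) monoid_scheme \<Rightarrow> bool" where
  "p_local_group p G \<longleftrightarrow>
     (\<forall>k::nat. coprime k p \<longrightarrow> bij_betw (\<lambda>g. g [^]\<^bsub>G\<^esub> k) (carrier G) (carrier G))"

text \<open>A homomorphism of abelian groups is a \<open>p\<close>-localisation if its target is \<open>p\<close>-local and its
  kernel and cokernel are torsion prime to \<open>p\<close>; equivalently, the target is \<open>p\<close>-local and the
  homomorphism becomes an isomorphism after tensoring with the integers localised at \<open>p\<close>.\<close>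

definition p_localisation_hom ::
  "nat \<Rightarrow> ('g, 'm) monoid_scheme \<Rightarrow> ('h, 'n) monoid_scheme \<Rightarrow> ('g \<Rightarrow> 'h) \<Rightarrow> bool" where
  "p_localisation_hom p G H \<phi> \<longleftrightarrow>
     \<phi> \<in> hom G H \<and> p_local_group p H \<and>
     (\<forall>g \<in> carrier G. \<phi> g = \<one>\<^bsub>H\<^esub> \<longrightarrow> (\<exists>k::nat. coprime k p \<and> g [^]\<^bsub>G\<^esub> k = \<one>\<^bsub>G\<^esub>)) \<and>
     (\<forall>h \<in> carrier H. \<exists>k::nat. coprime k p \<and> h [^]\<^bsub>H\<^esub> k \<in> \<phi> ` carrier G)"

text \<open>Localisation of simply connected spaces: the map localises integral homology in positive
  degrees.\<close>

definition p_localisation :: "nat \<Rightarrow> 'a topology \<Rightarrow> 'b topology \<Rightarrow> ('a \<Rightarrow> 'b) \<Rightarrow> bool" where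
  "p_localisation p X Y l \<longleftrightarrow>
     simply_connected_space Y \<and> continuous_map X Y l \<and>
     (\<forall>i::int. i > 0 \<longrightarrow>
        p_localisation_hom p (homology_group i X) (homology_group i Y) (hom_induced i X {} Y {} l))"

definition sphere_base :: "nat \<Rightarrow> real" where
  "sphere_base = (\<lambda>i. if i = 0 then 1 else 0)"

text \<open>The \<open>p\<close>-localisation of the \<open>n\<close>-sphere (\<open>n \<ge> 2\<close>) is determined up to pointed homotopy
  equivalence; the predicate describes its representatives that are CW complexes based at a
  vertex.\<close>

definition p_local_sphere :: "nat \<Rightarrow> nat \<Rightarrow> 'a topology \<Rightarrow> 'a \<Rightarrow> bool" where
  "p_local_sphere p n X x0 \<longleftrightarrow>
     pointed_CW_complex X x0 \<and> (\<exists>l. p_localisation p (nsphere n) X l \<and> l sphere_base = x0)"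


section \<open>The homotopy cofibre\<close>

text \<open>The reduced mapping cone of a pointed map \<open>f\<close> from \<open>(X, x0)\<close> to \<open>(Y, y0)\<close> is the quotient of
  the disjoint union of \<open>X \<times> [0,1]\<close> and \<open>Y\<close> by \<open>(x,1) \<sim> f x\<close> and \<open>(x,0) \<sim> (x0,t) \<sim> y0\<close>. Each
  class has a unique representative in \<open>Y\<close> or in \<open>(X - {x0}) \<times> (0,1)\<close>, so these serve as the
  points of the cone, and \<open>cone_proj\<close> is the quotient map on \<open>X \<times> [0,1]\<close>.\<close>

definition cone_proj :: "'a \<Rightarrow> 'b \<Rightarrow> ('a \<Rightarrow> 'b) \<Rightarrow> 'a \<times> real \<Rightarrow> ('a \<times> real) + 'b" where
  "cone_proj x0 y0 f = (\<lambda>(x, t).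
     if t = 0 \<or> x = x0 then Inr y0 else if t = 1 then Inr (f x) else Inl (x, t))"

definition cone_points :: "'a topology \<Rightarrow> 'a \<Rightarrow> 'b topology \<Rightarrow> (('a \<times> real) + 'b) set" where
  "cone_points X x0 Y = Inl ` ((topspace X - {x0}) \<times> {0<..<1}) \<union> Inr ` topspace Y"

definition mapping_cone ::
  "'a topology \<Rightarrow> 'a \<Rightarrow> 'b topology \<Rightarrow> 'b \<Rightarrow> ('a \<Rightarrow> 'b) \<Rightarrow> (('a \<times> real) + 'b) topology" where
  "mapping_cone X x0 Y y0 f = topology (\<lambda>U.
     U \<subseteq> cone_points X x0 Y \<and>
     openin (prod_topology X (top_of_set {0..1}))
       {z \<in> topspace X \<times> {0..1}. cone_proj x0 y0 f z \<in> U} \<and>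
     openin Y {y \<in> topspace Y. Inr y \<in> U})"

lemma openin_mapping_cone:
  "openin (mapping_cone X x0 Y y0 f) U \<longleftrightarrow>
     U \<subseteq> cone_points X x0 Y \<and>
     openin (prod_topology X (top_of_set {0..1}))
       {z \<in> topspace X \<times> {0..1}. cone_proj x0 y0 f z \<in> U} \<and>
     openin Y {y \<in> topspace Y. Inr y \<in> U}"
proof -
  let ?P = "prod_topology X (top_of_set {0..1::real})"
  let ?A = "\<lambda>U. {z \<in> topspace X \<times> {0..1}. cone_proj x0 y0 f z \<in> U}"
  let ?B = "\<lambda>U. {y \<in> topspace Y. Inr y \<in> U}"
  have "istopology (\<lambda>U. U \<subseteq> cone_points X x0 Y \<and> openin ?P (?A U) \<and> openin Y (?B U))"
    unfolding istopology_def
  proof (intro conjI allI impI)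
    fix S T
    assume S: "S \<subseteq> cone_points X x0 Y \<and> openin ?P (?A S) \<and> openin Y (?B S)"
      and T: "T \<subseteq> cone_points X x0 Y \<and> openin ?P (?A T) \<and> openin Y (?B T)"
    have eq: "?A (S \<inter> T) = ?A S \<inter> ?A T" "?B (S \<inter> T) = ?B S \<inter> ?B T" by auto
    show "S \<inter> T \<subseteq> cone_points X x0 Y" using S by auto
    show "openin ?P (?A (S \<inter> T))" "openin Y (?B (S \<inter> T))"
      unfolding eq using S T by (simp_all add: openin_Int)
  next
    fix K
    assume K: "\<forall>U\<in>K. U \<subseteq> cone_points X x0 Y \<and> openin ?P (?A U) \<and> openin Y (?B U)"
    have eq: "?A (\<Union>K) = (\<Union>U\<in>K. ?A U)" "?B (\<Union>K) = (\<Union>U\<in>K. ?B U)" by auto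
    show "\<Union>K \<subseteq> cone_points X x0 Y" using K by auto
    show "openin ?P (?A (\<Union>K))" "openin Y (?B (\<Union>K))"
      unfolding eq using K by (auto intro!: openin_Union)
  qed
  then show ?thesis
    unfolding mapping_cone_def by (simp add: topology_inverse')
qed

lemma topspace_mapping_cone:
  assumes "continuous_map X Y f" and "y0 \<in> topspace Y"
  shows "topspace (mapping_cone X x0 Y y0 f) = cone_points X x0 Y"
proof
  let ?P = "prod_topology X (top_of_set {0..1::real})"
  show "topspace (mapping_cone X x0 Y y0 f) \<subseteq> cone_points X x0 Y"
    using openin_mapping_cone[of X x0 Y y0 f "topspace (mapping_cone X x0 Y y0 f)"] by simp
  have "cone_proj x0 y0 f (x, t) \<in> cone_points X x0 Y" if "x \<in> topspace X" "t \<in> {0..1}" for x t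
  proof -
    have "f x \<in> topspace Y"
      using continuous_map_image_subset_topspace[OF assms(1)] that by blast
    then show ?thesis
      using that assms(2) by (simp add: cone_proj_def cone_points_def)
  qed
  then have 1: "{z \<in> topspace X \<times> {0..1}. cone_proj x0 y0 f z \<in> cone_points X x0 Y} = topspace ?P"
    unfolding topspace_prod_topology topspace_euclidean_subtopology by blast
  have 2: "{y \<in> topspace Y. Inr y \<in> cone_points X x0 Y} = topspace Y"
    unfolding cone_points_def by blast
  have "openin (mapping_cone X x0 Y y0 f) (cone_points X x0 Y)"
    unfolding openin_mapping_cone 1 2 by (intro conjI order_refl openin_topspace)
  then show "cone_points X x0 Y \<subseteq> topspace (mapping_cone X x0 Y y0 f)"
    by (rule openin_subset)
qed

lemma continuous_map_cone_inclusion: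
  assumes "continuous_map X Y f" and "y0 \<in> topspace Y"
  shows "continuous_map Y (mapping_cone X x0 Y y0 f) Inr"
  unfolding continuous_map_def topspace_mapping_cone[OF assms]
  by (simp add: openin_mapping_cone cone_points_def)


section \<open>Loop spaces and inert maps\<close>

text \<open>Loops are made extensional so that a loop is determined by its values on the unit
  interval.\<close>

definition loops :: "'a topology \<Rightarrow> 'a \<Rightarrow> (real \<Rightarrow> 'a) set" where
  "loops X x0 = {g \<in> extensional {0..1}. pathin X g \<and> g 0 = x0 \<and> g 1 = x0}"

text \<open>The compact-open topology.\<close>

definition loop_space :: "'a topology \<Rightarrow> 'a \<Rightarrow> (real \<Rightarrow> 'a) topology" where
  "loop_space X x0 = topology_generated_by
     {{g \<in> loops X x0. g ` K \<subseteq> U} | K U. K \<subseteq> {0..1} \<and> compact K \<and> openin X U}"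

definition const_loop :: "'a \<Rightarrow> real \<Rightarrow> 'a" where
  "const_loop x0 = restrict (\<lambda>_. x0) {0..1}"

definition loop_map :: "('a \<Rightarrow> 'b) \<Rightarrow> (real \<Rightarrow> 'a) \<Rightarrow> (real \<Rightarrow> 'b)" where
  "loop_map v g = restrict (v \<circ> g) {0..1}"

lemma topspace_loop_space: "topspace (loop_space X x0) = loops X x0"
proof
  show "topspace (loop_space X x0) \<subseteq> loops X x0"
    unfolding loop_space_def topology_generated_by_topspace by blast
  have "loops X x0 \<in> {{g \<in> loops X x0. g ` K \<subseteq> U} | K U. K \<subseteq> {0..1} \<and> compact K \<and> openin X U}"
    by (rule CollectI, rule exI[of _ "{}"], rule exI[of _ "{}"]) simp
  then show "loops X x0 \<subseteq> topspace (loop_space X x0)"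
    unfolding loop_space_def topology_generated_by_topspace by (rule Union_upper)
qed

lemma continuous_map_loop_map:
  assumes "continuous_map X Y v"
  shows "continuous_map (loop_space X x0) (loop_space Y (v x0)) (loop_map v)"
proof -
  have maps: "loop_map v g \<in> loops Y (v x0)" if "g \<in> loops X x0" for g
  proof -
    have "continuous_map (top_of_set {0..1}) Y (v \<circ> g)"
      using that assms by (auto simp: loops_def pathin_def intro: continuous_map_compose)
    then have "continuous_map (top_of_set {0..1}) Y (loop_map v g)"
      by (rule continuous_map_eq) (simp add: loop_map_def)
    then show ?thesis
      using that by (simp add: loops_def pathin_def loop_map_def)
  qed
  show ?thesis
    unfolding loop_space_def [of Y]
  proof (rule continuous_on_generated_topo)
    fix W
    assume "W \<in> {{g \<in> loops Y (v x0). g ` K \<subseteq> U} |K U. K \<subseteq> {0..1} \<and> compact K \<and> openin Y U}"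
    then obtain K U where W: "W = {g \<in> loops Y (v x0). g ` K \<subseteq> U}"
      and K: "K \<subseteq> {0..1}" "compact K" and U: "openin Y U" by blast
    let ?V = "{x \<in> topspace X. v x \<in> U}"
    have V: "openin X ?V" using assms U by (rule openin_continuous_map_preimage)
    have "loop_map v -` W \<inter> topspace (loop_space X x0) = {g \<in> loops X x0. g ` K \<subseteq> ?V}"
    proof -
      have "g t \<in> topspace X" if "g \<in> loops X x0" "t \<in> K" for g t
        using that K by (auto simp: loops_def pathin_def continuous_map_def)
      moreover have "loop_map v g t = v (g t)" if "t \<in> K" for g t
        using that K by (auto simp: loop_map_def)
      ultimately show ?thesis
        using maps by (auto simp: W topspace_loop_space image_subset_iff)
    qed
    then show "openin (loop_space X x0) (loop_map v -` W \<inter> topspace (loop_space X x0))"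
      unfolding loop_space_def using K V by (auto intro!: topology_generated_by_Basis)
  next
    show "loop_map v ` topspace (loop_space X x0)
        \<subseteq> \<Union> {{g \<in> loops Y (v x0). g ` K \<subseteq> U} |K U. K \<subseteq> {0..1} \<and> compact K \<and> openin Y U}"
      using maps topspace_loop_space [of Y "v x0"]
      unfolding loop_space_def [of Y] topology_generated_by_topspace
      by (auto simp: topspace_loop_space)
  qed
qed

definition has_right_homotopy_inverse ::
  "'a topology \<Rightarrow> 'a \<Rightarrow> 'b topology \<Rightarrow> 'b \<Rightarrow> ('a \<Rightarrow> 'b) \<Rightarrow> bool" where
  "has_right_homotopy_inverse X x0 Y y0 f \<longleftrightarrow>
     (\<exists>s. continuous_map Y X s \<and> s y0 = x0 \<and>
          homotopic_with (\<lambda>h. h y0 = y0) Y Y (f \<circ> s) id)"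

text \<open>The homotopy cofibration is \<open>(X, x0) \<rightarrow> (Y, y0) \<rightarrow> mapping cone\<close>, with first map \<open>u\<close> and
  second map the inclusion \<open>Inr\<close>. When \<open>X\<close> and \<open>Y\<close> are simply connected and \<open>p\<close>-local, so is
  the cone, and hence this is inertness at \<open>p\<close>.\<close>

definition inert ::
  "'a topology \<Rightarrow> 'a \<Rightarrow> 'b topology \<Rightarrow> 'b \<Rightarrow> ('a \<Rightarrow> 'b) \<Rightarrow> bool" where
  "inert X x0 Y y0 u \<longleftrightarrow>
     has_right_homotopy_inverse
       (loop_space Y y0) (const_loop y0)
       (loop_space (mapping_cone X x0 Y y0 u) (Inr y0)) (const_loop (Inr y0))
       (loop_map Inr)"

end

theory Submission
  imports Defs
begin

text \<open>Let \<open>A\<close> be the cone of \<open>\<alpha>\<close>. For a pointed space \<open>B\<close> the chain complexes of the spaces of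
  singular \<open>n\<close>-simplices of \<open>B\<close>, lifted to the path space, form a double complex (Dress's
  construction of the Serre spectral sequence) whose rows are exact and whose \<open>n\<close>-th column
  computes the homology of the loop space with coefficients in the \<open>n\<close>-chains of \<open>B\<close>. Below
  degree \<open>b\<close> the homology of \<open>A\<close> is torsion except in the odd degree \<open>a\<close>; therefore the homology
  of \<open>\<Omega>A\<close> is torsion in odd degrees below \<open>b - 1\<close>, and every class in \<open>H\<^sub>b(A)\<close> has a nonzero multiple
  in the image of the homology suspension from \<open>H\<^sub>b\<^sub>-\<^sub>1(\<Omega>A)\<close>. If \<open>\<Omega>Y \<rightarrow> \<Omega>A\<close> has a right homotopy inverse,
  the suspension factors through \<open>H\<^sub>b(Y) = 0\<close>, so \<open>H\<^sub>b(A)\<close> is torsion. But it maps onto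
  \<open>H\<^sub>b\<^sub>-\<^sub>1(X)\<close>, which is not torsion. The excision needed for the cone rests on the
  nondegeneracy of a vertex of a CW complex.\<close>

section \<open>Continuity rules\<close>

text \<open>Rational homology is never formed: all chains are integral, and statements hold up to a
  positive integer factor, which replaces tensoring with the rationals and is collected along each
  chase. The simplices of the base carry the discrete topology, so a column is a disjoint union over
  simplices, and a path from \<open>b\<close> to each point may be chosen without continuity. The
  obstacle is that the resulting identification of a column with copies of the loop space respects
  face 0 only up to a homotopy, which exists because the loop space is path connected; otherwise
  local coefficients would enter. For the cone this connectedness comes not from a van Kampen
  argument but from inertness itself: every loop is joined to the image of a loop in the simply
  connected \<open>Y\<close>. Parity does the rest: in total degree b - 1, a column i with 0 < i < b
  - 1 either has i even, where the base is torsion because a is odd, or has i odd, where the loop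
  degree b - 1 - i is odd because b is.\<close>

abbreviation unit_interval :: "real topology" where
  "unit_interval \<equiv> top_of_set {0..1}"

abbreviation simplex_top :: "nat \<Rightarrow> (nat \<Rightarrow> real) topology" where
  "simplex_top n \<equiv> subtopology (powertop_real UNIV) (standard_simplex n)"

lemma compact_simplex_top: "compact_space (simplex_top n)"
  using compactin_standard_simplex compact_space_subtopology by blast

lemma Hausdorff_simplex_top: "Hausdorff_space (simplex_top n)"
  by (simp add: Hausdorff_space_subtopology Hausdorff_space_product_topology)

lemma compact_unit_interval: "compact_space unit_interval"
  by (simp add: compact_space_subtopology compactin_euclidean_iff)

lemma Hausdorff_unit_interval: "Hausdorff_space unit_interval"
  by (simp add: Hausdorff_space_subtopology)

lemma cm_id: "continuous_map W W (\<lambda>w. w)"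
  using continuous_map_id by (simp add: id_def)

lemma cm_const: "c \<in> topspace Y \<Longrightarrow> continuous_map W Y (\<lambda>w. c)"
  by simp

lemma cm_comp: "continuous_map X Y f \<Longrightarrow> continuous_map W X g \<Longrightarrow> continuous_map W Y (\<lambda>w. f (g w))"
  using continuous_map_compose[of W X g Y f] by (simp add: o_def)

lemma cm_fst: "continuous_map W (prod_topology X Y) f \<Longrightarrow> continuous_map W X (\<lambda>w. fst (f w))"
  by (simp add: continuous_map_pairwise o_def)

lemma cm_snd: "continuous_map W (prod_topology X Y) f \<Longrightarrow> continuous_map W Y (\<lambda>w. snd (f w))"
  by (simp add: continuous_map_pairwise o_def)

lemma cm_fst': "continuous_map (prod_topology X Y) X fst"
  and cm_snd': "continuous_map (prod_topology X Y) Y snd"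
  by (simp_all add: continuous_map_fst continuous_map_snd)

lemma cm_interval: "continuous_map W unit_interval f \<longleftrightarrow>
    continuous_map W euclideanreal f \<and> (\<forall>w \<in> topspace W. 0 \<le> f w \<and> f w \<le> 1)"
  by (auto simp: continuous_map_in_subtopology)

lemma cm_interval_real: "continuous_map W unit_interval f \<Longrightarrow> continuous_map W euclideanreal f"
  by (simp add: cm_interval)

lemma cm_simplex: "continuous_map W (simplex_top n) f \<longleftrightarrow>
    (\<forall>k. continuous_map W euclideanreal (\<lambda>w. f w k)) \<and> (\<forall>w \<in> topspace W. f w \<in> standard_simplex n)"
  by (auto simp: continuous_map_in_subtopology continuous_map_componentwise_UNIV)

lemma cm_simplex_coord: "continuous_map W (simplex_top n) f \<Longrightarrow> continuous_map W euclideanreal (\<lambda>w. f w k)"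
  by (simp add: cm_simplex)

lemma cm_sub: "continuous_map W Y f \<Longrightarrow> continuous_map (subtopology W S) Y f"
  by (rule continuous_map_from_subtopology)

lemma cm_singular: "singular_simplex n B \<tau> \<Longrightarrow> continuous_map W (simplex_top n) f \<Longrightarrow>
    continuous_map W B (\<lambda>w. \<tau> (f w))"
  unfolding singular_simplex_def using cm_comp by blast

lemma cm_if_le:
  assumes "continuous_map X euclideanreal p" "continuous_map X euclideanreal q"
    and "continuous_map (subtopology X {x \<in> topspace X. p x \<le> q x}) Y f"
    and "continuous_map (subtopology X {x \<in> topspace X. q x \<le> p x}) Y g"
    and "\<And>x. \<lbrakk>x \<in> topspace X; p x = q x\<rbrakk> \<Longrightarrow> f x = g x"
  shows "continuous_map X Y (\<lambda>x. if p x \<le> q x then f x else g x)"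
  using continuous_map_cases_le[of X p q Y f g] assms by simp

text \<open>The fibres of a map into a discrete space are open, so the discrete coordinate may be
  frozen. This is how dependence on a singular simplex is handled, in which no continuity is asked
  for.\<close>

lemma cm_slices:
  assumes c: "continuous_map W (discrete_topology S) c"
    and f: "\<And>s. s \<in> S \<Longrightarrow> continuous_map (subtopology W {w \<in> topspace W. c w = s}) B f"
  shows "continuous_map W B f"
proof (rule pasting_lemma[where I = S and T = "\<lambda>s. {w \<in> topspace W. c w = s}" and f = "\<lambda>_. f"])
  fix s assume "s \<in> S"
  then have "openin (discrete_topology S) {s}" by simp
  from openin_continuous_map_preimage[OF c this] show "openin W {w \<in> topspace W. c w = s}"
    by simp
next
  fix w assume "w \<in> topspace W"
  then show "\<exists>j. j \<in> S \<and> w \<in> {w \<in> topspace W. c w = j} \<and> f w = f w"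
    using continuous_map_image_subset_topspace[OF c] by auto
qed (use f in auto)

lemma homotopicI:
  assumes "continuous_map (prod_topology unit_interval W) U h"
    and "\<And>w. w \<in> topspace W \<Longrightarrow> h (0, w) = f w" "\<And>w. w \<in> topspace W \<Longrightarrow> h (1, w) = g w"
  shows "homotopic_with (\<lambda>_. True) W U f g"
  using assms by (subst homotopic_with) auto

lemma homotopic_relI:
  assumes "continuous_map (prod_topology unit_interval W) U h"
    and "\<And>w. w \<in> topspace W \<Longrightarrow> h (0, w) = f w" "\<And>w. w \<in> topspace W \<Longrightarrow> h (1, w) = g w"
    and "\<And>s w. s \<in> {0..1} \<Longrightarrow> w \<in> topspace W \<Longrightarrow> w \<in> S \<Longrightarrow> h (s, w) \<in> T" and "S \<subseteq> topspace W"
  shows "homotopic_with (\<lambda>k. k \<in> S \<rightarrow> T) W U f g"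
  using assms by (subst homotopic_with) (auto simp: Pi_iff subset_iff)

section \<open>The compact-open topology\<close>

text \<open>The compact-open topology on a prescribed set \<open>S\<close> of maps, so that one
  exponential law serves for loops, for lifts of simplices and for the paths in the deformation of
  the cone.\<close>

definition cotop :: "'d topology \<Rightarrow> 'b topology \<Rightarrow> ('d \<Rightarrow> 'b) set \<Rightarrow> ('d \<Rightarrow> 'b) topology" where
  "cotop D B S = topology_generated_by {{g \<in> S. g ` K \<subseteq> U} | K U. compactin D K \<and> openin B U}"

lemma topspace_cotop [simp]: "topspace (cotop D B S) = S"
proof -
  have "S \<in> {{g \<in> S. g ` K \<subseteq> U} | K U. compactin D K \<and> openin B U}"
    by (rule CollectI, rule exI[of _ "{}"], rule exI[of _ "{}"]) simp
  then show ?thesis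
    unfolding cotop_def topology_generated_by_topspace by blast
qed

text \<open>One half of the exponential law, valid for every \<open>D\<close>: the tube lemma
  thickens the slice over a point of \<open>W\<close> along the compact set
  \<open>K\<close>.\<close>

lemma cm_into_cotop:
  assumes "\<And>w. w \<in> topspace W \<Longrightarrow> f w \<in> S"
    and cont: "continuous_map (prod_topology W D) B (\<lambda>z. f (fst z) (snd z))"
  shows "continuous_map W (cotop D B S) f"
  unfolding cotop_def
proof (rule continuous_on_generated_topo)
  fix V assume "V \<in> {{g \<in> S. g ` K \<subseteq> U} | K U. compactin D K \<and> openin B U}"
  then obtain K U where V: "V = {g \<in> S. g ` K \<subseteq> U}" and K: "compactin D K" and U: "openin B U"
    by blast
  let ?N = "{z \<in> topspace (prod_topology W D). f (fst z) (snd z) \<in> U}"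
  have N: "openin (prod_topology W D) ?N"
    using openin_continuous_map_preimage[OF cont U] .
  show "openin W (f -` V \<inter> topspace W)"
  proof (subst openin_subopen, intro ballI)
    fix w assume w: "w \<in> f -` V \<inter> topspace W"
    have "{w} \<times> K \<subseteq> ?N"
      using w K compactin_subset_topspace[OF K] by (auto simp: V)
    from tube_lemma_right[OF N K _ this] w
    obtain P Q where PQ: "openin W P" "w \<in> P" "K \<subseteq> Q" "P \<times> Q \<subseteq> ?N" by auto
    have "P \<subseteq> f -` V \<inter> topspace W"
    proof
      fix v assume v: "v \<in> P"
      have "v \<in> topspace W" using v PQ(1) openin_subset by blast
      moreover have "f v d \<in> U" if "d \<in> K" for d
        using PQ that v by fastforce
      ultimately show "v \<in> f -` V \<inter> topspace W"
        using assms(1) by (auto simp: V)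
    qed
    then show "\<exists>T. openin W T \<and> w \<in> T \<and> T \<subseteq> f -` V \<inter> topspace W"
      using PQ by blast
  qed
next
  have "S \<in> {{g \<in> S. g ` K \<subseteq> U} | K U. compactin D K \<and> openin B U}"
    by (rule CollectI, rule exI[of _ "{}"], rule exI[of _ "{}"]) simp
  then show "f ` topspace W \<subseteq> \<Union> {{g \<in> S. g ` K \<subseteq> U} | K U. compactin D K \<and> openin B U}"
    using assms(1) by blast
qed

text \<open>The other half. A compact Hausdorff space is regular, so \<open>d w\<close> has a
  compact neighbourhood that \<open>g w\<close> still maps into \<open>U\<close>; this neighbourhood
  and \<open>U\<close> define a subbasic open set around \<open>g w\<close>.\<close>

lemma cm_eval:
  assumes D: "compact_space D" "Hausdorff_space D" and S: "\<And>g. g \<in> S \<Longrightarrow> continuous_map D B g"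
    and g: "continuous_map W (cotop D B S) g" and d: "continuous_map W D d"
  shows "continuous_map W B (\<lambda>w. g w (d w))"
proof -
  have gS: "g w \<in> S" if "w \<in> topspace W" for w
    using continuous_map_image_subset_topspace[OF g] that by auto
  have dD: "d w \<in> topspace D" if "w \<in> topspace W" for w
    using continuous_map_image_subset_topspace[OF d] that by auto
  have reg: "regular_space D"
    using D compact_Hausdorff_imp_regular_space by blast
  show ?thesis
    unfolding continuous_map_openin_preimage_eq
  proof (intro conjI allI impI)
    show "(\<lambda>w. g w (d w)) \<in> topspace W \<rightarrow> topspace B"
    proof
      fix w assume w: "w \<in> topspace W"
      then show "g w (d w) \<in> topspace B"
        using continuous_map_image_subset_topspace[OF S[OF gS[OF w]]] dD[OF w] by blast
    qed
    fix U assume U: "openin B U"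
    show "openin W (topspace W \<inter> (\<lambda>w. g w (d w)) -` U)"
    proof (subst openin_subopen, intro ballI)
      fix w assume "w \<in> topspace W \<inter> (\<lambda>w. g w (d w)) -` U"
      then have w: "w \<in> topspace W" "g w (d w) \<in> U" by auto
      let ?P = "{x \<in> topspace D. g w x \<in> U}"
      have P: "openin D ?P"
        using openin_continuous_map_preimage[OF S[OF gS[OF w(1)]] U] .
      have "closedin D (topspace D - ?P)" "d w \<in> topspace D - (topspace D - ?P)"
        using P w dD by auto
      then obtain A C where AC: "openin D A" "openin D C" "d w \<in> A" "topspace D - ?P \<subseteq> C" "disjnt A C"
        using reg[unfolded regular_space_def, rule_format, of "topspace D - ?P" "d w"] by auto
      let ?K = "topspace D - C"
      have K: "compactin D ?K"
        using AC(2) D(1) closedin_compact_space by blast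
      have KU: "g w ` ?K \<subseteq> U" and AK: "A \<subseteq> ?K"
        using AC openin_subset[OF AC(1)] by (auto simp: disjnt_def)
      let ?G = "{h \<in> S. h ` ?K \<subseteq> U}"
      have G: "openin (cotop D B S) ?G"
        unfolding cotop_def by (rule topology_generated_by_Basis) (use K U in blast)
      note o = openin_continuous_map_preimage[OF g G] openin_continuous_map_preimage[OF d AC(1)]
      let ?T = "{v \<in> topspace W. g v \<in> ?G} \<inter> {v \<in> topspace W. d v \<in> A}"
      have "openin W ?T" using o by blast
      moreover have "w \<in> ?T" using w gS KU AC by auto
      moreover have "?T \<subseteq> topspace W \<inter> (\<lambda>w. g w (d w)) -` U"
        using AK by auto
      ultimately show "\<exists>T. openin W T \<and> w \<in> T \<and> T \<subseteq> topspace W \<inter> (\<lambda>w. g w (d w)) -` U"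
        by blast
    qed
  qed
qed

lemma loop_space_eq_cotop: "loop_space B b = cotop unit_interval B (loops B b)"
proof -
  have "compactin unit_interval K \<longleftrightarrow> K \<subseteq> {0..1} \<and> compact K" for K :: "real set"
    by (auto simp: compactin_subtopology)
  then show ?thesis
    by (simp add: loop_space_def cotop_def)
qed

lemma cm_loop_eval:
  assumes "continuous_map W (loop_space B b) g" "continuous_map W unit_interval d"
  shows "continuous_map W B (\<lambda>w. g w (d w))"
  using assms unfolding loop_space_eq_cotop
  by (rule cm_eval[OF compact_unit_interval Hausdorff_unit_interval, rotated])
     (auto simp: loops_def pathin_def)

lemma cm_into_loop_space:
  assumes "\<And>w. w \<in> topspace W \<Longrightarrow> f w \<in> extensional {0..1}"
    and "\<And>w. w \<in> topspace W \<Longrightarrow> f w 0 = b" "\<And>w. w \<in> topspace W \<Longrightarrow> f w 1 = b"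
    and cont: "continuous_map (prod_topology W unit_interval) B (\<lambda>z. f (fst z) (snd z))"
  shows "continuous_map W (loop_space B b) f"
  unfolding loop_space_eq_cotop
proof (rule cm_into_cotop[OF _ cont])
  fix w assume w: "w \<in> topspace W"
  have "continuous_map unit_interval B (\<lambda>t. (\<lambda>z. f (fst z) (snd z)) (w, t))"
    by (rule cm_comp[OF cont]) (intro continuous_map_pairedI cm_id cm_const w)
  then show "f w \<in> loops B b"
    using assms w by (simp add: loops_def pathin_def)
qed

section \<open>Spaces of simplices with a contraction\<close>

abbreviation cyl :: "nat \<Rightarrow> ((nat \<Rightarrow> real) \<times> real) topology" where
  "cyl n \<equiv> prod_topology (simplex_top n) unit_interval"

abbreviation cylset :: "nat \<Rightarrow> ((nat \<Rightarrow> real) \<times> real) set" where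
  "cylset n \<equiv> standard_simplex n \<times> {0..1}"

text \<open>A map of the simplex into the space of paths from \<open>b\<close>, in adjoint form on
  simplex times interval. Extensionality makes it determined by its values there.\<close>

definition lifts :: "nat \<Rightarrow> 'b topology \<Rightarrow> 'b \<Rightarrow> ((nat \<Rightarrow> real) \<times> real \<Rightarrow> 'b) set" where
  "lifts n B b = {g \<in> extensional (cylset n).
     continuous_map (cyl n) B g \<and> (\<forall>x \<in> standard_simplex n. g (x, 0) = b)}"

type_synonym 'b path_simplex = "((nat \<Rightarrow> real) \<Rightarrow> 'b) \<times> ((nat \<Rightarrow> real) \<times> real \<Rightarrow> 'b)"

text \<open>Points of \<open>Gam n B b\<close> are singular \<open>n\<close>-simplices of \<open>B\<close>, lifted to the space of paths
  starting at \<open>b\<close>; \<open>Gam 0 B b\<close> contains the loop space as the fibre over \<open>b\<close>.\<close>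

definition Gam :: "nat \<Rightarrow> 'b topology \<Rightarrow> 'b \<Rightarrow>
    'b path_simplex topology" where
  "Gam n B b = subtopology
     (prod_topology (discrete_topology (singular_simplex_set n B)) (cotop (cyl n) B (lifts n B b)))
     {z. \<forall>x \<in> standard_simplex n. snd z (x, 1) = fst z x}"

lemma topspace_Gam: "z \<in> topspace (Gam n B b) \<longleftrightarrow>
    singular_simplex n B (fst z) \<and> snd z \<in> lifts n B b \<and> (\<forall>x \<in> standard_simplex n. snd z (x, 1) = fst z x)"
  by (cases z) (auto simp: Gam_def)

lemma compact_cyl: "compact_space (cyl n)" and Hausdorff_cyl: "Hausdorff_space (cyl n)"
  by (simp_all add: compact_space_prod_topology compact_simplex_top compact_unit_interval
      Hausdorff_space_prod_topology Hausdorff_simplex_top Hausdorff_unit_interval del: topspace_prod_topology)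

lemma cm_Gam_fst: "continuous_map (Gam n B b) (discrete_topology (singular_simplex_set n B)) fst"
  unfolding Gam_def by (intro cm_sub cm_fst')

lemma cm_Gam_snd: "continuous_map (Gam n B b) (cotop (cyl n) B (lifts n B b)) snd"
  unfolding Gam_def by (intro cm_sub cm_snd')

lemma cm_Gam_eval:
  assumes "continuous_map W (Gam n B b) f" "continuous_map W (simplex_top n) d" "continuous_map W unit_interval t"
  shows "continuous_map W B (\<lambda>w. snd (f w) (d w, t w))"
proof (rule cm_eval[OF compact_cyl Hausdorff_cyl])
  show "continuous_map W (cotop (cyl n) B (lifts n B b)) (\<lambda>w. snd (f w))"
    by (rule cm_comp[OF cm_Gam_snd assms(1)])
  show "continuous_map W (cyl n) (\<lambda>w. (d w, t w))"
    using assms by (intro continuous_map_pairedI)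
qed (simp add: lifts_def)

lemma cm_into_Gam:
  assumes t: "continuous_map W (discrete_topology (singular_simplex_set n B)) (\<lambda>w. fst (f w))"
    and g: "continuous_map (prod_topology W (cyl n)) B (\<lambda>z. snd (f (fst z)) (snd z))"
    and e: "\<And>w. w \<in> topspace W \<Longrightarrow> snd (f w) \<in> extensional (cylset n)"
    and 0: "\<And>w x. w \<in> topspace W \<Longrightarrow> x \<in> standard_simplex n \<Longrightarrow> snd (f w) (x, 0) = b"
    and 1: "\<And>w x. w \<in> topspace W \<Longrightarrow> x \<in> standard_simplex n \<Longrightarrow> snd (f w) (x, 1) = fst (f w) x"
  shows "continuous_map W (Gam n B b) f"
  unfolding Gam_def continuous_map_in_subtopology
proof
  have L: "snd (f w) \<in> lifts n B b" if w: "w \<in> topspace W" for w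
  proof -
    have "continuous_map (cyl n) B (\<lambda>d. (\<lambda>z. snd (f (fst z)) (snd z)) (w, d))"
      by (rule cm_comp[OF g]) (intro continuous_map_pairedI cm_id cm_const w)
    then show ?thesis
      using e[OF w] 0[OF w] by (simp add: lifts_def)
  qed
  show "continuous_map W (prod_topology (discrete_topology (singular_simplex_set n B))
      (cotop (cyl n) B (lifts n B b))) f"
    unfolding continuous_map_pairwise o_def
    using t cm_into_cotop[of W "\<lambda>w. snd (f w)", OF L g] by simp
  show "f \<in> topspace W \<rightarrow> {z. \<forall>x\<in>standard_simplex n. snd z (x, 1) = fst z x}"
    using 1 by simp
qed

lemma cm_cyl_pt: "continuous_map (prod_topology W (cyl n)) (simplex_top n) (\<lambda>z. fst (snd z))"
  and cm_cyl_time: "continuous_map (prod_topology W (cyl n)) unit_interval (\<lambda>z. snd (snd z))"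
  by (rule cm_fst[OF cm_snd'], rule cm_snd[OF cm_snd'])

text \<open>The first component takes values in a discrete space and the standard simplex is
  connected: a simplex of a column lies over a single simplex of the base.\<close>

lemma singular_simplex_Gam_fst:
  assumes \<sigma>: "singular_simplex j (Gam n B b) \<sigma>" and "x \<in> standard_simplex j" "y \<in> standard_simplex j"
  shows "fst (\<sigma> x) = fst (\<sigma> y)"
proof -
  have "continuous_map (simplex_top j) (discrete_topology (singular_simplex_set n B)) (\<lambda>x. fst (\<sigma> x))"
    by (rule cm_comp[OF cm_Gam_fst[of n B b]]) (use \<sigma> in \<open>simp add: singular_simplex_def\<close>)
  moreover have "connectedin (simplex_top j) (standard_simplex j)"
    by (simp add: connectedin_subtopology connectedin_standard_simplex)
  ultimately have "connectedin (discrete_topology (singular_simplex_set n B)) ((\<lambda>x. fst (\<sigma> x)) ` standard_simplex j)"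
    using connectedin_continuous_map_image by blast
  then show ?thesis
    unfolding connectedin_discrete_topology using assms(2,3) by auto
qed

section \<open>Face maps and the horizontal differential\<close>

definition gface :: "nat \<Rightarrow> nat \<Rightarrow> 'b path_simplex \<Rightarrow> 'b path_simplex" where
  "gface n k z = (singular_face (Suc n) k (fst z),
     restrict (\<lambda>(x, t). snd z (simplical_face k x, t)) (cylset n))"

lemma cm_simplical_face:
  assumes "k \<le> Suc n" "continuous_map W (simplex_top n) f"
  shows "continuous_map W (simplex_top (Suc n)) (\<lambda>w. simplical_face k (f w))"
proof -
  have c: "continuous_map W euclideanreal (\<lambda>w. f w i)" for i
    using assms(2) by (simp add: cm_simplex)
  have "continuous_map W euclideanreal (\<lambda>w. simplical_face k (f w) i)" for i
    unfolding simplical_face_def using c by (cases "i < k"; cases "i = k"; simp)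
  moreover have "\<forall>w \<in> topspace W. simplical_face k (f w) \<in> standard_simplex (Suc n)"
    using assms simplical_face_in_standard_simplex[of "Suc n" k] by (simp add: cm_simplex)
  ultimately show ?thesis by (simp add: cm_simplex)
qed

lemma face_in_simplex: "k \<le> Suc n \<Longrightarrow> x \<in> standard_simplex n \<Longrightarrow> simplical_face k x \<in> standard_simplex (Suc n)"
  using simplical_face_in_standard_simplex[of "Suc n" k x] by simp

lemma cm_discrete_map:
  assumes "continuous_map W (discrete_topology S) c" "\<And>s. s \<in> S \<Longrightarrow> h s \<in> T"
  shows "continuous_map W (discrete_topology T) (\<lambda>w. h (c w))"
  by (rule cm_comp[OF _ assms(1)]) (use assms(2) in auto)

lemma cm_restrict:
  assumes "continuous_map (prod_topology W D) B (\<lambda>z. f (fst z) (snd z))" "topspace D \<subseteq> S"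
  shows "continuous_map (prod_topology W D) B (\<lambda>z. restrict (f (fst z)) S (snd z))"
  by (rule continuous_map_eq[OF assms(1)]) (use assms(2) in auto)

lemma cm_gface:
  assumes k: "k \<le> Suc n"
  shows "continuous_map (Gam (Suc n) B b) (Gam n B b) (gface n k)"
proof (rule cm_into_Gam)
  show "continuous_map (Gam (Suc n) B b) (discrete_topology (singular_simplex_set n B)) (\<lambda>w. fst (gface n k w))"
    unfolding gface_def fst_conv
    by (rule cm_discrete_map[OF cm_Gam_fst]) (use singular_simplex_singular_face[of "Suc n"] k in simp)
  show "continuous_map (prod_topology (Gam (Suc n) B b) (cyl n)) B (\<lambda>z. snd (gface n k (fst z)) (snd z))"
    unfolding gface_def snd_conv
    by (rule cm_restrict)
       (simp_all add: case_prod_beta,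
        intro cm_Gam_eval[of _ "Suc n" B b] cm_simplical_face k cm_cyl_pt cm_cyl_time cm_fst')
qed (use k in \<open>auto simp: gface_def topspace_Gam singular_face_def lifts_def face_in_simplex\<close>)

lemma simplical_face_commute:
  "k < l \<Longrightarrow> simplical_face l (simplical_face k x) = simplical_face k (simplical_face (l - 1) x)"
  by (rule ext) (auto simp: simplical_face_def)

lemma gface_gface:
  assumes "k < l" "l \<le> Suc (Suc n)"
  shows "gface n k (gface (Suc n) l z) = gface n (l - 1) (gface (Suc n) k z)"
proof -
  have kl: "k \<le> Suc n" "l - 1 \<le> Suc n" using assms by auto
  have "singular_face (Suc n) k (singular_face (Suc (Suc n)) l (fst z)) =
      singular_face (Suc n) (l - 1) (singular_face (Suc (Suc n)) k (fst z))"
    unfolding singular_face_def o_def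
    by (rule ext) (use simplical_face_commute[OF assms(1), where 'a = real] face_in_simplex[OF kl(1)] face_in_simplex[OF kl(2)] in
        \<open>simp add: restrict_def\<close>)
  moreover have "restrict (\<lambda>(x, t). snd (gface (Suc n) l z) (simplical_face k x, t)) (cylset n) =
      restrict (\<lambda>(x, t). snd (gface (Suc n) k z) (simplical_face (l - 1) x, t)) (cylset n)"
    by (rule ext) (use simplical_face_commute[OF assms(1), where 'a = real] face_in_simplex[OF kl(1)] face_in_simplex[OF kl(2)] in
        \<open>simp add: restrict_def gface_def split: prod.splits\<close>)
  ultimately show ?thesis
    unfolding gface_def[of n] by (simp add: gface_def[of "Suc n"])
qed

lemma chain_map_comp_eq:
  assumes "singular_chain j X c" "\<And>x. x \<in> topspace X \<Longrightarrow> f (g x) = h (k x)"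
  shows "chain_map j f (chain_map j g c) = chain_map j h (chain_map j k c)"
proof -
  have "chain_map j (f \<circ> g) c = chain_map j (h \<circ> k) c"
    using assms by (intro chain_map_eq) auto
  then show ?thesis by (simp add: chain_map_compose)
qed

text \<open>The horizontal differential, from column \<open>Suc n\<close> to column
  \<open>n\<close>. It commutes strictly with \<open>chain_boundary\<close>, so the total
  differential used later puts the sign (-1)^i on the vertical part.\<close>

definition dh :: "nat \<Rightarrow> nat \<Rightarrow> 'b path_simplex chain \<Rightarrow>
    'b path_simplex chain" where
  "dh n j x = (\<Sum>k\<le>Suc n. frag_cmul ((-1) ^ k) (chain_map j (gface n k) x))"

lemma dh_0 [simp]: "dh n j 0 = 0"
  by (simp add: dh_def)

lemma dh_add: "dh n j (x + y) = dh n j x + dh n j y"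
  unfolding dh_def chain_map_add frag_cmul_distrib2 sum.distrib ..

lemma dh_cmul: "dh n j (frag_cmul c x) = frag_cmul c (dh n j x)"
  unfolding dh_def chain_map_cmul frag_cmul_sum o_def frag_cmul_cmul by (simp add: mult.commute)

lemma dh_minus: "dh n j (- x) = - dh n j x"
  using dh_cmul[of n j "-1" x] by simp

lemma dh_diff: "dh n j (x - y) = dh n j x - dh n j y"
  using dh_add[of n j x "- y"] dh_minus[of n j y] by simp

lemma singular_chain_dh:
  "singular_chain j (Gam (Suc n) B b) x \<Longrightarrow> singular_chain j (Gam n B b) (dh n j x)"
  unfolding dh_def
  by (intro singular_chain_sum singular_chain_cmul singular_chain_chain_map[OF _ cm_gface]) auto

lemma chain_boundary_dh:
  assumes "singular_chain j (Gam (Suc n) B b) x"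
  shows "chain_boundary j (dh n j x) = dh n (j - Suc 0) (chain_boundary j x)"
  unfolding dh_def chain_boundary_sum o_def chain_boundary_cmul chain_boundary_chain_map[OF assms] ..

lemma dh_dh:
  assumes x: "singular_chain j (Gam (Suc (Suc n)) B b) x"
  shows "dh n j (dh (Suc n) j x) = 0"
proof -
  define F where "F k l = chain_map j (gface n k) (chain_map j (gface (Suc n) l) x)" for k l
  define G where "G = (\<lambda>(k, l). frag_cmul ((-1) ^ (k + l)) (F k l))"
  let ?A = "{(k, l). k < l \<and> l \<le> Suc (Suc n)}" and ?B = "{(k, l). l \<le> k \<and> k \<le> Suc n}"
  have F: "F k l = F (l - 1) k" if "k < l" "l \<le> Suc (Suc n)" for k l
    unfolding F_def using gface_gface[OF that] by (intro chain_map_comp_eq[OF x]) auto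
  have "dh n j (dh (Suc n) j x) = (\<Sum>k\<le>Suc n. \<Sum>l\<le>Suc (Suc n). G (k, l))"
    unfolding dh_def G_def F_def
    by (simp add: chain_map_sum frag_cmul_sum o_def power_add frag_cmul_cmul del: sum.atMost_Suc)
  also have "\<dots> = sum G ({..Suc n} \<times> {..Suc (Suc n)})"
    by (simp add: sum.cartesian_product del: sum.atMost_Suc)
  also have "{..Suc n} \<times> {..Suc (Suc n)} = ?A \<union> ?B" by auto
  also have "sum G (?A \<union> ?B) = sum G ?A + sum G ?B"
  proof (rule sum.union_disjoint)
    have "?A \<subseteq> {..Suc n} \<times> {..Suc (Suc n)}" "?B \<subseteq> {..Suc n} \<times> {..Suc (Suc n)}" by auto
    then show "finite ?A" "finite ?B" by (meson finite_SigmaI finite_atMost finite_subset)+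
  qed auto
  also have "sum G ?A = (\<Sum>z\<in>?B. - G z)"
  \<comment> \<open>The simplicial identity pairs (k, l), where k < l, with (l - 1, k). The sums of
    the indices differ by one, so the two terms cancel.\<close>
  proof (rule sum.reindex_bij_witness[where i = "\<lambda>(k, l). (l, Suc k)" and j = "\<lambda>(k, l). (l - 1, k)"])
    fix a assume "a \<in> ?A"
    then obtain k l where a: "a = (k, l)" and kl: "k < l" "l \<le> Suc (Suc n)" by auto
    have "(-1 :: int) ^ (k + l) = - ((-1) ^ (l - 1 + k))"
      using kl by (cases l) (auto simp: add.commute)
    then show "- G (case a of (k, l) \<Rightarrow> (l - 1, k)) = G a"
      using F[OF kl] by (simp add: G_def a)
  qed auto
  finally show ?thesis by (simp add: sum_negf)
qed

section \<open>Projection to the base, naturality, and the fibre\<close>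

abbreviation vert0 :: "nat \<Rightarrow> real" where
  "vert0 \<equiv> (\<lambda>j. if j = 0 then 1 else 0)"

lemma vert0_in: "vert0 \<in> standard_simplex n"
  by simp

text \<open>The edge map to the chains of the base. It is applied to 0-chains of a column, whose
  simplices are single points, and evaluation at \<open>vert0\<close> reads off that point.\<close>

definition pr :: "'b path_simplex chain \<Rightarrow> 'b chain" where
  "pr x = frag_extend (\<lambda>\<sigma>. frag_of (fst (\<sigma> vert0))) x"

lemma pr_0 [simp]: "pr 0 = 0" by (simp add: pr_def)
lemma pr_of: "pr (frag_of \<sigma>) = frag_of (fst (\<sigma> vert0))" by (simp add: pr_def)
lemma pr_add: "pr (x + y) = pr x + pr y" by (simp add: pr_def frag_extend_add)
lemma pr_diff: "pr (x - y) = pr x - pr y" by (simp add: pr_def frag_extend_diff)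
lemma pr_cmul: "pr (frag_cmul c x) = frag_cmul c (pr x)" by (simp add: pr_def frag_extend_cmul)
lemma pr_sum: "finite I \<Longrightarrow> pr (sum f I) = (\<Sum>i\<in>I. pr (f i))"
  by (induction I rule: finite_induct) (auto simp: pr_add)

lemma singular_chain_pr:
  assumes "singular_chain 0 (Gam n B b) x"
  shows "singular_chain n B (pr x)"
  unfolding pr_def
proof (rule singular_chain_extend)
  fix \<sigma> assume "\<sigma> \<in> Poly_Mapping.keys x"
  then have "singular_simplex 0 (Gam n B b) \<sigma>" using assms by (auto simp: singular_chain_def)
  then have "\<sigma> vert0 \<in> topspace (Gam n B b)"
    using vert0_in[of 0] by (auto simp: singular_simplex_def continuous_map_def)
  then show "singular_chain n B (frag_of (fst (\<sigma> vert0)))"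
    by (simp add: singular_chain_of topspace_Gam)
qed

lemma pr_dh:
  shows "pr (dh n 0 x) = chain_boundary (Suc n) (pr x)"
proof (induction x rule: frag_induction[OF subset_UNIV])
  case (2 \<sigma>)
  have "dh n 0 (frag_of \<sigma>) = (\<Sum>k\<le>Suc n. frag_cmul ((-1) ^ k) (frag_of (simplex_map 0 (gface n k) \<sigma>)))"
    unfolding dh_def chain_map_of ..
  moreover have "fst (simplex_map 0 (gface n k) \<sigma> vert0) = singular_face (Suc n) k (fst (\<sigma> vert0))" for k
    using vert0_in[of 0] by (simp add: simplex_map_def gface_def)
  ultimately show ?case
    by (simp add: pr_of chain_boundary_of pr_sum pr_cmul del: sum.atMost_Suc)
qed (simp_all add: dh_diff pr_diff chain_boundary_diff)

text \<open>The two ends of a 1-simplex of a column lie over the same simplex of the base, so their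
  projections cancel.\<close>

lemma pr_chain_boundary:
  assumes "singular_chain (Suc 0) (Gam n B b) x"
  shows "pr (chain_boundary (Suc 0) x) = 0"
  using assms unfolding singular_chain_def
proof (induction x rule: frag_induction)
  case (one \<sigma>)
  then have s: "singular_simplex (Suc 0) (Gam n B b) \<sigma>" by simp
  have f: "fst (singular_face (Suc 0) k \<sigma> vert0) = fst (\<sigma> vert0)" if "k \<le> Suc 0" for k
    using vert0_in[of 0] singular_simplex_Gam_fst[OF s face_in_simplex[OF that vert0_in] vert0_in]
    by (simp add: singular_face_def)
  show ?case
    using f[of 0] f[of "Suc 0"] by (simp add: chain_boundary_of pr_add pr_diff pr_of pr_cmul)
qed (simp_all add: chain_boundary_diff pr_diff)

section \<open>Naturality in the base space, and the inclusion of the fibre\<close>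

definition gmap :: "nat \<Rightarrow> ('b \<Rightarrow> 'c) \<Rightarrow> 'b path_simplex \<Rightarrow>
    'c path_simplex" where
  "gmap n v z = (simplex_map n v (fst z), restrict (v \<circ> snd z) (cylset n))"

lemma cm_gmap:
  assumes v: "continuous_map B B' v"
  shows "continuous_map (Gam n B b) (Gam n B' (v b)) (gmap n v)"
proof (rule cm_into_Gam)
  show "continuous_map (Gam n B b) (discrete_topology (singular_simplex_set n B')) (\<lambda>w. fst (gmap n v w))"
    unfolding gmap_def fst_conv
    by (rule cm_discrete_map[OF cm_Gam_fst]) (use singular_simplex_simplex_map v in auto)
  show "continuous_map (prod_topology (Gam n B b) (cyl n)) B' (\<lambda>z. snd (gmap n v (fst z)) (snd z))"
    unfolding gmap_def snd_conv
  proof (rule cm_restrict)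
    have "continuous_map (prod_topology (Gam n B b) (cyl n)) B (\<lambda>z. snd (fst z) (fst (snd z), snd (snd z)))"
      by (intro cm_Gam_eval[of _ n B b] cm_cyl_pt cm_cyl_time cm_fst')
    from cm_comp[OF v this] 
    show "continuous_map (prod_topology (Gam n B b) (cyl n)) B' (\<lambda>z. (v \<circ> snd (fst z)) (snd z))"
      by simp
  qed simp
qed (auto simp: gmap_def topspace_Gam simplex_map_def lifts_def)

lemma gmap_gface:
  assumes "k \<le> Suc n"
  shows "gface n k (gmap (Suc n) v z) = gmap n v (gface n k z)"
proof -
  have "singular_face (Suc n) k (simplex_map (Suc n) v (fst z)) = simplex_map n v (singular_face (Suc n) k (fst z))"
    by (rule ext) (use face_in_simplex[OF assms] in \<open>simp add: singular_face_def simplex_map_def restrict_def\<close>)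
  moreover have "restrict (\<lambda>(x, t). snd (gmap (Suc n) v z) (simplical_face k x, t)) (cylset n) =
      restrict (v \<circ> snd (gface n k z)) (cylset n)"
    by (rule ext) (use face_in_simplex[OF assms] in \<open>simp add: restrict_def gmap_def gface_def split: prod.splits\<close>)
  ultimately show ?thesis
    by (simp add: gface_def[of n k "gmap (Suc n) v z"] gmap_def[of n]) (simp add: gmap_def gface_def)
qed

lemma dh_gmap:
  assumes x: "singular_chain j (Gam (Suc n) B b) x"
  shows "dh n j (chain_map j (gmap (Suc n) v) x) = chain_map j (gmap n v) (dh n j x)"
proof -
  have "chain_map j (gface n k) (chain_map j (gmap (Suc n) v) x) = chain_map j (gmap n v) (chain_map j (gface n k) x)"
    if "k \<le> Suc n" for k
    using gmap_gface[OF that] by (intro chain_map_comp_eq[OF x]) auto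
  then show ?thesis
    unfolding dh_def by (simp add: chain_map_sum o_def del: sum.atMost_Suc)
qed

lemma pr_gmap: "pr (chain_map 0 (gmap n v) x) = chain_map n v (pr x)"
proof (induction x rule: frag_induction[OF subset_UNIV])
  case (2 \<sigma>)
  show ?case using vert0_in[of 0] by (simp add: pr_of simplex_map_def gmap_def)
qed (simp_all add: chain_map_diff pr_diff)

definition fibre :: "'b \<Rightarrow> (real \<Rightarrow> 'b) \<Rightarrow> 'b path_simplex" where
  "fibre b g = (restrict (\<lambda>_. b) (standard_simplex 0), restrict (\<lambda>(x, t). g t) (cylset 0))"

lemma singular_simplex_const: "b \<in> topspace B \<Longrightarrow> singular_simplex n B (restrict (\<lambda>_. b) (standard_simplex n))"
  unfolding singular_simplex_def
  by (auto intro: continuous_map_eq[OF cm_const])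

lemma cm_fibre:
  assumes b: "b \<in> topspace B"
  shows "continuous_map (loop_space B b) (Gam 0 B b) (fibre b)"
proof (rule cm_into_Gam)
  show "continuous_map (loop_space B b) (discrete_topology (singular_simplex_set 0 B)) (\<lambda>w. fst (fibre b w))"
    using singular_simplex_const[OF b] by (simp add: fibre_def)
  show "continuous_map (prod_topology (loop_space B b) (cyl 0)) B (\<lambda>z. snd (fibre b (fst z)) (snd z))"
    unfolding fibre_def snd_conv
    by (rule cm_restrict)
       (simp_all add: case_prod_beta, intro cm_loop_eval[of _ B b] cm_fst' cm_cyl_time)
qed (auto simp: fibre_def topspace_loop_space loops_def)

lemma gmap_fibre:
  shows "gmap 0 v (fibre b g) = fibre (v b) (loop_map v g)"
  by (auto simp: gmap_def fibre_def simplex_map_def loop_map_def restrict_def fun_eq_iff)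

section \<open>Exactness of the rows\<close>

definition mix :: "real \<Rightarrow> (nat \<Rightarrow> real) \<Rightarrow> (nat \<Rightarrow> real) \<Rightarrow> nat \<Rightarrow> real" where
  "mix c x y = (\<lambda>i. (1 - c) * x i + c * y i)"

lemma mix_in:
  "x \<in> standard_simplex n \<Longrightarrow> y \<in> standard_simplex n \<Longrightarrow> 0 \<le> c \<Longrightarrow> c \<le> 1 \<Longrightarrow> mix c x y \<in> standard_simplex n"
  unfolding mix_def by (rule convex_standard_simplex)

lemma mix_0 [simp]: "mix 0 x y = x" and mix_1 [simp]: "mix 1 x y = y"
  and mix_same [simp]: "mix c x x = x"
  by (simp_all add: mix_def fun_eq_iff algebra_simps)

lemma cm_mix:
  assumes "continuous_map W euclideanreal c" "continuous_map W (simplex_top n) x" "continuous_map W (simplex_top n) y"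
    and "\<And>w. w \<in> topspace W \<Longrightarrow> 0 \<le> c w \<and> c w \<le> 1"
  shows "continuous_map W (simplex_top n) (\<lambda>w. mix (c w) (x w) (y w))"
  unfolding cm_simplex
proof (intro conjI allI ballI)
  show "continuous_map W euclideanreal (\<lambda>w. mix (c w) (x w) (y w) k)" for k
    unfolding mix_def by (intro continuous_intros cm_simplex_coord[OF assms(2)] cm_simplex_coord[OF assms(3)] assms(1))
  show "mix (c w) (x w) (y w) \<in> standard_simplex n" if "w \<in> topspace W" for w
    using assms that by (intro mix_in) (auto simp: cm_simplex)
qed

text \<open>A contraction of the path over \<open>x\<close>, from the constant \<open>b\<close> at s
  = 0 to the path of \<open>\<sigma> y\<close> at s = 1. Its end point must not depend on
  \<open>y\<close>, since a simplex of a column lies over one base simplex. So for s \<le> 1/2 only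
  the path of \<open>\<sigma> vert0\<close> is lengthened, and once it has reached the base simplex
  the parameter moves from \<open>vert0\<close> to \<open>y\<close>.\<close>

definition shrink :: "((nat \<Rightarrow> real) \<Rightarrow> 'b path_simplex) \<Rightarrow>
    real \<Rightarrow> (nat \<Rightarrow> real) \<Rightarrow> (nat \<Rightarrow> real) \<Rightarrow> real \<Rightarrow> 'b" where
  "shrink \<sigma> s x y t = (if s \<le> 1/2 then snd (\<sigma> vert0) (x, 2 * s * t) else snd (\<sigma> (mix (2 * s - 1) vert0 y)) (x, t))"

lemma cm_shrink:
  assumes \<sigma>: "singular_simplex j (Gam n B b) \<sigma>"
    and s: "continuous_map W unit_interval s" and x: "continuous_map W (simplex_top n) x"
    and y: "continuous_map W (simplex_top j) y" and t: "continuous_map W unit_interval t"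
  shows "continuous_map W B (\<lambda>w. shrink \<sigma> (s w) (x w) (y w) (t w))"
  unfolding shrink_def
proof (rule cm_if_le)
  show s': "continuous_map W euclideanreal s" using s by (rule cm_interval_real)
  have t': "continuous_map W euclideanreal t" using t by (rule cm_interval_real)
  show "continuous_map W euclideanreal (\<lambda>_. 1/2)" by simp
  let ?W = "subtopology W {w \<in> topspace W. s w \<le> 1/2}"
  have "continuous_map ?W unit_interval (\<lambda>w. 2 * s w * t w)"
    unfolding cm_interval
  proof (intro conjI ballI)
    show "continuous_map ?W euclideanreal (\<lambda>w. 2 * s w * t w)"
      by (intro continuous_intros cm_sub s' t')
    fix w assume "w \<in> topspace ?W"
    then have "0 \<le> s w" "s w \<le> 1/2" "0 \<le> t w" "t w \<le> 1" using s t by (auto simp: cm_interval)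
    then show "0 \<le> 2 * s w * t w" "2 * s w * t w \<le> 1"
      using mult_mono[of "2 * s w" 1 "t w" 1] by auto
  qed
  then show "continuous_map ?W B (\<lambda>w. snd (\<sigma> vert0) (x w, 2 * s w * t w))"
    by (intro cm_Gam_eval[of _ n B b] cm_sub[OF x] cm_singular[OF \<sigma>] cm_const) (auto simp: vert0_in)
  let ?V = "subtopology W {w \<in> topspace W. 1/2 \<le> s w}"
  have "continuous_map ?V (simplex_top j) (\<lambda>w. mix (2 * s w - 1) vert0 (y w))"
  proof (rule cm_mix)
    show "continuous_map ?V euclideanreal (\<lambda>w. 2 * s w - 1)"
      by (intro continuous_intros cm_sub s')
    show "\<And>w. w \<in> topspace ?V \<Longrightarrow> 0 \<le> 2 * s w - 1 \<and> 2 * s w - 1 \<le> 1"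
      using s by (auto simp: cm_interval)
  qed (auto intro: cm_sub y simp: vert0_in)
  then show "continuous_map ?V B (\<lambda>w. snd (\<sigma> (mix (2 * s w - 1) vert0 (y w))) (x w, t w))"
    by (intro cm_Gam_eval[of _ n B b] cm_sub[OF x] cm_sub[OF t] cm_singular[OF \<sigma>])
  fix w assume "s w = 1/2"
  then have e: "2 * s w = 1" by simp
  show "snd (\<sigma> vert0) (x w, 2 * s w * t w) = snd (\<sigma> (mix (2 * s w - 1) vert0 (y w))) (x w, t w)" by (simp add: e)
qed

lemma simplex_in_Gam:
  "singular_simplex j (Gam n B b) \<sigma> \<Longrightarrow> y \<in> standard_simplex j \<Longrightarrow> \<sigma> y \<in> topspace (Gam n B b)"
  by (auto simp: singular_simplex_def continuous_map_def)

lemma shrink_0: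
  assumes "singular_simplex j (Gam n B b) \<sigma>" "x \<in> standard_simplex n"
  shows "shrink \<sigma> 0 x y t = b"
  using simplex_in_Gam[OF assms(1) vert0_in] assms(2) by (simp add: shrink_def topspace_Gam lifts_def)

lemma shrink_1: "shrink \<sigma> 1 x y t = snd (\<sigma> y) (x, t)"
  by (simp add: shrink_def)

text \<open>While the path is being lengthened \<open>y\<close> does not occur; afterwards the end
  point lies on the base simplex, which is the same for all points of the
  \<open>j\<close>-simplex.\<close>

lemma shrink_end:
  assumes "singular_simplex j (Gam n B b) \<sigma>" "x \<in> standard_simplex n" "y \<in> standard_simplex j" "s \<le> 1"
  shows "shrink \<sigma> s x y 1 = shrink \<sigma> s x vert0 1"
proof (cases "s \<le> 1/2")
  case False
  then have m: "mix (2 * s - 1) vert0 y \<in> standard_simplex j"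
    using assms by (intro mix_in) (auto simp: vert0_in)
  then have "fst (\<sigma> (mix (2 * s - 1) vert0 y)) x = fst (\<sigma> vert0) x"
    using singular_simplex_Gam_fst[OF assms(1) m vert0_in] by simp
  then show ?thesis
    using False assms(2) simplex_in_Gam[OF assms(1) m] simplex_in_Gam[OF assms(1) vert0_in]
    by (simp add: shrink_def topspace_Gam)
qed (simp add: shrink_def)

text \<open>Join coordinates: \<open>u\<close> is the join of vertex 0, with weight
  \<open>u 0\<close>, and of the point \<open>base_pt u\<close> of the opposite face. At that vertex
  the quotient is meaningless, which \<open>cone_fun\<close> covers by a case of its own.\<close>

definition base_pt :: "(nat \<Rightarrow> real) \<Rightarrow> nat \<Rightarrow> real" where
  "base_pt u = (\<lambda>i. u (Suc i) / (1 - u 0))"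

lemma sum_Suc_split: "(\<Sum>i\<le>Suc n. (u::nat\<Rightarrow>real) i) = u 0 + (\<Sum>i\<le>n. u (Suc i))"
  by (rule sum.atMost_Suc_shift)

lemma base_pt_in:
  assumes u: "u \<in> standard_simplex (Suc n)" and u0: "u 0 \<noteq> 1"
  shows "base_pt u \<in> standard_simplex n"
proof -
  have pos: "1 - u 0 > 0" using u u0 by (simp add: standard_simplex_def order_less_le)
  have S: "(\<Sum>i\<le>n. u (Suc i)) = 1 - u 0"
    using u sum_Suc_split[of u n] by (simp add: standard_simplex_def del: sum.atMost_Suc)
  have nn: "0 \<le> u i" for i using u by (simp add: standard_simplex_def)
  have "u (Suc i) \<le> 1 - u 0" for i
  proof (cases "i \<le> n")
    case True
    then show ?thesis using member_le_sum[of i "{..n}" "\<lambda>i. u (Suc i)"] nn S by simp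
  next
    case False
    then have "u (Suc i) = 0" using u by (simp add: standard_simplex_def)
    then show ?thesis using pos by simp
  qed
  then show ?thesis
    using pos S nn u by (simp add: standard_simplex_def base_pt_def flip: sum_divide_distrib)
qed

definition cone_fun :: "'b \<Rightarrow> ((nat \<Rightarrow> real) \<Rightarrow> 'b path_simplex) \<Rightarrow>
    (nat \<Rightarrow> real) \<Rightarrow> (nat \<Rightarrow> real) \<times> real \<Rightarrow> 'b" where
  "cone_fun b \<sigma> y z = (if fst z 0 = 1 then b else shrink \<sigma> (1 - fst z 0) (base_pt (fst z)) y (snd z))"

definition join_pt :: "real \<Rightarrow> (nat \<Rightarrow> real) \<Rightarrow> nat \<Rightarrow> real" where
  "join_pt s x = (\<lambda>i. case i of 0 \<Rightarrow> 1 - s | Suc k \<Rightarrow> s * x k)"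

lemma join_pt_in:
  assumes "x \<in> standard_simplex n" "0 \<le> s" "s \<le> 1"
  shows "join_pt s x \<in> standard_simplex (Suc n)"
proof -
  have "(\<Sum>i\<le>Suc n. join_pt s x i) = 1"
    unfolding sum_Suc_split using assms(1) by (simp add: join_pt_def standard_simplex_def flip: sum_distrib_left)
  then show ?thesis
    using assms mult_le_one by (auto simp: standard_simplex_def join_pt_def split: nat.split)
qed

lemma join_base_pt:
  assumes "u \<in> standard_simplex (Suc n)" "u 0 \<noteq> 1"
  shows "join_pt (1 - u 0) (base_pt u) = u"
  using assms(2) by (auto simp: join_pt_def base_pt_def fun_eq_iff split: nat.split)

lemma join_pt_1:
  assumes u: "u \<in> standard_simplex (Suc n)" "u 0 = 1"
  shows "u = join_pt 0 x"
proof
  fix i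
  have "u (Suc k) = 0" for k
  proof (cases "k \<le> n")
    case True
    have "(\<Sum>i\<le>n. u (Suc i)) = 0"
      using u sum_Suc_split[of u n] by (simp add: standard_simplex_def del: sum.atMost_Suc)
    then show ?thesis
      using True u sum_nonneg_eq_0_iff[of "{..n}" "\<lambda>i. u (Suc i)"] by (simp add: standard_simplex_def)
  next
    case False
    then show ?thesis using u by (simp add: standard_simplex_def)
  qed
  then show "u i = join_pt 0 x i"
    using u by (simp add: join_pt_def split: nat.split)
qed

text \<open>Continuity at the new vertex, where \<open>base_pt\<close> has no limit, comes from
  compactness: \<open>join_pt\<close> makes the simplex a quotient of interval times opposite face,
  and at s = 0, where it collapses, \<open>shrink\<close> is constantly \<open>b\<close>.\<close>

lemma cm_cone_fun:
  assumes \<sigma>: "singular_simplex j (Gam n B b) \<sigma>"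
  shows "continuous_map (prod_topology (simplex_top j) (cyl (Suc n))) B (\<lambda>z. cone_fun b \<sigma> (fst z) (snd z))"
proof -
  let ?P = "prod_topology (prod_topology (simplex_top j) unit_interval) (prod_topology unit_interval (simplex_top n))"
  let ?Q = "prod_topology (simplex_top j) (cyl (Suc n))"
  let ?q = "\<lambda>p. (fst (fst p), (join_pt (fst (snd p)) (snd (snd p)), snd (fst p)))"
  have c: "continuous_map ?P (simplex_top j) (\<lambda>p. fst (fst p))" "continuous_map ?P unit_interval (\<lambda>p. snd (fst p))"
    "continuous_map ?P unit_interval (\<lambda>p. fst (snd p))" "continuous_map ?P (simplex_top n) (\<lambda>p. snd (snd p))"
    by (rule cm_fst[OF cm_fst'], rule cm_snd[OF cm_fst'], rule cm_fst[OF cm_snd'], rule cm_snd[OF cm_snd'])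
  have "continuous_map ?P (simplex_top (Suc n)) (\<lambda>p. join_pt (fst (snd p)) (snd (snd p)))"
    unfolding cm_simplex
  proof (intro conjI allI ballI)
    show "continuous_map ?P euclideanreal (\<lambda>p. join_pt (fst (snd p)) (snd (snd p)) k)" for k
      unfolding join_pt_def
      by (cases k) (simp_all, (intro continuous_intros cm_interval_real[OF c(3)] cm_simplex_coord[OF c(4)])+)
  qed (auto intro: join_pt_in)
  then have q: "continuous_map ?P ?Q ?q"
    by (intro continuous_map_pairedI c)
  have img: "?q ` topspace ?P = topspace ?Q"
  proof
    show "?q ` topspace ?P \<subseteq> topspace ?Q" using continuous_map_image_subset_topspace[OF q] .
    show "topspace ?Q \<subseteq> ?q ` topspace ?P"
    proof
      fix w assume "w \<in> topspace ?Q"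
      then obtain y u t where w: "w = (y, (u, t))" and y: "y \<in> standard_simplex j" and u: "u \<in> standard_simplex (Suc n)"
        and t: "t \<in> {0..1}" by auto
      show "w \<in> ?q ` topspace ?P"
      proof (cases "u 0 = 1")
        case True
        then have "w = ?q ((y, t), (0, vert0))" using w join_pt_1[OF u] by simp
        moreover have "((y, t), (0, vert0)) \<in> topspace ?P" using y t vert0_in[of n] by simp
        ultimately show ?thesis by (rule image_eqI)
      next
        case False
        then have "w = ?q ((y, t), (1 - u 0, base_pt u))" using w join_base_pt[OF u] by simp
        moreover have "1 - u 0 \<in> {0..1}" using u by (simp add: standard_simplex_def)
        ultimately have "((y, t), (1 - u 0, base_pt u)) \<in> topspace ?P" "w = ?q ((y, t), (1 - u 0, base_pt u))"
          using y t base_pt_in[OF u False] by simp_all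
        then show ?thesis by (intro image_eqI)
      qed
    qed
  qed
  have "compact_space ?P" "Hausdorff_space ?Q"
    by (simp_all add: compact_space_prod_topology compact_simplex_top compact_unit_interval
      Hausdorff_space_prod_topology Hausdorff_simplex_top Hausdorff_unit_interval del: topspace_prod_topology)
  from continuous_imp_quotient_map[OF q this(1,2) img] have quo: "quotient_map ?P ?Q ?q" .
  show ?thesis
  proof (rule continuous_compose_quotient_map[OF quo])
    have "continuous_map ?P B (\<lambda>p. shrink \<sigma> (fst (snd p)) (snd (snd p)) (fst (fst p)) (snd (fst p)))"
      by (rule cm_shrink[OF \<sigma> c(3,4,1,2)])
    then show "continuous_map ?P B ((\<lambda>z. cone_fun b \<sigma> (fst z) (snd z)) \<circ> ?q)"
    proof (rule continuous_map_eq)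
      fix p assume p: "p \<in> topspace ?P"
      then obtain y t s x where p: "p = ((y, t), (s, x))" "x \<in> standard_simplex n" by auto
      have "join_pt s x 0 = 1 - s" "s \<noteq> 0 \<Longrightarrow> base_pt (join_pt s x) = x"
        by (auto simp: join_pt_def base_pt_def)
      then show "shrink \<sigma> (fst (snd p)) (snd (snd p)) (fst (fst p)) (snd (fst p)) =
          ((\<lambda>z. cone_fun b \<sigma> (fst z) (snd z)) \<circ> ?q) p"
        using shrink_0[OF \<sigma> p(2)] by (simp add: p cone_fun_def)
    qed
  qed
qed

text \<open>The base simplex has to be the same for all \<open>y\<close>, so it is read off at
  \<open>vert0\<close>; by \<open>cone_fun_end\<close> any other point gives the same.\<close>

definition cone_simplex :: "'b \<Rightarrow> nat \<Rightarrow> nat \<Rightarrow>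
    ((nat \<Rightarrow> real) \<Rightarrow> 'b path_simplex) \<Rightarrow>
    ((nat \<Rightarrow> real) \<Rightarrow> 'b path_simplex)" where
  "cone_simplex b n j \<sigma> = restrict (\<lambda>y.
     (restrict (\<lambda>u. cone_fun b \<sigma> vert0 (u, 1)) (standard_simplex (Suc n)),
      restrict (cone_fun b \<sigma> y) (cylset (Suc n)))) (standard_simplex j)"

lemma cone_fun_end:
  assumes \<sigma>: "singular_simplex j (Gam n B b) \<sigma>" and "u \<in> standard_simplex (Suc n)" "y \<in> standard_simplex j"
  shows "cone_fun b \<sigma> y (u, 1) = cone_fun b \<sigma> vert0 (u, 1)"
  using shrink_end[OF \<sigma> base_pt_in[OF assms(2)] assms(3), of "1 - u 0"] assms(2)
  by (auto simp: cone_fun_def standard_simplex_def)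

lemma cone_fun_start:
  assumes \<sigma>: "singular_simplex j (Gam n B b) \<sigma>" and u: "u \<in> standard_simplex (Suc n)" and y: "y \<in> standard_simplex j"
  shows "cone_fun b \<sigma> y (u, 0) = b"
proof (cases "u 0 = 1")
  case False
  have m: "mix (2 * (1 - u 0) - 1) vert0 y \<in> standard_simplex j" if "\<not> 1 - u 0 \<le> 1/2"
    using that u y by (intro mix_in) (auto simp: standard_simplex_def vert0_in)
  show ?thesis
    using simplex_in_Gam[OF \<sigma> vert0_in] simplex_in_Gam[OF \<sigma> m] base_pt_in[OF u False] False
    by (auto simp: cone_fun_def shrink_def topspace_Gam lifts_def)
qed (simp add: cone_fun_def)

lemma singular_simplex_cone_simplex:
  assumes \<sigma>: "singular_simplex j (Gam n B b) \<sigma>"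
  shows "singular_simplex j (Gam (Suc n) B b) (cone_simplex b n j \<sigma>)"
  unfolding singular_simplex_def
proof
  let ?f = "\<lambda>y. (restrict (\<lambda>u. cone_fun b \<sigma> vert0 (u, 1)) (standard_simplex (Suc n)),
      restrict (cone_fun b \<sigma> y) (cylset (Suc n)))"
  have "continuous_map (simplex_top j) (Gam (Suc n) B b) ?f"
  proof (rule cm_into_Gam)
    have "continuous_map (simplex_top (Suc n)) B (\<lambda>u. (\<lambda>z. cone_fun b \<sigma> (fst z) (snd z)) (vert0, (u, 1)))"
      by (rule cm_comp[OF cm_cone_fun[OF \<sigma>]]) (intro continuous_map_pairedI cm_id cm_const; simp add: vert0_in)
    then have "continuous_map (simplex_top (Suc n)) B (restrict (\<lambda>u. cone_fun b \<sigma> vert0 (u, 1)) (standard_simplex (Suc n)))"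
      by (rule continuous_map_eq) simp
    then show "continuous_map (simplex_top j) (discrete_topology (singular_simplex_set (Suc n) B)) (\<lambda>w. fst (?f w))"
      by (simp add: singular_simplex_def)
    show "continuous_map (prod_topology (simplex_top j) (cyl (Suc n))) B (\<lambda>z. snd (?f (fst z)) (snd z))"
      unfolding snd_conv by (rule cm_restrict[OF cm_cone_fun[OF \<sigma>]]) simp
  qed (auto intro: cone_fun_end[OF \<sigma>] cone_fun_start[OF \<sigma>])
  then show "continuous_map (simplex_top j) (Gam (Suc n) B b) (cone_simplex b n j \<sigma>)"
    by (rule continuous_map_eq) (simp add: cone_simplex_def)
qed (simp add: cone_simplex_def)

lemma face_0_in: "x \<in> standard_simplex n \<Longrightarrow> base_pt (simplical_face 0 x) = x \<and> simplical_face 0 x 0 = 0"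
  by (simp add: base_pt_def simplical_face_def)

text \<open>On the face opposite to the new vertex \<open>u 0\<close> is 0, so \<open>shrink\<close>
  stands at s = 1, where it returns the paths of \<open>\<sigma>\<close>.\<close>

lemma face_0_cone_simplex:
  assumes \<sigma>: "singular_simplex j (Gam n B b) \<sigma>"
  shows "simplex_map j (gface n 0) (cone_simplex b n j \<sigma>) = \<sigma>"
proof
  fix y
  show "simplex_map j (gface n 0) (cone_simplex b n j \<sigma>) y = \<sigma> y"
  proof (cases "y \<in> standard_simplex j")
    case False
    then show ?thesis using \<sigma> by (simp add: simplex_map_def singular_simplex_def extensional_def)
  next
    case y: True
    have G: "\<sigma> y \<in> topspace (Gam n B b)" "\<sigma> vert0 \<in> topspace (Gam n B b)"
      using simplex_in_Gam[OF \<sigma>] y vert0_in by auto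
    have c: "cone_fun b \<sigma> y' (simplical_face 0 x, t) = snd (\<sigma> y') (x, t)" if "x \<in> standard_simplex n" for y' x t
      using face_0_in[OF that] by (simp add: cone_fun_def shrink_1)
    have "fst (gface n 0 (cone_simplex b n j \<sigma> y)) x = fst (\<sigma> y) x" for x
    proof (cases "x \<in> standard_simplex n")
      case True
      have "fst (\<sigma> vert0) x = fst (\<sigma> y) x" using singular_simplex_Gam_fst[OF \<sigma> vert0_in y] by simp
      then show ?thesis
        using True y G face_in_simplex[of 0 n x]
        by (simp add: gface_def cone_simplex_def singular_face_def c topspace_Gam)
    next
      case False
      then show ?thesis
        using G by (simp add: gface_def singular_face_def topspace_Gam singular_simplex_def extensional_def)
    qed
    moreover have "snd (gface n 0 (cone_simplex b n j \<sigma> y)) z = snd (\<sigma> y) z" for z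
    proof (cases "z \<in> cylset n")
      case True
      then show ?thesis
        using y face_in_simplex[of 0 n "fst z"]
        by (auto simp: gface_def cone_simplex_def c)
    next
      case False
      then show ?thesis
        using G by (simp add: gface_def topspace_Gam lifts_def extensional_arb[of _ "cylset n"])
    qed
    ultimately show ?thesis
      using y by (simp add: simplex_map_def prod_eq_iff fun_eq_iff)
  qed
qed

lemma base_pt_face:
  assumes "k \<le> Suc n"
  shows "base_pt (simplical_face (Suc k) u) = simplical_face k (base_pt u)" "simplical_face (Suc k) u 0 = u 0"
  by (auto simp: base_pt_def simplical_face_def fun_eq_iff)

text \<open>A face of positive index contains the new vertex and keeps its weight, so coning
  commutes with it up to the shift of the index.\<close>

lemma face_Suc_cone_simplex:
  assumes \<sigma>: "singular_simplex j (Gam (Suc n) B b) \<sigma>" and k: "k \<le> Suc n"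
  shows "simplex_map j (gface (Suc n) (Suc k)) (cone_simplex b (Suc n) j \<sigma>) =
     cone_simplex b n j (simplex_map j (gface n k) \<sigma>)"
proof -
  have c: "cone_fun b \<sigma> y (simplical_face (Suc k) u, t) = cone_fun b (simplex_map j (gface n k) \<sigma>) y (u, t)"
    if u: "u \<in> standard_simplex (Suc n)" and y: "y \<in> standard_simplex j" and t: "t \<in> {0..1}" for u y t
  proof (cases "u 0 = 1")
    case False
    have x: "base_pt u \<in> standard_simplex n" using base_pt_in[OF u False] .
    have m: "mix (2 * (1 - u 0) - 1) vert0 y \<in> standard_simplex j" if "\<not> 1 - u 0 \<le> 1/2"
      using that u y by (intro mix_in) (auto simp: standard_simplex_def vert0_in)
    have "0 \<le> 2 * (1 - u 0) * t" using u t by (simp add: standard_simplex_def)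
    moreover have "2 * (1 - u 0) * t \<le> 1" if "1 - u 0 \<le> 1/2"
      using t that u mult_mono[of "2 * (1 - u 0)" 1 t 1] by (auto simp: standard_simplex_def)
    ultimately show ?thesis
      using False base_pt_face[OF k] x m t vert0_in[of j]
      by (simp add: cone_fun_def shrink_def simplex_map_def gface_def)
  qed (simp add: cone_fun_def base_pt_face[OF k])
  have "gface (Suc n) (Suc k) (cone_simplex b (Suc n) j \<sigma> y) = cone_simplex b n j (simplex_map j (gface n k) \<sigma>) y"
    if y: "y \<in> standard_simplex j" for y
  proof -
    have k': "Suc k \<le> Suc (Suc n)" using k by simp
    have "singular_face (Suc (Suc n)) (Suc k)
        (restrict (\<lambda>u. cone_fun b \<sigma> vert0 (u, 1)) (standard_simplex (Suc (Suc n)))) =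
        restrict (\<lambda>u. cone_fun b (simplex_map j (gface n k) \<sigma>) vert0 (u, 1)) (standard_simplex (Suc n))"
      by (rule ext) (use c[OF _ vert0_in, of _ 1] face_in_simplex[OF k'] in \<open>simp add: singular_face_def restrict_def\<close>)
    moreover have "restrict (\<lambda>(x, t). restrict (cone_fun b \<sigma> y) (cylset (Suc (Suc n))) (simplical_face (Suc k) x, t)) (cylset (Suc n))
       = restrict (cone_fun b (simplex_map j (gface n k) \<sigma>) y) (cylset (Suc n))"
      by (rule ext) (use c[OF _ y] face_in_simplex[OF k'] in \<open>simp add: restrict_def split: prod.splits\<close>)
    ultimately show ?thesis
      using y by (simp add: gface_def[of "Suc n"] cone_simplex_def)
  qed
  then show ?thesis
    by (auto simp: simplex_map_def[of j "gface (Suc n) (Suc k)"] cone_simplex_def[of b n] fun_eq_iff restrict_def)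
qed

definition base_simplex :: "'b \<Rightarrow> nat \<Rightarrow> (nat \<Rightarrow> real) \<Rightarrow> 'b path_simplex" where
  "base_simplex b j = restrict (\<lambda>_. (restrict (\<lambda>_. b) (standard_simplex 0), restrict (\<lambda>_. b) (cylset 0))) (standard_simplex j)"

text \<open>Dimension 0 is exceptional: the cone over a 0-simplex has the new vertex as its second
  face, with the constant path. The augmentation accounts for this constant term.\<close>

lemma face_1_cone_simplex:
  "simplex_map j (gface 0 (Suc 0)) (cone_simplex b 0 j \<sigma>) = base_simplex b j"
proof -
  have f: "simplical_face (Suc 0) x = vert0" if "x \<in> standard_simplex 0" for x
    using that by (auto simp: standard_simplex_0 simplical_face_def fun_eq_iff)
  have "singular_face (Suc 0) (Suc 0) (restrict (\<lambda>u. cone_fun b \<sigma> vert0 (u, 1)) (standard_simplex (Suc 0))) =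
      restrict (\<lambda>_. b) (standard_simplex 0)"
    by (rule ext) (simp add: singular_face_def restrict_def f cone_fun_def)
  moreover have "restrict (\<lambda>(x, t). restrict (cone_fun b \<sigma> y) (cylset (Suc 0)) (simplical_face (Suc 0) x, t)) (cylset 0)
      = restrict (\<lambda>_. b) (cylset 0)" for y
    by (rule ext) (simp add: restrict_def f cone_fun_def split: prod.splits)
  ultimately show ?thesis
    by (auto simp: simplex_map_def base_simplex_def cone_simplex_def gface_def fun_eq_iff restrict_def[of _ "standard_simplex j"])
qed

text \<open>A contracting homotopy of the rows: the vertex prepended to the simplex is sent to \<open>b\<close>, and the
  path over a point on the way to it is traversed only in part.\<close>

definition cone_op :: "'b \<Rightarrow> nat \<Rightarrow> nat \<Rightarrow> 'b path_simplex chain \<Rightarrow>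
    'b path_simplex chain" where
  "cone_op b n j x = frag_extend (\<lambda>\<sigma>. frag_of (cone_simplex b n j \<sigma>)) x"

text \<open>The augmentation, with the integers presented as the free abelian group on one
  generator. It is used in every simplicial degree \<open>j\<close>, because the row of degree
  \<open>j\<close> is augmented by the \<open>j\<close>-chains of a point.\<close>

definition eps :: "'s chain \<Rightarrow> (unit \<Rightarrow>\<^sub>0 int)" where
  "eps x = frag_extend (\<lambda>_. frag_of ()) x"

lemma singular_chain_cone_op:
  "singular_chain j (Gam n B b) x \<Longrightarrow> singular_chain j (Gam (Suc n) B b) (cone_op b n j x)"
  unfolding cone_op_def
  by (rule singular_chain_extend) (auto simp: singular_chain_of singular_chain_def intro: singular_simplex_cone_simplex)

lemma cone_op_diff: "cone_op b n j (x - y) = cone_op b n j x - cone_op b n j y"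
  by (simp add: cone_op_def frag_extend_diff)

text \<open>The identity of a contracting homotopy: face 0 of the cone gives \<open>x\<close>, and
  the remaining faces are cones over the faces of \<open>x\<close>, with the sign changed by the
  shift.\<close>

lemma dh_cone_op_Suc:
  assumes x: "singular_chain j (Gam (Suc n) B b) x"
  shows "dh (Suc n) j (cone_op b (Suc n) j x) = x - cone_op b n j (dh n j x)"
  using x unfolding singular_chain_def
proof (induction x rule: frag_induction)
  case (one \<sigma>)
  then have \<sigma>: "singular_simplex j (Gam (Suc n) B b) \<sigma>" by simp
  have "cone_op b n j (dh n j (frag_of \<sigma>)) =
      (\<Sum>k\<le>Suc n. frag_cmul ((-1) ^ k) (frag_of (cone_simplex b n j (simplex_map j (gface n k) \<sigma>))))"
    by (simp add: dh_def cone_op_def frag_extend_sum frag_extend_cmul o_def del: sum.atMost_Suc)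
  also have "\<dots> = (\<Sum>k\<le>Suc n. frag_cmul ((-1) ^ k) (frag_of (simplex_map j (gface (Suc n) (Suc k)) (cone_simplex b (Suc n) j \<sigma>))))"
    by (rule sum.cong) (simp_all add: face_Suc_cone_simplex[OF \<sigma>] del: sum.atMost_Suc)
  finally have *: "cone_op b n j (dh n j (frag_of \<sigma>)) = \<dots>" .
  have "dh (Suc n) j (cone_op b (Suc n) j (frag_of \<sigma>)) =
     (\<Sum>k\<le>Suc (Suc n). frag_cmul ((-1) ^ k) (frag_of (simplex_map j (gface (Suc n) k) (cone_simplex b (Suc n) j \<sigma>))))"
    by (simp add: dh_def cone_op_def del: sum.atMost_Suc)
  also have "\<dots> = frag_of \<sigma> - cone_op b n j (dh n j (frag_of \<sigma>))"
    unfolding sum.atMost_Suc_shift[of _ "Suc n"] * face_0_cone_simplex[OF \<sigma>]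
    by (simp del: sum.atMost_Suc flip: sum_negf)
  finally show ?case .
qed (simp_all add: dh_diff cone_op_diff, simp add: cone_op_def)

lemma dh_cone_op_0:
  assumes x: "singular_chain j (Gam 0 B b) x"
  shows "dh 0 j (cone_op b 0 j x) = x - frag_extend (\<lambda>_. frag_of (base_simplex b j)) (eps x)"
  using x unfolding singular_chain_def
proof (induction x rule: frag_induction)
  case (one \<sigma>)
  then have \<sigma>: "singular_simplex j (Gam 0 B b) \<sigma>" by simp
  show ?case
    using face_0_cone_simplex[OF \<sigma>] face_1_cone_simplex[of j b \<sigma>]
    by (simp add: dh_def cone_op_def eps_def)
qed (simp_all add: dh_diff cone_op_diff eps_def frag_extend_diff, simp_all add: cone_op_def eps_def)

section \<open>The augmentation and the exactness of the total complex\<close>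

lemma eps_diff: "eps (x - y) = eps x - eps y" and eps_add: "eps (x + y) = eps x + eps y"
  and eps_cmul: "eps (frag_cmul c x) = frag_cmul c (eps x)" and eps_0 [simp]: "eps 0 = 0"
  by (simp_all add: eps_def frag_extend_diff frag_extend_add frag_extend_cmul)

lemma eps_chain_map: "eps (chain_map j f x) = eps x"
proof (induction x rule: frag_induction[OF subset_UNIV])
qed (simp_all add: eps_diff chain_map_diff, simp_all add: eps_def)

lemma eps_dh: "eps (dh 0 j x) = 0"
  by (simp add: dh_def eps_add eps_diff eps_cmul eps_chain_map)

lemma alternating_sum_frag: "(\<Sum>k\<le>p. frag_cmul ((-1) ^ k) c) = (if even p then c else 0)"
  by (induction p) auto

lemma eps_chain_boundary: "eps (chain_boundary p x) = (if p \<noteq> 0 \<and> even p then eps x else 0)"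
proof (induction x rule: frag_induction[OF subset_UNIV])
  case (2 \<sigma>)
  have "eps (\<Sum>k\<le>p. frag_cmul ((-1) ^ k) (frag_of (singular_face p k \<sigma>))) = (\<Sum>k\<le>p. frag_cmul ((-1) ^ k) (frag_of ()))"
    by (simp add: eps_def frag_extend_sum frag_extend_cmul o_def)
  then show ?case
    by (simp add: chain_boundary_of alternating_sum_frag) (simp add: eps_def)
qed (simp_all add: eps_diff chain_boundary_diff)

lemma singular_simplex_base_simplex:
  assumes "b \<in> topspace B"
  shows "singular_simplex j (Gam 0 B b) (base_simplex b j)"
proof -
  have "(restrict (\<lambda>_. b) (standard_simplex 0), restrict (\<lambda>_. b) (cylset 0)) \<in> topspace (Gam 0 B b)"
    using singular_simplex_const[OF assms, of 0] continuous_map_eq[OF cm_const[OF assms], of "cyl 0" "restrict (\<lambda>_. b) (cylset 0)"]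
    by (simp add: topspace_Gam lifts_def)
  from singular_simplex_const[OF this] show ?thesis
    by (simp add: base_simplex_def)
qed

text \<open>The rows are contracted by \<open>cone_op\<close>, so a total cycle is filled column by
  column, starting at column 0, where exactness holds only on the kernel of the
  augmentation.\<close>

proposition total_complex_exact:
  assumes b: "b \<in> topspace B" and n: "n \<ge> 1"
    and w: "\<And>i. i \<le> n \<Longrightarrow> singular_chain (n - i) (Gam i B b) (w i)"
    and D: "\<And>i. i < n \<Longrightarrow> dh i (n - Suc i) (w (Suc i)) + frag_cmul ((-1) ^ i) (chain_boundary (n - i) (w i)) = 0"
  obtains x where "\<And>i. i \<le> Suc n \<Longrightarrow> singular_chain (Suc n - i) (Gam i B b) (x i)"
    and "\<And>i. i \<le> n \<Longrightarrow> w i = dh i (n - i) (x (Suc i)) + frag_cmul ((-1) ^ i) (chain_boundary (Suc n - i) (x i))"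
proof -
  \<comment> \<open>\<open>x0\<close> corrects the augmentation of \<open>w 0\<close>. For odd n the
    boundary from degree n + 1 preserves the augmentation, so a multiple of the constant simplex
    works; for even n the first cycle equation already forces the augmentation of \<open>w 0\<close>
    to vanish.\<close>
  define x0 where "x0 = (if odd n then frag_extend (\<lambda>_. frag_of (base_simplex b (Suc n))) (eps (w 0)) else 0)"
  have x0: "singular_chain (Suc n) (Gam 0 B b) x0"
    unfolding x0_def using singular_simplex_base_simplex[OF b]
    by (auto intro!: singular_chain_extend simp: singular_chain_of)
  have "eps (w 0) = eps (chain_boundary (Suc n) x0)"
  proof (cases "odd n")
    case True
    have "eps (frag_extend (\<lambda>_. frag_of (base_simplex b (Suc n))) e) = e" for e
      by (induction e rule: frag_induction[OF subset_UNIV]) (simp_all add: eps_def frag_extend_diff)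
    then show ?thesis using True by (simp add: x0_def eps_chain_boundary)
  next
    case False
    have "eps (dh 0 (n - Suc 0) (w (Suc 0)) + chain_boundary n (w 0)) = eps 0"
      using D[of 0] n by simp
    then show ?thesis
      using False n by (simp add: x0_def eps_add eps_dh eps_chain_boundary)
  qed
  then have e0: "eps (w 0 - chain_boundary (Suc n) x0) = 0" by (simp add: eps_diff)
  \<comment> \<open>Each round cones what is left of \<open>w i\<close> after the vertical boundary
    of \<open>x i\<close> has been subtracted; the cycle equations make this remainder a horizontal
    cycle.\<close>
  define x where "x = rec_nat x0 (\<lambda>i xi. cone_op b i (n - i) (w i - frag_cmul ((-1) ^ i) (chain_boundary (Suc n - i) xi)))"
  have x_0: "x 0 = x0" by (simp add: x_def)
  have x_Suc: "x (Suc i) = cone_op b i (n - i) (w i - frag_cmul ((-1) ^ i) (chain_boundary (Suc n - i) (x i)))" for i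
    by (simp add: x_def)
  define y where "y i = w i - frag_cmul ((-1) ^ i) (chain_boundary (Suc n - i) (x i))" for i
  have main: "singular_chain (Suc n - i) (Gam i B b) (x i) \<and> dh i (n - i) (x (Suc i)) = y i" if "i \<le> n" for i
    using that
  proof (induction i)
    case 0
    have "singular_chain n (Gam 0 B b) (y 0)"
      using w[of 0] singular_chain_boundary[OF x0] by (simp add: y_def x_0 singular_chain_diff)
    from dh_cone_op_0[OF this] show ?case
      using x0 e0 by (simp add: x_0 x_Suc y_def)
  next
    case (Suc i)
    then have IH: "singular_chain (Suc n - i) (Gam i B b) (x i)" "dh i (n - i) (x (Suc i)) = y i" and i: "i < n" by auto
    have S: "Suc n - i = Suc (n - i)" "n - i = Suc (n - Suc i)" using i by auto
    have chain: "singular_chain (n - i) (Gam i B b) (y i)"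
      using w[of i] singular_chain_boundary[OF IH(1)] i S by (simp add: y_def singular_chain_diff singular_chain_cmul)
    have xS: "singular_chain (n - i) (Gam (Suc i) B b) (x (Suc i))"
      unfolding x_Suc by (rule singular_chain_cone_op) (use chain in \<open>simp add: y_def\<close>)
    have yS: "singular_chain (n - Suc i) (Gam (Suc i) B b) (y (Suc i))"
      using w[of "Suc i"] singular_chain_boundary[OF xS] i by (simp add: y_def singular_chain_diff singular_chain_cmul)
    have "chain_boundary (n - i) (y i) = chain_boundary (n - i) (w i)"
      using chain_boundary_boundary[OF IH(1)] S by (simp add: y_def chain_boundary_diff chain_boundary_cmul)
    then have "dh i (n - Suc i) (chain_boundary (n - i) (x (Suc i))) = chain_boundary (n - i) (w i)"
      using chain_boundary_dh[OF xS] IH(2) by simp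
    then have "dh i (n - Suc i) (y (Suc i)) = dh i (n - Suc i) (w (Suc i)) + frag_cmul ((-1) ^ i) (chain_boundary (n - i) (w i))"
      by (simp add: y_def dh_diff dh_cmul)
    then have "dh i (n - Suc i) (y (Suc i)) = 0" using D[OF i] by simp
    then have "dh (Suc i) (n - Suc i) (cone_op b (Suc i) (n - Suc i) (y (Suc i))) = y (Suc i)"
      using dh_cone_op_Suc[OF yS] by (simp add: cone_op_def)
    then show ?case
      using xS by (simp add: x_Suc[of "Suc i"] y_def)
  qed
  show ?thesis
  proof (rule that[of x])
    show "singular_chain (Suc n - i) (Gam i B b) (x i)" if "i \<le> Suc n" for i
    proof (cases "i \<le> n")
      case False
      then have i: "i = Suc n" using that by simp
      have "singular_chain 0 (Gam n B b) (y n)"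
        using w[of n] singular_chain_boundary[of "Suc 0" "Gam n B b" "x n"] main[of n]
        by (simp add: y_def singular_chain_diff singular_chain_cmul)
      then show ?thesis
        unfolding i x_Suc using singular_chain_cone_op[of 0 n B b "y n"] by (simp add: y_def)
    qed (use main in blast)
    show "w i = dh i (n - i) (x (Suc i)) + frag_cmul ((-1) ^ i) (chain_boundary (Suc n - i) (x i))" if "i \<le> n" for i
      using main[OF that] by (simp add: y_def)
  qed
qed

section \<open>Trivialising the columns\<close>

text \<open>Reversing one path and appending the other gives a loop at \<open>b\<close>, and a path
  in the loop space from it to the constant loop is a filled square.\<close>

lemma loops_homotopic_rel_ends:
  assumes con: "path_connected_space (loop_space B b)"
    and \<beta>0: "continuous_map unit_interval B \<beta>0" "\<beta>0 0 = y" "\<beta>0 1 = b"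
    and \<beta>1: "continuous_map unit_interval B \<beta>1" "\<beta>1 0 = y" "\<beta>1 1 = b"
  obtains h where "continuous_map (prod_topology unit_interval unit_interval) B (\<lambda>z. h (fst z) (snd z))"
    "\<And>u. u \<in> {0..1} \<Longrightarrow> h 0 u = \<beta>0 u" "\<And>u. u \<in> {0..1} \<Longrightarrow> h 1 u = \<beta>1 u"
    "\<And>s. s \<in> {0..1} \<Longrightarrow> h s 0 = y" "\<And>s. s \<in> {0..1} \<Longrightarrow> h s 1 = b"
proof -
  define l where "l = restrict (\<lambda>t. if t \<le> 1/2 then \<beta>0 (1 - 2 * t) else \<beta>1 (2 * t - 1)) {0..1::real}"
  have id: "continuous_map unit_interval euclideanreal (\<lambda>t. t)"
    by (rule cm_interval_real[OF cm_id])
  have "continuous_map unit_interval B (\<lambda>t. if t \<le> 1/2 then \<beta>0 (1 - 2 * t) else \<beta>1 (2 * t - 1))"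
  proof (rule cm_if_le)
    show "continuous_map (subtopology unit_interval {x \<in> topspace unit_interval. x \<le> 1/2}) B (\<lambda>t. \<beta>0 (1 - 2 * t))"
      by (rule cm_comp[OF \<beta>0(1)]) (auto simp: cm_interval intro!: continuous_intros cm_sub id)
    show "continuous_map (subtopology unit_interval {x \<in> topspace unit_interval. 1/2 \<le> x}) B (\<lambda>t. \<beta>1 (2 * t - 1))"
      by (rule cm_comp[OF \<beta>1(1)]) (auto simp: cm_interval intro!: continuous_intros cm_sub id)
    fix t :: real assume t: "t = 1/2"
    show "\<beta>0 (1 - 2 * t) = \<beta>1 (2 * t - 1)" by (simp add: t \<beta>0 \<beta>1)
  qed (use id in auto)
  then have "continuous_map unit_interval B l"
    by (rule continuous_map_eq) (simp add: l_def)
  then have l: "l \<in> topspace (loop_space B b)"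
    by (simp add: topspace_loop_space loops_def pathin_def) (simp add: l_def \<beta>0 \<beta>1)
  have "b \<in> topspace B"
    using continuous_map_image_subset_topspace[OF \<beta>0(1)] \<beta>0(3) by force
  then have k: "const_loop b \<in> topspace (loop_space B b)"
    by (auto simp: topspace_loop_space loops_def pathin_def const_loop_def intro: continuous_map_eq[OF cm_const])
  obtain L where L: "continuous_map unit_interval (loop_space B b) L" "L 0 = l" "L 1 = const_loop b"
    using con l k unfolding path_connected_space_def pathin_def by blast
  \<comment> \<open>In the square of \<open>L\<close>, with \<open>l\<close> on one edge and
    \<open>b\<close> on the other three, \<open>u\<close> runs along the segment from the midpoint
    of the edge of \<open>l\<close>, where the value is \<open>y\<close>, to a point that traverses
    the other three edges as \<open>s\<close> goes from 0 to 1.\<close>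
  define h where "h s u = L (u * min (min (3 * s) 1) (3 - 3 * s)) ((1 - u) / 2 + u * max 0 (min (3 * s - 1) 1))" for s u :: real
  let ?P = "prod_topology unit_interval unit_interval"
  have c: "continuous_map ?P euclideanreal fst" "continuous_map ?P euclideanreal snd"
    by (rule cm_interval_real[OF cm_fst'], rule cm_interval_real[OF cm_snd'])
  have L0: "L s 0 = b" "L s 1 = b" if "s \<in> {0..1}" for s
    using continuous_map_image_subset_topspace[OF L(1)] that by (auto simp: topspace_loop_space loops_def image_subset_iff)
  show ?thesis
  proof (rule that[of h])
    have "continuous_map ?P unit_interval (\<lambda>z. snd z * min (min (3 * fst z) 1) (3 - 3 * fst z))"
      by (auto simp: cm_interval intro!: continuous_intros c mult_le_one)
    moreover have "continuous_map ?P unit_interval (\<lambda>z. (1 - snd z) / 2 + snd z * max 0 (min (3 * fst z - 1) 1))"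
      unfolding cm_interval
    proof (intro conjI ballI)
      fix z assume z: "z \<in> topspace ?P"
      have "snd z * max 0 (min (3 * fst z - 1) 1) \<le> snd z" "snd z \<le> 1"
        using z mult_left_mono[of "max 0 (min (3 * fst z - 1) 1)" 1 "snd z"] by auto
      moreover have "v \<le> y \<Longrightarrow> y \<le> 1 \<Longrightarrow> (1 - y) / 2 + v \<le> 1" for v y :: real by (simp add: field_simps)
      ultimately show "(1 - snd z) / 2 + snd z * max 0 (min (3 * fst z - 1) 1) \<le> 1" by blast
    qed (auto intro!: continuous_intros c)
    ultimately show "continuous_map ?P B (\<lambda>z. h (fst z) (snd z))"
      unfolding h_def by (intro cm_loop_eval[of _ B b] cm_comp[OF L(1)])
    show "h 0 u = \<beta>0 u" "h 1 u = \<beta>1 u" if "u \<in> {0..1}" for u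
      using that \<beta>0 \<beta>1 by (auto simp: h_def L l_def min_def max_def field_simps)
    show "h s 0 = y" if "s \<in> {0..1}" for s
      using that \<beta>0 by (simp add: h_def L l_def)
    show "h s 1 = b" if s: "s \<in> {0..1}" for s
    proof -
      consider "s \<le> 1/3" | "1/3 \<le> s" "s \<le> 2/3" | "2/3 \<le> s" by linarith
      then show ?thesis
      proof cases
        case 1
        then show ?thesis using s L0 by (simp add: h_def)
      next
        case 2
        then have "min (min (3 * s) 1) (3 - 3 * s) = 1" "max 0 (min (3 * s - 1) 1) \<in> {0..1}" by auto
        then show ?thesis by (simp add: h_def L const_loop_def)
      next
        case 3
        then show ?thesis using s L0 by (simp add: h_def)
      qed
    qed
  qed
qed

lemma cm_parametric_eval:
  assumes "continuous_map W (discrete_topology S) c" "\<And>s. s \<in> S \<Longrightarrow> continuous_map D B (f s)" "continuous_map W D d"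
  shows "continuous_map W B (\<lambda>w. f (c w) (d w))"
proof (rule cm_slices[OF assms(1)])
  fix s assume s: "s \<in> S"
  have "continuous_map (subtopology W {w \<in> topspace W. c w = s}) B (\<lambda>w. f s (d w))"
    by (rule cm_comp[OF assms(2)[OF s] cm_sub[OF assms(3)]])
  then show "continuous_map (subtopology W {w \<in> topspace W. c w = s}) B (\<lambda>w. f (c w) (d w))"
    by (rule continuous_map_eq) simp
qed

text \<open>The model of a column. Its faces act on the simplex and leave the loop alone, which
  turns the first page into chains of the base with coefficients in the homology of the loop
  space.\<close>

definition Qsp :: "nat \<Rightarrow> 'b topology \<Rightarrow> 'b \<Rightarrow> (((nat \<Rightarrow> real) \<Rightarrow> 'b) \<times> (real \<Rightarrow> 'b)) topology" where
  "Qsp n B b = prod_topology (discrete_topology (singular_simplex_set n B)) (loop_space B b)"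

definition qface :: "nat \<Rightarrow> nat \<Rightarrow> ((nat \<Rightarrow> real) \<Rightarrow> 'b) \<times> (real \<Rightarrow> 'b) \<Rightarrow> ((nat \<Rightarrow> real) \<Rightarrow> 'b) \<times> (real \<Rightarrow> 'b)" where
  "qface n k z = (singular_face (Suc n) k (fst z), snd z)"

lemma cm_Q_fst: "continuous_map (Qsp n B b) (discrete_topology (singular_simplex_set n B)) fst"
  and cm_Q_snd: "continuous_map (Qsp n B b) (loop_space B b) snd"
  unfolding Qsp_def by (rule cm_fst', rule cm_snd')

lemma topspace_Q: "z \<in> topspace (Qsp n B b) \<longleftrightarrow> singular_simplex n B (fst z) \<and> snd z \<in> loops B b"
  by (cases z) (simp add: Qsp_def topspace_loop_space)

lemma cm_into_Q:
  assumes "continuous_map W (discrete_topology (singular_simplex_set n B)) (\<lambda>w. fst (f w))"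
    "continuous_map W (loop_space B b) (\<lambda>w. snd (f w))"
  shows "continuous_map W (Qsp n B b) f"
  using assms by (simp add: Qsp_def continuous_map_pairwise o_def)

lemma cm_qface: "k \<le> Suc n \<Longrightarrow> continuous_map (Qsp (Suc n) B b) (Qsp n B b) (qface n k)"
  using singular_simplex_singular_face[of "Suc n"]
  by (intro cm_into_Q) (auto simp: qface_def intro!: cm_discrete_map[OF cm_Q_fst] cm_Q_snd)

text \<open>\<open>lam\<close> chooses a path from \<open>b\<close> to every point, with no
  continuity in the point. Path connectedness of the loop space makes any two paths with the same
  ends homotopic, and \<open>lam_base\<close> keeps the identification over \<open>b\<close> itself
  free of a detour.\<close>

locale trivialisation =
  fixes B :: "'b topology" and b :: 'b and lam :: "'b \<Rightarrow> real \<Rightarrow> 'b"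
  assumes base: "b \<in> topspace B"
    and loops_connected: "path_connected_space (loop_space B b)"
    and lam: "\<And>y. y \<in> topspace B \<Longrightarrow> continuous_map unit_interval B (lam y)"
    and lam_0: "\<And>y. y \<in> topspace B \<Longrightarrow> lam y 0 = b"
    and lam_1: "\<And>y. y \<in> topspace B \<Longrightarrow> lam y 1 = y"
    and lam_base: "\<And>t. t \<in> {0..1} \<Longrightarrow> lam b t = b"
begin

abbreviation "G n \<equiv> Gam n B b"
abbreviation "Q n \<equiv> Qsp n B b"
abbreviation "F \<equiv> loop_space B b"

lemma simplex_point: "singular_simplex n B \<tau> \<Longrightarrow> x \<in> standard_simplex n \<Longrightarrow> \<tau> x \<in> topspace B"
  by (auto simp: singular_simplex_def continuous_map_def)

lemma cm_lam:
  assumes "continuous_map W (discrete_topology (singular_simplex_set n B)) c" "continuous_map W unit_interval d"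
    and "x \<in> standard_simplex n"
  shows "continuous_map W B (\<lambda>w. lam (c w x) (d w))"
  by (rule cm_parametric_eval[OF assms(1) _ assms(2), of B "\<lambda>\<tau>. lam (\<tau> x)"]) (use assms(3) lam simplex_point in auto)

lemma cm_simplex_eval:
  assumes "continuous_map W (discrete_topology (singular_simplex_set n B)) c" "continuous_map W (simplex_top n) d"
  shows "continuous_map W B (\<lambda>w. c w (d w))"
  by (rule cm_parametric_eval[OF assms(1) _ assms(2)]) (auto simp: singular_simplex_def)

text \<open>\<open>RR\<close> and \<open>PSI\<close> are inverse homotopy equivalences between \<open>Gam n B b\<close> and the union of one copy
  of the loop space for each singular simplex.\<close>

definition rr :: "'b path_simplex \<Rightarrow> real \<Rightarrow> 'b" where
  "rr z = restrict (\<lambda>t. if t \<le> 1/2 then snd z (vert0, 2 * t) else lam (fst z vert0) (2 - 2 * t)) {0..1}"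

definition RR :: "'b path_simplex \<Rightarrow> ((nat \<Rightarrow> real) \<Rightarrow> 'b) \<times> (real \<Rightarrow> 'b)" where
  "RR z = (fst z, rr z)"

definition om :: "((nat \<Rightarrow> real) \<Rightarrow> 'b) \<Rightarrow> (real \<Rightarrow> 'b) \<Rightarrow> real \<Rightarrow> 'b" where
  "om \<tau> g u = (if u \<le> 1 then g u else lam (\<tau> vert0) (u - 1))"

text \<open>One third of the time each: the loop \<open>g\<close>, the path \<open>lam\<close> to
  vertex 0 of \<open>\<tau>\<close>, and the image of the segment from that vertex to the given
  point.\<close>

definition psi :: "((nat \<Rightarrow> real) \<Rightarrow> 'b) \<Rightarrow> (real \<Rightarrow> 'b) \<Rightarrow> (nat \<Rightarrow> real) \<times> real \<Rightarrow> 'b" where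
  "psi \<tau> g z = (if snd z \<le> 2/3 then om \<tau> g (3 * snd z) else \<tau> (mix (3 * snd z - 2) vert0 (fst z)))"

definition PSI :: "nat \<Rightarrow> ((nat \<Rightarrow> real) \<Rightarrow> 'b) \<times> (real \<Rightarrow> 'b) \<Rightarrow> 'b path_simplex" where
  "PSI n z = (fst z, restrict (psi (fst z) (snd z)) (cylset n))"

lemma Gam_facts:
  assumes "z \<in> topspace (G n)"
  shows "singular_simplex n B (fst z)" "x \<in> standard_simplex n \<Longrightarrow> snd z (x, 0) = b"
    "x \<in> standard_simplex n \<Longrightarrow> snd z (x, 1) = fst z x"
    "fst z vert0 \<in> topspace B" "lam (fst z vert0) 0 = b" "lam (fst z vert0) 1 = fst z vert0"
proof -
  show "singular_simplex n B (fst z)" "x \<in> standard_simplex n \<Longrightarrow> snd z (x, 0) = b"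
    "x \<in> standard_simplex n \<Longrightarrow> snd z (x, 1) = fst z x"
    using assms by (auto simp: topspace_Gam lifts_def)
  then show v: "fst z vert0 \<in> topspace B" using simplex_point vert0_in by blast
  show "lam (fst z vert0) 0 = b" "lam (fst z vert0) 1 = fst z vert0"
    using lam_0[OF v] lam_1[OF v] by auto
qed

lemma Q_facts:
  assumes "z \<in> topspace (Q n)"
  shows "singular_simplex n B (fst z)" "snd z 0 = b" "snd z 1 = b"
    "fst z vert0 \<in> topspace B" "lam (fst z vert0) 0 = b" "lam (fst z vert0) 1 = fst z vert0"
proof -
  show "singular_simplex n B (fst z)" "snd z 0 = b" "snd z 1 = b"
    using assms by (auto simp: topspace_Q loops_def)
  then show v: "fst z vert0 \<in> topspace B" using simplex_point vert0_in by blast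
  show "lam (fst z vert0) 0 = b" "lam (fst z vert0) 1 = fst z vert0"
    using lam_0[OF v] lam_1[OF v] by auto
qed

lemma cm_rr: "continuous_map (G n) F rr"
proof (rule cm_into_loop_space)
  let ?P = "prod_topology (G n) unit_interval"
  have t: "continuous_map ?P euclideanreal snd" by (rule cm_interval_real[OF cm_snd'])
  have z: "continuous_map ?P (G n) fst" by (rule cm_fst')
  have c: "continuous_map ?P (discrete_topology (singular_simplex_set n B)) (\<lambda>w. fst (fst w))"
    by (rule cm_comp[OF cm_Gam_fst z])
  have "continuous_map ?P B (\<lambda>w. if snd w \<le> 1/2 then snd (fst w) (vert0, 2 * snd w) else lam (fst (fst w) vert0) (2 - 2 * snd w))"
  proof (rule cm_if_le)
    show "continuous_map (subtopology ?P {w \<in> topspace ?P. snd w \<le> 1/2}) B (\<lambda>w. snd (fst w) (vert0, 2 * snd w))"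
      by (rule cm_Gam_eval[of _ n B b]) (auto simp: cm_interval vert0_in intro!: continuous_intros cm_sub t z)
    show "continuous_map (subtopology ?P {w \<in> topspace ?P. 1/2 \<le> snd w}) B (\<lambda>w. lam (fst (fst w) vert0) (2 - 2 * snd w))"
      by (rule cm_lam[of _ n]) (auto simp: cm_interval vert0_in intro!: continuous_intros cm_sub t c)
    fix w assume w: "w \<in> topspace ?P" "snd w = 1/2"
    then have "fst w \<in> topspace (G n)" by auto
    from Gam_facts[OF this] show "snd (fst w) (vert0, 2 * snd w) = lam (fst (fst w) vert0) (2 - 2 * snd w)"
      by (simp add: w(2) vert0_in)
  qed (use t in auto)
  then show "continuous_map ?P B (\<lambda>z. rr (fst z) (snd z))"
    unfolding rr_def by (rule cm_restrict[where f = "\<lambda>z t. if t \<le> 1/2 then snd z (vert0, 2 * t) else lam (fst z vert0) (2 - 2 * t)"]) simp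
qed (auto simp: rr_def Gam_facts[of _ n] vert0_in[of n])

lemma cm_RR: "continuous_map (G n) (Q n) RR"
  by (rule cm_into_Q) (simp_all add: RR_def cm_rr cm_Gam_fst eta_contract_eq)

lemma cm_om:
  assumes c: "continuous_map W (discrete_topology (singular_simplex_set n B)) c"
    and g: "continuous_map W F g" and u: "continuous_map W euclideanreal u"
    and r: "\<And>w. w \<in> topspace W \<Longrightarrow> 0 \<le> u w \<and> u w \<le> 2"
  shows "continuous_map W B (\<lambda>w. om (c w) (g w) (u w))"
  unfolding om_def
proof (rule cm_if_le)
  show "continuous_map (subtopology W {w \<in> topspace W. u w \<le> 1}) B (\<lambda>w. g w (u w))"
    by (rule cm_loop_eval[of _ B b]) (auto simp: cm_interval r intro!: cm_sub g u)
  have "continuous_map (subtopology W {w \<in> topspace W. 1 \<le> u w}) unit_interval (\<lambda>w. u w - 1)"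
    unfolding cm_interval
  proof (intro conjI ballI)
    fix w assume "w \<in> topspace (subtopology W {w \<in> topspace W. 1 \<le> u w})"
    then show "0 \<le> u w - 1" "u w - 1 \<le> 1" using r[of w] by auto
  qed (intro continuous_intros cm_sub u)
  then show "continuous_map (subtopology W {w \<in> topspace W. 1 \<le> u w}) B (\<lambda>w. lam (c w vert0) (u w - 1))"
    by (intro cm_lam[of _ n] cm_sub[OF c] vert0_in)
  fix w assume w: "w \<in> topspace W" "u w = 1"
  have "g w \<in> loops B b" "singular_simplex n B (c w)"
    using w continuous_map_image_subset_topspace[OF c] continuous_map_image_subset_topspace[OF g] by (auto simp: topspace_loop_space)
  then show "g w (u w) = lam (c w vert0) (u w - 1)"
    using w lam_0[OF simplex_point[OF _ vert0_in]] by (simp add: loops_def)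
qed (use u in auto)

lemma cm_PSI: "continuous_map (Q n) (G n) (PSI n)"
proof (rule cm_into_Gam)
  let ?P = "prod_topology (Q n) (cyl n)"
  have t: "continuous_map ?P euclideanreal (\<lambda>w. snd (snd w))" by (rule cm_interval_real[OF cm_cyl_time])
  have c: "continuous_map ?P (discrete_topology (singular_simplex_set n B)) (\<lambda>w. fst (fst w))"
    by (rule cm_comp[OF cm_Q_fst cm_fst'])
  have g: "continuous_map ?P F (\<lambda>w. snd (fst w))"
    by (rule cm_comp[OF cm_Q_snd cm_fst'])
  show "continuous_map (Q n) (discrete_topology (singular_simplex_set n B)) (\<lambda>w. fst (PSI n w))"
    by (simp add: PSI_def cm_Q_fst eta_contract_eq)
  have "continuous_map ?P B (\<lambda>z. psi (fst (fst z)) (snd (fst z)) (snd z))"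
    unfolding psi_def
  proof (rule cm_if_le)
    show "continuous_map (subtopology ?P {w \<in> topspace ?P. snd (snd w) \<le> 2/3}) B (\<lambda>w. om (fst (fst w)) (snd (fst w)) (3 * snd (snd w)))"
      by (rule cm_om[of _ n]) (auto intro!: continuous_intros cm_sub t c g)
    show "continuous_map (subtopology ?P {w \<in> topspace ?P. 2/3 \<le> snd (snd w)}) B
        (\<lambda>w. fst (fst w) (mix (3 * snd (snd w) - 2) vert0 (fst (snd w))))"
      by (rule cm_simplex_eval[of _ n], rule cm_sub[OF c], rule cm_mix)
         (auto simp: vert0_in intro!: continuous_intros cm_sub t cm_cyl_pt)
    fix w assume w: "w \<in> topspace ?P" "snd (snd w) = 2/3"
    then have "fst w \<in> topspace (Q n)" by auto
    from Q_facts(6)[OF this]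
    show "om (fst (fst w)) (snd (fst w)) (3 * snd (snd w)) = fst (fst w) (mix (3 * snd (snd w) - 2) vert0 (fst (snd w)))"
      by (simp add: om_def w(2))
  qed (use t in auto)
  then show "continuous_map ?P B (\<lambda>z. snd (PSI n (fst z)) (snd z))"
    unfolding PSI_def snd_conv
    by (rule cm_restrict[where f = "\<lambda>w. psi (fst w) (snd w)"]) simp
qed (auto simp: PSI_def psi_def om_def Q_facts[of _ n])

end

context trivialisation begin

lemma homotopic_into_Q:
  assumes "continuous_map (prod_topology unit_interval W) F h"
    and "continuous_map W (discrete_topology (singular_simplex_set n B)) c"
    and "\<And>w. w \<in> topspace W \<Longrightarrow> f w = (c w, h (0, w))" "\<And>w. w \<in> topspace W \<Longrightarrow> g w = (c w, h (1, w))"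
  shows "homotopic_with (\<lambda>_. True) W (Q n) f g"
proof (rule homotopicI)
  show "continuous_map (prod_topology unit_interval W) (Q n) (\<lambda>w. (c (snd w), h w))"
    by (rule cm_into_Q) (simp_all add: assms(1) cm_comp[OF assms(2) cm_snd'] eta_contract_eq)
qed (use assms in auto)

lemma bound_mix: "0 \<le> s \<Longrightarrow> s \<le> 1 \<Longrightarrow> l \<le> x \<Longrightarrow> x \<le> u \<Longrightarrow> l \<le> y \<Longrightarrow> y \<le> u \<Longrightarrow>
    l \<le> (1 - s) * x + s * y \<and> (1 - s) * x + s * y \<le> (u::real)"
  using convex_bound_le[of x u y "1 - s" s] convex_bound_le[of "- x" "- l" "- y" "1 - s" s] by simp

lemma RR_PSI: "homotopic_with (\<lambda>_. True) (Q n) (Q n) (RR \<circ> PSI n) id"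
proof -
  let ?P = "prod_topology unit_interval (Q n)"
  let ?R = "prod_topology ?P unit_interval"
  \<comment> \<open>The composite runs through \<open>om\<close> at the time \<open>?th t\<close>:
    along the loop and \<open>lam\<close> for t \<le> 1/3, resting at the vertex up to 1/2, then
    back along \<open>lam\<close>. A linear homotopy of times turns \<open>?th\<close> into the
    identity.\<close>
  let ?th = "\<lambda>t. min (min (6 * t) 2) (3 - 2 * t)"
  let ?om = "\<lambda>p t. om (fst (snd p)) (snd (snd p)) ((1 - fst p) * ?th t + fst p * t)"
  define h where "h p = restrict (?om p) {0..1}" for p
  have th: "0 \<le> ?th t" "?th t \<le> 2" if "t \<in> {0..1}" for t :: real using that by auto
  have s: "continuous_map ?R euclideanreal (\<lambda>w. fst (fst w))"
    by (rule cm_interval_real[OF cm_fst[OF cm_fst']])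
  have t: "continuous_map ?R euclideanreal snd" by (rule cm_interval_real[OF cm_snd'])
  have z: "continuous_map ?R (Q n) (\<lambda>w. snd (fst w))" by (rule cm_snd[OF cm_fst'])
  have "continuous_map ?R B (\<lambda>w. ?om (fst w) (snd w))"
  proof (rule cm_om[of _ n])
    show "continuous_map ?R (discrete_topology (singular_simplex_set n B)) (\<lambda>w. fst (snd (fst w)))"
      by (rule cm_comp[OF cm_Q_fst z])
    show "continuous_map ?R F (\<lambda>w. snd (snd (fst w)))" by (rule cm_comp[OF cm_Q_snd z])
    show "continuous_map ?R euclideanreal (\<lambda>w. (1 - fst (fst w)) * ?th (snd w) + fst (fst w) * snd w)"
      by (intro continuous_intros s t)
    fix w assume "w \<in> topspace ?R"
    then have "fst (fst w) \<in> {0..1}" "snd w \<in> {0..1}" by auto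
    then show "0 \<le> (1 - fst (fst w)) * ?th (snd w) + fst (fst w) * snd w \<and>
        (1 - fst (fst w)) * ?th (snd w) + fst (fst w) * snd w \<le> 2"
      by (intro bound_mix th) auto
  qed
  then have "continuous_map ?R B (\<lambda>w. h (fst w) (snd w))"
    unfolding h_def by (rule cm_restrict[where f = ?om]) simp
  then have h: "continuous_map ?P F h"
  proof (rule cm_into_loop_space[rotated 3])
    fix p assume p: "p \<in> topspace ?P"
    then have "snd p \<in> topspace (Q n)" by auto
    from Q_facts(2,3)[OF this] show "h p 0 = b" "h p 1 = b" by (simp_all add: h_def om_def)
  qed (simp only: h_def restrict_extensional)
  show ?thesis
  proof (rule homotopic_into_Q[OF h cm_Q_fst])
    fix z assume z: "z \<in> topspace (Q n)"
    have "rr (PSI n z) t = h (0, z) t" for t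
    proof (cases "t \<in> {0..1}")
      case True
      have v: "vert0 \<in> standard_simplex n" by (rule vert0_in)
      consider "t \<le> 1/6" | "1/6 < t" "t \<le> 1/3" | "1/3 < t" "t \<le> 1/2" | "1/2 < t" by linarith
      then show ?thesis
      proof cases
        case 3
        then have "?th t = 2" by auto
        then show ?thesis using 3 True v Q_facts[OF z]
          by (simp add: rr_def PSI_def psi_def h_def om_def)
      next
        case 4
        then have "?th t = 3 - 2 * t" by auto
        then show ?thesis using 4 True v Q_facts[OF z]
          by (simp add: rr_def PSI_def psi_def h_def om_def algebra_simps)
      qed (use True v in \<open>simp_all add: rr_def PSI_def psi_def h_def om_def\<close>)
    qed (simp add: rr_def h_def restrict_def del: atLeastAtMost_iff)
    then show "(RR \<circ> PSI n) z = (fst z, h (0, z))"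
      by (auto simp: RR_def PSI_def)
    have "snd z \<in> extensional {0..1}" using z by (simp add: topspace_Q loops_def)
    then have "h (1, z) t = snd z t" for t
      by (auto simp: h_def om_def extensional_def)
    then show "id z = (fst z, h (1, z))" by (auto simp: prod_eq_iff)
  qed
qed

lemma homotopic_into_Gam:
  assumes h: "continuous_map (prod_topology (prod_topology unit_interval W) (cyl n)) B (\<lambda>w. h (fst w) (snd w))"
    and c: "continuous_map W (discrete_topology (singular_simplex_set n B)) c"
    and 0: "\<And>s w x. s \<in> {0..1} \<Longrightarrow> w \<in> topspace W \<Longrightarrow> x \<in> standard_simplex n \<Longrightarrow> h (s, w) (x, 0) = b"
    and 1: "\<And>s w x. s \<in> {0..1} \<Longrightarrow> w \<in> topspace W \<Longrightarrow> x \<in> standard_simplex n \<Longrightarrow> h (s, w) (x, 1) = c w x"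
    and f: "continuous_map W (Gam n B b) f" "\<And>w. w \<in> topspace W \<Longrightarrow> fst (f w) = c w"
       "\<And>w x t. w \<in> topspace W \<Longrightarrow> x \<in> standard_simplex n \<Longrightarrow> t \<in> {0..1} \<Longrightarrow> snd (f w) (x, t) = h (0, w) (x, t)"
    and g: "continuous_map W (Gam n B b) g" "\<And>w. w \<in> topspace W \<Longrightarrow> fst (g w) = c w"
       "\<And>w x t. w \<in> topspace W \<Longrightarrow> x \<in> standard_simplex n \<Longrightarrow> t \<in> {0..1} \<Longrightarrow> snd (g w) (x, t) = h (1, w) (x, t)"
  shows "homotopic_with (\<lambda>_. True) W (Gam n B b) f g"
proof (rule homotopicI)
  let ?h = "\<lambda>p. (c (snd p), restrict (h p) (cylset n))"
  show "continuous_map (prod_topology unit_interval W) (Gam n B b) ?h"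
  proof (rule cm_into_Gam)
    show "continuous_map (prod_topology (prod_topology unit_interval W) (cyl n)) B (\<lambda>z. snd (?h (fst z)) (snd z))"
      unfolding snd_conv by (rule cm_restrict[OF h]) simp
  qed (use 0 1 in \<open>auto simp: cm_comp[OF c cm_snd']\<close>)
  have ext: "snd (k w) \<in> extensional (cylset n)" if "continuous_map W (Gam n B b) k" "w \<in> topspace W" for k w
    using continuous_map_image_subset_topspace[OF that(1)] that(2) by (force simp: topspace_Gam lifts_def)
  fix w assume w: "w \<in> topspace W"
  have "snd (f w) = restrict (h (0, w)) (cylset n)" "snd (g w) = restrict (h (1, w)) (cylset n)"
    by (rule extensionalityI[OF ext[OF f(1) w]], simp, use w f in force, rule extensionalityI[OF ext[OF g(1) w]], simp, use w g in force)
  then show "?h (0, w) = f w" "?h (1, w) = g w"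
    using f(2)[OF w] g(2)[OF w] by (simp_all add: prod_eq_iff)
qed

text \<open>The homotopy first removes the detour along \<^term>\<open>lam\<close> and its reverse, then slides along straight
  segments of the convex set \<open>cylset n\<close>.\<close>

lemma PSI_RR: "homotopic_with (\<lambda>_. True) (G n) (G n) (PSI n \<circ> RR) id"
proof -
  let ?P = "prod_topology (prod_topology unit_interval (G n)) (cyl n)"
  have s: "continuous_map ?P euclideanreal (\<lambda>w. fst (fst w))"
    by (rule cm_interval_real[OF cm_fst[OF cm_fst']])
  have t: "continuous_map ?P euclideanreal (\<lambda>w. snd (snd w))" by (rule cm_interval_real[OF cm_cyl_time])
  have x: "continuous_map ?P (simplex_top n) (\<lambda>w. fst (snd w))" by (rule cm_cyl_pt)
  have z: "continuous_map ?P (G n) (\<lambda>w. snd (fst w))" by (rule cm_snd[OF cm_fst'])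
  have c: "continuous_map ?P (discrete_topology (singular_simplex_set n B)) (\<lambda>w. fst (snd (fst w)))"
    by (rule cm_comp[OF cm_Gam_fst z])
  let ?u = "\<lambda>t. max 0 (3 * t - 2)"
  \<comment> \<open>The second stage, straight-line motion in simplex times interval. It starts from
    the path that runs up over vertex 0 by time 1/6, rests at its end until 2/3 and then follows a
    segment of the base simplex.\<close>
  define hB where "hB p d = snd (snd p) (mix (fst p) (mix (?u (snd d)) vert0 (fst d)) (fst d),
      (1 - fst p) * min (6 * snd d) 1 + fst p * snd d)"
    for p :: "real \<times> 'b path_simplex" and d :: "(nat \<Rightarrow> real) \<times> real"
  have hB: "continuous_map ?P B (\<lambda>w. hB (fst w) (snd w))"
    unfolding hB_def
  proof (intro cm_Gam_eval[of _ n B b] z cm_mix x s)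
    show "continuous_map ?P unit_interval (\<lambda>w. (1 - fst (fst w)) * min (6 * snd (snd w)) 1 + fst (fst w) * snd (snd w))"
      unfolding cm_interval
    proof (intro conjI ballI)
      fix w assume "w \<in> topspace ?P"
      then have "fst (fst w) \<in> {0..1}" "snd (snd w) \<in> {0..1}" by auto
      then show "0 \<le> (1 - fst (fst w)) * min (6 * snd (snd w)) 1 + fst (fst w) * snd (snd w)"
        "(1 - fst (fst w)) * min (6 * snd (snd w)) 1 + fst (fst w) * snd (snd w) \<le> 1"
        using bound_mix[of "fst (fst w)" 0 "min (6 * snd (snd w)) 1" 1 "snd (snd w)"] by auto
    qed (intro continuous_intros s t)
    show "continuous_map ?P euclideanreal (\<lambda>w. ?u (snd (snd w)))" by (intro continuous_intros t)
  qed (auto simp: vert0_in)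
  have hB_0: "hB (0, z) (x, t) = snd z (mix (?u t) vert0 x, min (6 * t) 1)" for z x t
    by (simp add: hB_def)
  have cmid: "continuous_map (G n) (G n) (\<lambda>w. w)" by (rule cm_id)
  define k where "k z = (fst z, restrict (hB (0, z)) (cylset n))" for z
  have kc: "continuous_map (G n) (G n) k"
  proof (rule cm_into_Gam)
    show "continuous_map (G n) (discrete_topology (singular_simplex_set n B)) (\<lambda>w. fst (k w))"
      by (simp add: k_def cm_Gam_fst eta_contract_eq)
    have "continuous_map (prod_topology (G n) (cyl n)) B (\<lambda>q. (\<lambda>w. hB (fst w) (snd w)) ((0, fst q), snd q))"
      by (rule cm_comp[OF hB]) (intro continuous_map_pairedI cm_fst' cm_snd' cm_const; simp)
    then have "continuous_map (prod_topology (G n) (cyl n)) B (\<lambda>q. hB (0, fst q) (snd q))" by simp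
    then show "continuous_map (prod_topology (G n) (cyl n)) B (\<lambda>q. snd (k (fst q)) (snd q))"
      unfolding k_def snd_conv by (rule cm_restrict[where f = "\<lambda>z. hB (0, z)"]) simp
    fix w x assume w: "w \<in> topspace (G n)" and x: "x \<in> standard_simplex n"
    show "snd (k w) (x, 0) = b"
      using x Gam_facts(2)[OF w vert0_in] by (simp add: k_def hB_0)
    show "snd (k w) (x, 1) = fst (k w) x"
      using x Gam_facts(3)[OF w x] by (simp add: k_def hB_0)
  qed (simp add: k_def)
  have B: "homotopic_with (\<lambda>_. True) (G n) (G n) k id"
  proof (rule homotopic_into_Gam[OF hB cm_Gam_fst])
    fix s :: real and w x assume s: "s \<in> {0..1}" and w: "w \<in> topspace (G n)" and x: "x \<in> standard_simplex n"
    have "mix s vert0 x \<in> standard_simplex n" using s x by (intro mix_in) (auto simp: vert0_in)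
    from Gam_facts(2)[OF w this] show "hB (s, w) (x, 0) = b"
      by (simp add: hB_def)
    show "hB (s, w) (x, 1) = fst w x"
      using Gam_facts(3)[OF w x] by (simp add: hB_def)
  qed (auto simp: kc k_def hB_def)
  \<comment> \<open>The first stage. \<open>?a\<close> falls from 1 to 0 on [1/6, 1/3] and is back
    at 1 at 2/3, which is the detour along \<open>lam\<close>; raising it to the constant 1 leaves a
    path that rests at the vertex.\<close>
  let ?a = "\<lambda>t. max (2 - 6 * t) (3 * t - 1)"
  define hA where "hA p d = (if snd d \<le> 1/6 then snd (snd p) (vert0, 6 * snd d)
      else if snd d \<le> 2/3 then lam (fst (snd p) vert0) ((1 - fst p) * ?a (snd d) + fst p * 1)
      else fst (snd p) (mix (3 * snd d - 2) vert0 (fst d)))"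
    for p :: "real \<times> 'b path_simplex" and d :: "(nat \<Rightarrow> real) \<times> real"
  have "continuous_map ?P B (\<lambda>w. hA (fst w) (snd w))"
    unfolding hA_def
  proof (rule cm_if_le)
    show "continuous_map (subtopology ?P {w \<in> topspace ?P. snd (snd w) \<le> 1/6}) B
        (\<lambda>w. snd (snd (fst w)) (vert0, 6 * snd (snd w)))"
      by (rule cm_Gam_eval[of _ n B b]) (auto simp: cm_interval vert0_in intro!: continuous_intros cm_sub t z)
    let ?W = "subtopology ?P {w \<in> topspace ?P. 1/6 \<le> snd (snd w)}"
    show "continuous_map ?W B (\<lambda>w. if snd (snd w) \<le> 2/3
        then lam (fst (snd (fst w)) vert0) ((1 - fst (fst w)) * ?a (snd (snd w)) + fst (fst w) * 1)
        else fst (snd (fst w)) (mix (3 * snd (snd w) - 2) vert0 (fst (snd w))))"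
    proof (rule cm_if_le)
      let ?V = "subtopology ?W {w \<in> topspace ?W. snd (snd w) \<le> 2/3}"
      have "continuous_map ?V unit_interval (\<lambda>w. (1 - fst (fst w)) * ?a (snd (snd w)) + fst (fst w) * 1)"
        unfolding cm_interval
      proof (intro conjI ballI)
        fix w assume "w \<in> topspace ?V"
        then have "fst (fst w) \<in> {0..1}" "1/6 \<le> snd (snd w)" "snd (snd w) \<le> 2/3" by auto
        then show "0 \<le> (1 - fst (fst w)) * ?a (snd (snd w)) + fst (fst w) * 1"
          "(1 - fst (fst w)) * ?a (snd (snd w)) + fst (fst w) * 1 \<le> 1"
          using bound_mix[of "fst (fst w)" 0 "?a (snd (snd w))" 1 1] by auto
      qed (intro continuous_intros cm_sub[OF cm_sub[OF s]] cm_sub[OF cm_sub[OF t]])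
      then show "continuous_map ?V B (\<lambda>w. lam (fst (snd (fst w)) vert0) ((1 - fst (fst w)) * ?a (snd (snd w)) + fst (fst w) * 1))"
        by (intro cm_lam[of _ n] vert0_in cm_sub[OF cm_sub[OF c]])
      let ?U = "subtopology ?W {w \<in> topspace ?W. 2/3 \<le> snd (snd w)}"
      have "continuous_map ?U (simplex_top n) (\<lambda>w. mix (3 * snd (snd w) - 2) vert0 (fst (snd w)))"
        by (rule cm_mix) (auto simp: vert0_in intro!: continuous_intros cm_sub t x)
      then show "continuous_map ?U B (\<lambda>w. fst (snd (fst w)) (mix (3 * snd (snd w) - 2) vert0 (fst (snd w))))"
        by (intro cm_simplex_eval[of _ n] cm_sub[OF cm_sub[OF c]])
      fix w assume w: "w \<in> topspace ?W" "snd (snd w) = 2/3"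
      then have "snd (fst w) \<in> topspace (G n)" by auto
      from Gam_facts[OF this]
      show "lam (fst (snd (fst w)) vert0) ((1 - fst (fst w)) * ?a (snd (snd w)) + fst (fst w) * 1) =
          fst (snd (fst w)) (mix (3 * snd (snd w) - 2) vert0 (fst (snd w)))"
        by (simp add: w(2))
    qed (auto intro: cm_sub t)
    fix w assume w: "w \<in> topspace ?P" "snd (snd w) = 1/6"
    then have "snd (fst w) \<in> topspace (G n)" by auto
    from Gam_facts[OF this]
    show "snd (snd (fst w)) (vert0, 6 * snd (snd w)) = (if snd (snd w) \<le> 2/3
        then lam (fst (snd (fst w)) vert0) ((1 - fst (fst w)) * ?a (snd (snd w)) + fst (fst w) * 1)
        else fst (snd (fst w)) (mix (3 * snd (snd w) - 2) vert0 (fst (snd w))))"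
      by (simp add: w(2) vert0_in)
  qed (auto intro: t)
  then have A: "homotopic_with (\<lambda>_. True) (G n) (G n) (PSI n \<circ> RR) k"
  proof (rule homotopic_into_Gam[OF _ cm_Gam_fst])
    fix s :: real and w x assume s: "s \<in> {0..1}" and w: "w \<in> topspace (G n)" and x: "x \<in> standard_simplex n"
    show "hA (s, w) (x, 0) = b" using Gam_facts(2)[OF w vert0_in] by (simp add: hA_def)
    show "hA (s, w) (x, 1) = fst w x" by (simp add: hA_def)
  next
    fix w x and t :: real assume w: "w \<in> topspace (G n)" and x: "x \<in> standard_simplex n" and t: "t \<in> {0..1}"
    note f = Gam_facts[OF w] 
    consider "t \<le> 1/6" | "1/6 < t" "t \<le> 1/3" | "1/3 < t" "t \<le> 2/3" | "2/3 < t" by linarith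
    then show "snd ((PSI n \<circ> RR) w) (x, t) = hA (0, w) (x, t)"
    proof cases
      case 2
      then have "?a t = 2 - 6 * t" by auto
      then show ?thesis using 2 x t by (simp add: PSI_def RR_def psi_def om_def rr_def hA_def)
    next
      case 3
      then have "?a t = 3 * t - 1" by auto
      then show ?thesis using 3 x t by (simp add: PSI_def RR_def psi_def om_def rr_def hA_def)
    qed (use x t in \<open>simp_all add: PSI_def RR_def psi_def om_def rr_def hA_def\<close>)
    show "snd (k w) (x, t) = hA (1, w) (x, t)"
    proof -
      consider "t \<le> 1/6" | "1/6 < t" "t \<le> 2/3" | "2/3 < t" by linarith
      then show ?thesis
      proof cases
        case 2
        then have "?u t = 0" "min (6 * t) 1 = 1" by auto
        then show ?thesis using 2 x t f(3)[OF vert0_in] f by (simp add: k_def hB_0 hA_def)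
      next
        case 3
        then have "?u t = 3 * t - 2" "min (6 * t) 1 = 1" by auto
        moreover have "mix (3 * t - 2) vert0 x \<in> standard_simplex n" using 3 x t by (intro mix_in) (auto simp: vert0_in)
        ultimately show ?thesis using 3 x t f by (simp add: k_def hB_0 hA_def)
      qed (use x t in \<open>simp add: k_def hB_0 hA_def\<close>)
    qed
  next
    show "continuous_map (G n) (G n) (PSI n \<circ> RR)" by (rule continuous_map_compose[OF cm_RR cm_PSI])
  qed (simp_all add: PSI_def RR_def k_def kc)
  show ?thesis by (rule homotopic_with_trans[OF A B])
qed

end

section \<open>Compatibility of the trivialisation with the face maps\<close>

lemma singular_face_simplex:
  "singular_simplex (Suc n) B f \<Longrightarrow> k \<le> Suc n \<Longrightarrow> singular_simplex n B (singular_face (Suc n) k f)"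
  using singular_simplex_singular_face[of "Suc n" B f k] by simp

context trivialisation begin

text \<open>These faces keep vertex 0, and \<open>rr\<close> sees nothing of a lifted simplex but
  the path over that vertex and the vertex itself.\<close>

lemma RR_gface_Suc:
  assumes z: "z \<in> topspace (G (Suc n))" and k: "k \<le> n"
  shows "RR (gface n (Suc k) z) = qface n (Suc k) (RR z)"
proof -
  have e: "simplical_face (Suc k) vert0 = (vert0 :: nat \<Rightarrow> real)" by (auto simp: simplical_face_def)
  have "fst (gface n (Suc k) z) vert0 = fst z vert0"
    "\<And>t. t \<in> {0..1} \<Longrightarrow> snd (gface n (Suc k) z) (vert0, t) = snd z (vert0, t)"
    using vert0_in[of n] by (simp_all add: gface_def singular_face_def e)
  then have "rr (gface n (Suc k) z) = rr z"
    unfolding rr_def by (intro restrict_ext) auto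
  then show ?thesis by (simp add: RR_def qface_def gface_def)
qed

abbreviation vert1 :: "nat \<Rightarrow> real" where
  "vert1 \<equiv> simplical_face 0 vert0"

text \<open>Face 0 moves the reference point from vertex 0 to vertex 1. The path over vertex 1 is
  first slid to the path over vertex 0 followed by the first edge; this edge and the return along
  \<open>lam\<close> from vertex 1 are then exchanged for the return from vertex 0, by a homotopy
  chosen for each simplex.\<close>

lemma RR_gface_0: "homotopic_with (\<lambda>_. True) (G (Suc n)) (Q n) (RR \<circ> gface n 0) (qface n 0 \<circ> RR)"
proof -
  let ?N = "Suc n" and ?W = "G (Suc n)"
  let ?P = "prod_topology unit_interval ?W"
  let ?R = "prod_topology ?P unit_interval"
  have v0: "vert0 \<in> standard_simplex ?N" and v1: "vert1 \<in> standard_simplex ?N"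
    using vert0_in face_in_simplex[of 0 n vert0] by auto
  have s: "continuous_map ?R euclideanreal (\<lambda>w. fst (fst w))"
    by (rule cm_interval_real[OF cm_fst[OF cm_fst']])
  have t: "continuous_map ?R euclideanreal snd" by (rule cm_interval_real[OF cm_snd'])
  have z: "continuous_map ?R ?W (\<lambda>w. snd (fst w))" by (rule cm_snd[OF cm_fst'])
  have c: "continuous_map ?R (discrete_topology (singular_simplex_set ?N B)) (\<lambda>w. fst (snd (fst w)))"
    by (rule cm_comp[OF cm_Gam_fst z])
  have cf: "continuous_map ?W (discrete_topology (singular_simplex_set n B)) (\<lambda>w. singular_face ?N 0 (fst w))"
    by (rule cm_discrete_map[OF cm_Gam_fst]) (simp add: singular_face_simplex)
  have pt: "\<tau> vert0 \<in> topspace B" "\<tau> vert1 \<in> topspace B" if "singular_simplex ?N B \<tau>" for \<tau>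
    using simplex_point[OF that] v0 v1 by auto
  \<comment> \<open>the path running along the first edge and then back to \<open>b\<close>\<close>
  let ?m = "\<lambda>t. mix (max 0 (4 * t - 1)) vert0 vert1"
  define beta where "beta \<tau> u = (if u \<le> 1/3 then \<tau> (mix (3 * u) vert0 vert1) else lam (\<tau> vert1) ((3 - 3 * u) / 2))"
    for \<tau> and u :: real
  have id: "continuous_map unit_interval euclideanreal (\<lambda>t. t)" by (rule cm_interval_real[OF cm_id])
  have beta: "continuous_map unit_interval B (beta \<tau>)" "beta \<tau> 0 = \<tau> vert0" "beta \<tau> 1 = b"
    if \<tau>: "singular_simplex ?N B \<tau>" for \<tau>
  proof -
    show "continuous_map unit_interval B (beta \<tau>)"
      unfolding beta_def
    proof (rule cm_if_le)
      show "continuous_map (subtopology unit_interval {x \<in> topspace unit_interval. x \<le> 1/3}) B (\<lambda>u. \<tau> (mix (3 * u) vert0 vert1))"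
        by (rule cm_singular[OF \<tau> cm_mix]) (auto simp: v0 v1 intro!: continuous_intros cm_sub id)
      show "continuous_map (subtopology unit_interval {x \<in> topspace unit_interval. 1/3 \<le> x}) B (\<lambda>u. lam (\<tau> vert1) ((3 - 3 * u) / 2))"
        by (rule cm_comp[OF lam[OF pt(2)[OF \<tau>]]]) (auto simp: cm_interval intro!: continuous_intros cm_sub id)
      fix u :: real assume u: "u = 1/3"
      show "\<tau> (mix (3 * u) vert0 vert1) = lam (\<tau> vert1) ((3 - 3 * u) / 2)"
        using lam_1[OF pt(2)[OF \<tau>]] by (simp add: u)
    qed (use id in auto)
    show "beta \<tau> 0 = \<tau> vert0" "beta \<tau> 1 = b"
      using lam_0[OF pt(2)[OF \<tau>]] by (simp_all add: beta_def)
  qed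
  let ?H = "\<lambda>\<tau> h. continuous_map (prod_topology unit_interval unit_interval) B (\<lambda>z. h (fst z) (snd z)) \<and>
      (\<forall>u\<in>{0..1}. h 0 u = beta \<tau> u) \<and> (\<forall>u\<in>{0..1}. h 1 u = lam (\<tau> vert0) (1 - u)) \<and>
      (\<forall>s\<in>{0..1}. h s 0 = \<tau> vert0) \<and> (\<forall>s\<in>{0..1}. h s 1 = b)"
  have ex: "\<exists>h. ?H \<tau> h"
    if \<tau>: "singular_simplex ?N B \<tau>" for \<tau>
  proof -
    have "continuous_map unit_interval B (\<lambda>u. lam (\<tau> vert0) (1 - u))"
      by (rule cm_comp[OF lam[OF pt(1)[OF \<tau>]]]) (auto simp: cm_interval intro!: continuous_intros id)
    moreover have "lam (\<tau> vert0) (1 - 0) = \<tau> vert0" "lam (\<tau> vert0) (1 - 1) = b"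
      using lam_0[OF pt(1)[OF \<tau>]] lam_1[OF pt(1)[OF \<tau>]] by simp_all
    ultimately obtain h where "continuous_map (prod_topology unit_interval unit_interval) B (\<lambda>z. h (fst z) (snd z))"
      "\<And>u. u \<in> {0..1} \<Longrightarrow> h 0 u = beta \<tau> u" "\<And>u. u \<in> {0..1} \<Longrightarrow> h 1 u = lam (\<tau> vert0) (1 - u)"
      "\<And>s. s \<in> {0..1} \<Longrightarrow> h s 0 = \<tau> vert0" "\<And>s. s \<in> {0..1} \<Longrightarrow> h s 1 = b"
      using loops_homotopic_rel_ends[OF loops_connected beta[OF \<tau>]] by blast
    then show ?thesis by blast
  qed
  \<comment> \<open>One filling is chosen for every simplex; no continuity of the choice is needed
    because the simplices form a discrete space.\<close>
  define hh where "hh \<tau> = (SOME h. ?H \<tau> h)" for \<tau>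
  have "?H \<tau> (hh \<tau>)" if "singular_simplex ?N B \<tau>" for \<tau>
    unfolding hh_def by (rule someI_ex[OF ex[OF that]])
  then have hh: "\<And>\<tau>. singular_simplex ?N B \<tau> \<Longrightarrow>
      continuous_map (prod_topology unit_interval unit_interval) B (\<lambda>z. hh \<tau> (fst z) (snd z))"
    "\<And>\<tau> u. singular_simplex ?N B \<tau> \<Longrightarrow> u \<in> {0..1} \<Longrightarrow> hh \<tau> 0 u = beta \<tau> u"
    "\<And>\<tau> u. singular_simplex ?N B \<tau> \<Longrightarrow> u \<in> {0..1} \<Longrightarrow> hh \<tau> 1 u = lam (\<tau> vert0) (1 - u)"
    "\<And>\<tau> s. singular_simplex ?N B \<tau> \<Longrightarrow> s \<in> {0..1} \<Longrightarrow> hh \<tau> s 0 = \<tau> vert0"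
    "\<And>\<tau> s. singular_simplex ?N B \<tau> \<Longrightarrow> s \<in> {0..1} \<Longrightarrow> hh \<tau> s 1 = b"
    by blast+
  \<comment> \<open>Inside simplex times interval the segment over vertex 1 is moved linearly to a
    broken line: up over vertex 0 until t = 1/4, then along the first edge at height 1 until t =
    1/2.\<close>
  let ?gA = "\<lambda>p t. if t \<le> 1/2
      then snd (snd p) (mix (fst p) vert1 (?m t), (1 - fst p) * (2 * t) + fst p * min (4 * t) 1)
      else lam (fst (snd p) vert1) (2 - 2 * t)"
  define hA where "hA p = restrict (?gA p) {0..1}" for p :: "real \<times> 'b path_simplex"
  have "continuous_map ?R B (\<lambda>w. ?gA (fst w) (snd w))"
  proof (rule cm_if_le)
    let ?V = "subtopology ?R {w \<in> topspace ?R. snd w \<le> 1/2}"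
    have "continuous_map ?V unit_interval (\<lambda>w. (1 - fst (fst w)) * (2 * snd w) + fst (fst w) * min (4 * snd w) 1)"
      unfolding cm_interval
    proof (intro conjI ballI)
      fix w assume "w \<in> topspace ?V"
      then have "fst (fst w) \<in> {0..1}" "snd w \<in> {0..1}" "snd w \<le> 1/2" by auto
      then show "0 \<le> (1 - fst (fst w)) * (2 * snd w) + fst (fst w) * min (4 * snd w) 1"
          "(1 - fst (fst w)) * (2 * snd w) + fst (fst w) * min (4 * snd w) 1 \<le> 1"
        using bound_mix[of "fst (fst w)" 0 "2 * snd w" 1 "min (4 * snd w) 1"] by auto
    qed (intro continuous_intros cm_sub[OF s] cm_sub[OF t])
    moreover have m: "continuous_map ?V (simplex_top ?N) (\<lambda>w. ?m (snd w))"
      by (rule cm_mix) (auto simp: v0 v1 intro!: continuous_intros cm_sub[OF t])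
    have "continuous_map ?V (simplex_top ?N) (\<lambda>w. mix (fst (fst w)) vert1 (?m (snd w)))"
      by (rule cm_mix[OF cm_sub[OF s] _ m]) (auto simp: v1)
    ultimately show "continuous_map ?V B (\<lambda>w. snd (snd (fst w)) (mix (fst (fst w)) vert1 (?m (snd w)),
        (1 - fst (fst w)) * (2 * snd w) + fst (fst w) * min (4 * snd w) 1))"
      by (intro cm_Gam_eval[of _ ?N B b] cm_sub[OF z])
    show "continuous_map (subtopology ?R {w \<in> topspace ?R. 1/2 \<le> snd w}) B (\<lambda>w. lam (fst (snd (fst w)) vert1) (2 - 2 * snd w))"
      by (rule cm_lam[of _ ?N]) (auto simp: cm_interval v1 intro!: continuous_intros cm_sub[OF t] cm_sub[OF c])
    fix w assume w: "w \<in> topspace ?R" "snd w = 1/2"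
    then have G: "snd (fst w) \<in> topspace ?W" by auto
    show "snd (snd (fst w)) (mix (fst (fst w)) vert1 (?m (snd w)), (1 - fst (fst w)) * (2 * snd w) + fst (fst w) * min (4 * snd w) 1)
        = lam (fst (snd (fst w)) vert1) (2 - 2 * snd w)"
      using Gam_facts(3)[OF G v1] lam_1[OF pt(2)[OF Gam_facts(1)[OF G]]] by (simp add: w(2))
  qed (use t in auto)
  then have "continuous_map ?R B (\<lambda>w. hA (fst w) (snd w))"
    unfolding hA_def by (rule cm_restrict[where f = ?gA]) simp
  then have hA: "continuous_map ?P F hA"
  proof (rule cm_into_loop_space[rotated 3])
    fix p assume p: "p \<in> topspace ?P"
    then have G: "snd p \<in> topspace ?W" and p1: "fst p \<in> {0..1}" by auto
    have "mix (fst p) vert1 vert0 \<in> standard_simplex ?N"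
      using p1 by (intro mix_in) (auto simp: v0 v1)
    from Gam_facts(2)[OF G this] show "hA p 0 = b" by (simp add: hA_def)
    show "hA p 1 = b" using lam_0[OF pt(2)[OF Gam_facts(1)[OF G]]] by (simp add: hA_def)
  qed (simp only: hA_def restrict_extensional)
  \<comment> \<open>The break point moves from 1/4, where the path over vertex 0 ends in
    \<open>hA (1, z)\<close>, to 1/2, where it ends in \<open>rr z\<close>; the rest of the interval
    is filled by \<open>hh\<close>.\<close>
  let ?c = "\<lambda>p. (1 + fst p) / 4"
  let ?gB = "\<lambda>p t. if t \<le> ?c p then snd (snd p) (vert0, t / ?c p) else hh (fst (snd p)) (fst p) ((t - ?c p) / (1 - ?c p))"
  define hB where "hB p = restrict (?gB p) {0..1}" for p :: "real \<times> 'b path_simplex"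
  have "continuous_map ?R B (\<lambda>w. ?gB (fst w) (snd w))"
  proof (rule cm_if_le)
    show cc: "continuous_map ?R euclideanreal (\<lambda>w. ?c (fst w))" by (intro continuous_intros s) auto
    let ?V = "subtopology ?R {w \<in> topspace ?R. snd w \<le> ?c (fst w)}"
    have "continuous_map ?V unit_interval (\<lambda>w. snd w / ?c (fst w))"
      unfolding cm_interval
      by (intro conjI ballI continuous_intros cm_sub[OF s] cm_sub[OF t]) (auto simp: field_simps)
    then show "continuous_map ?V B (\<lambda>w. snd (snd (fst w)) (vert0, snd w / ?c (fst w)))"
      by (intro cm_Gam_eval[of _ ?N B b] cm_sub[OF z] cm_const) (auto simp: v0)
    let ?U = "subtopology ?R {w \<in> topspace ?R. ?c (fst w) \<le> snd w}"
    have "continuous_map ?U unit_interval (\<lambda>w. (snd w - ?c (fst w)) / (1 - ?c (fst w)))"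
      unfolding cm_interval
      by (intro conjI ballI continuous_intros cm_sub[OF s] cm_sub[OF t]) (auto simp: field_simps)
    moreover have "continuous_map ?U unit_interval (\<lambda>w. fst (fst w))"
      by (rule cm_sub[OF cm_fst[OF cm_fst']])
    ultimately have "continuous_map ?U (prod_topology unit_interval unit_interval)
        (\<lambda>w. (fst (fst w), (snd w - ?c (fst w)) / (1 - ?c (fst w))))"
      by (intro continuous_map_pairedI)
    from cm_parametric_eval[OF cm_sub[OF c] hh(1) this]
    show "continuous_map ?U B (\<lambda>w. hh (fst (snd (fst w))) (fst (fst w)) ((snd w - ?c (fst w)) / (1 - ?c (fst w))))"
      by simp
    fix w assume w: "w \<in> topspace ?R" "snd w = ?c (fst w)"
    then have G: "snd (fst w) \<in> topspace ?W" and s01: "fst (fst w) \<in> {0..1}" by auto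
    have "?c (fst w) \<noteq> 0" using s01 by auto
    then show "snd (snd (fst w)) (vert0, snd w / ?c (fst w)) =
        hh (fst (snd (fst w))) (fst (fst w)) ((snd w - ?c (fst w)) / (1 - ?c (fst w)))"
      unfolding w(2) using Gam_facts(3)[OF G v0] hh(4)[OF Gam_facts(1)[OF G] s01] by simp
  qed (rule t)
  then have "continuous_map ?R B (\<lambda>w. hB (fst w) (snd w))"
    unfolding hB_def by (rule cm_restrict[where f = ?gB]) simp
  then have hB: "continuous_map ?P F hB"
  proof (rule cm_into_loop_space[rotated 3])
    fix p assume p: "p \<in> topspace ?P"
    then have G: "snd p \<in> topspace ?W" and p1: "fst p \<in> {0..1}" by auto
    show "hB p 0 = b" using p1 Gam_facts(2)[OF G v0] by (simp add: hB_def)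
    have "1 - ?c p \<noteq> 0" "\<not> 1 \<le> ?c p" using p1 by auto
    then show "hB p 1 = b"
      using hh(5)[OF Gam_facts(1)[OF G] p1] by (simp add: hB_def)
  qed (simp only: hB_def restrict_extensional)
  have A: "homotopic_with (\<lambda>_. True) ?W (Q n) (RR \<circ> gface n 0) (\<lambda>z. (singular_face ?N 0 (fst z), hA (1, z)))"
  proof (rule homotopic_into_Q[OF hA cf])
    fix z assume "z \<in> topspace ?W"
    have "rr (gface n 0 z) = hA (0, z)"
      using vert0_in[of n] by (auto simp: rr_def hA_def gface_def singular_face_def fun_eq_iff restrict_def)
    then show "(RR \<circ> gface n 0) z = (singular_face ?N 0 (fst z), hA (0, z))"
      by (simp add: RR_def gface_def)
  qed simp
  have B: "homotopic_with (\<lambda>_. True) ?W (Q n) (\<lambda>z. (singular_face ?N 0 (fst z), hA (1, z))) (qface n 0 \<circ> RR)"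
  proof (rule homotopic_into_Q[OF hB cf])
    fix z assume z: "z \<in> topspace ?W"
    note f = Gam_facts[OF z]
    have "hA (1, z) t = hB (0, z) t" if t: "t \<in> {0..1}" for t
    proof -
      have m: "(t - 1/4) / (3/4) \<in> {0..1}" if "1/4 \<le> t" using that t by auto
      consider "t \<le> 1/4" | "1/4 < t" "t \<le> 1/2" | "1/2 < t" by linarith
      then show ?thesis
      proof cases
        case 2
        have e: "max 0 (4 * t - 1) = 4 * t - 1" "min (4 * t) 1 = 1" using 2 by auto
        have "mix (4 * t - 1) vert0 vert1 \<in> standard_simplex ?N" using 2 by (intro mix_in v0 v1) auto
        from f(3)[OF this] have "hA (1, z) t = fst z (mix (4 * t - 1) vert0 vert1)"
          using 2 t by (simp add: hA_def e)
        moreover have "3 * ((t - 1/4) / (3/4)) = 4 * t - 1" "(t - 1/4) / (3/4) \<le> 1/3" using 2 by (simp_all add: field_simps)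
        then have "beta (fst z) ((t - 1/4) / (3/4)) = fst z (mix (4 * t - 1) vert0 vert1)"
          by (simp only: beta_def if_True)
        ultimately show ?thesis using 2 t hh(2)[OF f(1) m] by (simp add: hB_def)
      next
        case 3
        have "(3 - 3 * ((t - 1/4) / (3/4))) / 2 = 2 - 2 * t" by (simp add: field_simps)
        moreover have "\<not> (t - 1/4) / (3/4) \<le> 1/3" using 3 by simp
        ultimately have "beta (fst z) ((t - 1/4) / (3/4)) = lam (fst z vert1) (2 - 2 * t)"
          by (simp only: beta_def if_False)
        then show ?thesis using 3 t hh(2)[OF f(1) m] by (simp add: hB_def hA_def)
      qed (use t in \<open>simp add: hA_def hB_def mult.commute\<close>)
    qed
    then have "hA (1, z) = hB (0, z)"
      by (intro extensionalityI[of _ "{0..1}"]) (simp_all only: hA_def hB_def restrict_extensional)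
    then show "(singular_face ?N 0 (fst z), hA (1, z)) = (singular_face ?N 0 (fst z), hB (0, z))" by simp
    have "rr z t = hB (1, z) t" if t: "t \<in> {0..1}" for t
    proof (cases "t \<le> 1/2")
      case False
      have "(t - 1/2) / (1 - 1/2) \<in> {0..1}" using False t by auto
      from hh(3)[OF f(1) this] have "hh (fst z) 1 ((t - 1/2) / (1 - 1/2)) = lam (fst z vert0) (2 - 2 * t)"
        by (simp add: algebra_simps)
      then show ?thesis using False t by (simp add: rr_def hB_def)
    qed (use t in \<open>simp add: rr_def hB_def mult.commute\<close>)
    then have "rr z = hB (1, z)"
      by (intro extensionalityI[of _ "{0..1}"]) (simp_all only: rr_def hB_def restrict_extensional)
    then show "(qface n 0 \<circ> RR) z = (singular_face ?N 0 (fst z), hB (1, z))"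
      by (simp add: qface_def RR_def)
  qed
  show ?thesis by (rule homotopic_with_trans[OF A B])
qed

text \<open>A 1-simplex of the base along \<open>lam\<close>, with the loop carried along unchanged.
  Its two faces show that a loop over any 0-simplex agrees, modulo the image of \<open>dhQ\<close>,
  with the same loop over \<open>b\<close>.\<close>

definition Lam :: "((nat \<Rightarrow> real) \<Rightarrow> 'b) \<times> (real \<Rightarrow> 'b) \<Rightarrow> ((nat \<Rightarrow> real) \<Rightarrow> 'b) \<times> (real \<Rightarrow> 'b)" where
  "Lam z = (restrict (\<lambda>u. lam (fst z vert0) (u 1)) (standard_simplex 1), snd z)"

lemma cm_Lam: "continuous_map (Q 0) (Q 1) Lam"
proof (rule cm_into_Q)
  have "singular_simplex 1 B (restrict (\<lambda>u. lam y (u 1)) (standard_simplex 1))" if y: "y \<in> topspace B" for y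
  proof -
    have "continuous_map (simplex_top 1) unit_interval (\<lambda>u. u 1)"
      using cm_simplex_coord[OF cm_id[of "simplex_top 1"], of 1] by (auto simp: cm_interval standard_simplex_def)
    from cm_comp[OF lam[OF y] this] have "continuous_map (simplex_top 1) B (restrict (\<lambda>u. lam y (u 1)) (standard_simplex 1))"
      by (rule continuous_map_eq) simp
    then show ?thesis by (simp add: singular_simplex_def)
  qed
  then show "continuous_map (Q 0) (discrete_topology (singular_simplex_set 1 B)) (\<lambda>w. fst (Lam w))"
    unfolding Lam_def fst_conv
    by (intro cm_discrete_map[OF cm_Q_fst, where h = "\<lambda>\<tau>. restrict (\<lambda>u. lam (\<tau> vert0) (u 1)) (standard_simplex 1)"]
        CollectI) (simp only: mem_Collect_eq simplex_point vert0_in)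
qed (simp add: Lam_def cm_Q_snd eta_contract_eq)

definition fibre_Q :: "(real \<Rightarrow> 'b) \<Rightarrow> ((nat \<Rightarrow> real) \<Rightarrow> 'b) \<times> (real \<Rightarrow> 'b)" where
  "fibre_Q g = (restrict (\<lambda>_. b) (standard_simplex 0), g)"

lemma cm_fibre_Q: "continuous_map F (Q 0) fibre_Q"
  using singular_simplex_const[OF base, of 0] by (intro cm_into_Q) (auto simp: fibre_Q_def cm_id)

lemma qface_Lam:
  assumes z: "z \<in> topspace (Q 0)"
  shows "qface 0 0 (Lam z) = z" "qface 0 1 (Lam z) = fibre_Q (snd z)"
proof -
  have f0: "simplical_face 0 x \<in> standard_simplex 1" "simplical_face 1 x \<in> standard_simplex 1"
    "simplical_face 0 x 1 = 1" "simplical_face 1 x 1 = 0" "x = vert0" if "x \<in> standard_simplex 0" for x :: "nat \<Rightarrow> real"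
    using that face_in_simplex[of 0 0 x] face_in_simplex[of 1 0 x] by (auto simp: standard_simplex_0 simplical_face_def)
  have "fst z \<in> extensional (standard_simplex 0)" using Q_facts(1)[OF z] by (simp add: singular_simplex_def)
  then show "qface 0 0 (Lam z) = z"
    using Q_facts(6)[OF z] f0 by (auto simp: qface_def Lam_def singular_face_def prod_eq_iff fun_eq_iff restrict_def extensional_def)
  show "qface 0 1 (Lam z) = fibre_Q (snd z)"
    using Q_facts(5)[OF z] f0 by (auto simp: qface_def Lam_def fibre_Q_def singular_face_def fun_eq_iff restrict_def)
qed

text \<open>Over \<open>b\<close> the path \<open>lam\<close> is constant, so the composite differs
  from the inclusion of the fibre only by a change of speed.\<close>

lemma fibre_PSI: "homotopic_with (\<lambda>_. True) F (G 0) (PSI 0 \<circ> fibre_Q) (fibre b)"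
proof -
  let ?P = "prod_topology (prod_topology unit_interval F) (cyl 0)"
  let ?c = "restrict (\<lambda>_. b) (standard_simplex 0)"
  define h where "h p d = snd p ((1 - fst p) * min (3 * snd d) 1 + fst p * snd d)"
    for p :: "real \<times> (real \<Rightarrow> 'b)" and d :: "(nat \<Rightarrow> real) \<times> real"
  have s: "continuous_map ?P euclideanreal (\<lambda>w. fst (fst w))"
    by (rule cm_interval_real[OF cm_fst[OF cm_fst']])
  have t: "continuous_map ?P euclideanreal (\<lambda>w. snd (snd w))" by (rule cm_interval_real[OF cm_cyl_time])
  have "continuous_map ?P unit_interval (\<lambda>w. (1 - fst (fst w)) * min (3 * snd (snd w)) 1 + fst (fst w) * snd (snd w))"
    unfolding cm_interval
  proof (intro conjI ballI)
    fix w assume "w \<in> topspace ?P"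
    then have "fst (fst w) \<in> {0..1}" "snd (snd w) \<in> {0..1}" by auto
    then show "0 \<le> (1 - fst (fst w)) * min (3 * snd (snd w)) 1 + fst (fst w) * snd (snd w)"
        "(1 - fst (fst w)) * min (3 * snd (snd w)) 1 + fst (fst w) * snd (snd w) \<le> 1"
      using bound_mix[of "fst (fst w)" 0 "min (3 * snd (snd w)) 1" 1 "snd (snd w)"] by auto
  qed (intro continuous_intros s t)
  then have "continuous_map ?P B (\<lambda>w. h (fst w) (snd w))"
    unfolding h_def by (intro cm_loop_eval[of _ B b] cm_snd[OF cm_fst'])
  then show ?thesis
  proof (rule homotopic_into_Gam[where c = "\<lambda>_. ?c"])
    show "continuous_map F (discrete_topology (singular_simplex_set 0 B)) (\<lambda>_. ?c)"
      using singular_simplex_const[OF base, of 0] by simp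
    fix g assume "g \<in> topspace F"
    then have g: "g 0 = b" "g 1 = b" by (auto simp: topspace_loop_space loops_def)
    fix x assume x: "x \<in> standard_simplex 0"
    show "h (s, g) (x, 0) = b" "h (s, g) (x, 1) = ?c x" for s
      using g x by (simp_all add: h_def)
    fix t :: real assume t: "t \<in> {0..1}"
    show "snd (fibre b g) (x, t) = h (1, g) (x, t)"
      using x t by (simp add: fibre_def h_def)
    have m: "mix (3 * t - 2) vert0 x \<in> standard_simplex 0" if "\<not> t \<le> 2/3"
      using that t x by (intro mix_in) (auto simp: vert0_in)
    show "snd ((PSI 0 \<circ> fibre_Q) g) (x, t) = h (0, g) (x, t)"
      using x t g m vert0_in[of 0] lam_base[of "3 * t - 1"]
      by (auto simp: PSI_def fibre_Q_def psi_def om_def h_def min_def)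
  qed (auto simp: PSI_def fibre_Q_def fibre_def cm_fibre[OF base] intro: continuous_map_compose[OF cm_fibre_Q cm_PSI])
qed

end

section \<open>Cycles up to torsion\<close>

definition torsion_homology :: "nat \<Rightarrow> 'a topology \<Rightarrow> bool" where
  "torsion_homology j X \<longleftrightarrow> (\<forall>z. singular_relcycle j X {} z \<longrightarrow>
     (\<exists>N::int. N > 0 \<and> singular_relboundary j X {} (frag_cmul N z)))"

lemma homotopic_cycles:
  assumes "homotopic_with (\<lambda>_. True) X Y f g" "singular_relcycle j X {} c"
  shows "homologous_rel j Y {} (chain_map j f c) (chain_map j g c)"
  by (rule homotopic_imp_homologous_rel_chain_maps[OF _ assms(2)]) (use assms(1) in simp)

lemma cycle_chain_map:
  "singular_relcycle j X {} c \<Longrightarrow> continuous_map X Y f \<Longrightarrow> singular_relcycle j Y {} (chain_map j f c)"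
  by (rule singular_relcycle_chain_map) auto

lemma boundary_chain_map:
  "singular_relboundary j X {} c \<Longrightarrow> continuous_map X Y f \<Longrightarrow> singular_relboundary j Y {} (chain_map j f c)"
  by (rule singular_relboundary_chain_map) auto

lemma singular_relboundary_sum:
  "finite I \<Longrightarrow> (\<And>i. i \<in> I \<Longrightarrow> singular_relboundary j X S (f i)) \<Longrightarrow> singular_relboundary j X S (sum f I)"
  by (induction I rule: finite_induct) (auto intro: singular_relboundary_add)

lemma homologous_rel_boundary:
  "homologous_rel j X S c d \<Longrightarrow> singular_relboundary j X S c \<Longrightarrow> singular_relboundary j X S d"
  using singular_relboundary_diff[of j X S c "c - d"] by (simp add: homologous_rel_def)

lemma frag_cmul_diff: "frag_cmul a (c - d) = frag_cmul a c - frag_cmul a d"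
  by (rule poly_mapping_eqI) (simp add: lookup_minus algebra_simps)

lemma homologous_rel_cmul:
  "homologous_rel j X S c d \<Longrightarrow> homologous_rel j X S (frag_cmul a c) (frag_cmul a d)"
  using singular_relboundary_cmul[of j X S "c - d" a]
  by (simp add: homologous_rel_def frag_cmul_diff)

lemma homologous_rel_chain_map:
  "homologous_rel j X {} c d \<Longrightarrow> continuous_map X Y f \<Longrightarrow> homologous_rel j Y {} (chain_map j f c) (chain_map j f d)"
  using boundary_chain_map[of j X "c - d" Y f] by (simp add: homologous_rel_def chain_map_diff)

lemma homologous_rel_finite_sum:
  "finite I \<Longrightarrow> (\<And>i. i \<in> I \<Longrightarrow> homologous_rel j X S (f i) (g i)) \<Longrightarrow> homologous_rel j X S (sum f I) (sum g I)"
  by (rule homologous_rel_sum) auto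

lemma dh_cycle:
  assumes "singular_relcycle j (Gam (Suc n) B b) {} x"
  shows "singular_relcycle j (Gam n B b) {} (dh n j x)"
  unfolding dh_def by (intro singular_relcycle_sum singular_relcycle_cmul cycle_chain_map[OF assms] cm_gface) auto

section \<open>Chains of the model as chains of the base with coefficients\<close>

definition dhQ :: "nat \<Rightarrow> nat \<Rightarrow> (((nat \<Rightarrow> real) \<Rightarrow> 'b) \<times> (real \<Rightarrow> 'b)) chain \<Rightarrow>
    (((nat \<Rightarrow> real) \<Rightarrow> 'b) \<times> (real \<Rightarrow> 'b)) chain" where
  "dhQ n j x = (\<Sum>k\<le>Suc n. frag_cmul ((-1) ^ k) (chain_map j (qface n k) x))"

lemma dhQ_0 [simp]: "dhQ n j 0 = 0"
  by (simp add: dhQ_def)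

lemma dhQ_add: "dhQ n j (x + y) = dhQ n j x + dhQ n j y"
  unfolding dhQ_def chain_map_add frag_cmul_distrib2 sum.distrib ..

lemma dhQ_cmul: "dhQ n j (frag_cmul c x) = frag_cmul c (dhQ n j x)"
  unfolding dhQ_def chain_map_cmul frag_cmul_sum o_def frag_cmul_cmul by (simp add: mult.commute)

lemma dhQ_diff: "dhQ n j (x - y) = dhQ n j x - dhQ n j y"
  using dhQ_add[of n j x "- y"] dhQ_cmul[of n j "-1" y] by simp

lemma dhQ_sum: "finite I \<Longrightarrow> dhQ n j (sum f I) = (\<Sum>i\<in>I. dhQ n j (f i))"
  by (induction I rule: finite_induct) (auto simp: dhQ_add)

lemma dhQ_cycle:
  assumes "singular_relcycle j (Qsp (Suc n) B b) {} x"
  shows "singular_relcycle j (Qsp n B b) {} (dhQ n j x)"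
  unfolding dhQ_def by (intro singular_relcycle_sum singular_relcycle_cmul cycle_chain_map[OF assms] cm_qface) auto

lemma dhQ_boundary:
  assumes "singular_relboundary j (Qsp (Suc n) B b) {} x"
  shows "singular_relboundary j (Qsp n B b) {} (dhQ n j x)"
  unfolding dhQ_def by (intro singular_relboundary_sum singular_relboundary_cmul boundary_chain_map[OF assms] cm_qface) auto

text \<open>\<open>tens j c m\<close> plays the role of the tensor product of \<open>c\<close> and \<open>m\<close>; \<open>comp j \<tau>\<close> extracts the
  coefficient of \<open>\<tau>\<close>.\<close>

definition tens :: "nat \<Rightarrow> ('t \<Rightarrow>\<^sub>0 int) \<Rightarrow> 's chain \<Rightarrow> ('t \<times> 's) chain" where
  "tens j c m = frag_extend (\<lambda>\<tau>. chain_map j (Pair \<tau>) m) c"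

definition comp :: "nat \<Rightarrow> 't \<Rightarrow> ('t \<times> 's) chain \<Rightarrow> 's chain" where
  "comp j \<tau> x = frag_extend (\<lambda>\<sigma>. if fst (\<sigma> vert0) = \<tau> then frag_of (simplex_map j snd \<sigma>) else 0) x"

lemma tens_of: "tens j (frag_of \<tau>) m = chain_map j (Pair \<tau>) m"
  and tens_0 [simp]: "tens j 0 m = 0"
  and tens_add: "tens j (c + d) m = tens j c m + tens j d m"
  and tens_diff: "tens j (c - d) m = tens j c m - tens j d m"
  and tens_cmul: "tens j (frag_cmul a c) m = frag_cmul a (tens j c m)"
  by (simp_all add: tens_def frag_extend_add frag_extend_diff frag_extend_cmul)

lemma tens_sum: "finite I \<Longrightarrow> tens j (sum f I) m = (\<Sum>i\<in>I. tens j (f i) m)"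
  by (induction I rule: finite_induct) (auto simp: tens_add)

lemma comp_diff: "comp j \<tau> (x - y) = comp j \<tau> x - comp j \<tau> y"
  and comp_add: "comp j \<tau> (x + y) = comp j \<tau> x + comp j \<tau> y"
  and comp_0 [simp]: "comp j \<tau> 0 = 0"
  and comp_cmul: "comp j \<tau> (frag_cmul a x) = frag_cmul a (comp j \<tau> x)"
  by (simp_all add: comp_def frag_extend_add frag_extend_diff frag_extend_cmul)

lemma comp_sum: "finite I \<Longrightarrow> comp j \<tau> (sum f I) = (\<Sum>i\<in>I. comp j \<tau> (f i))"
  by (induction I rule: finite_induct) (auto simp: comp_add)

lemma cm_Pair: "singular_simplex n B \<tau> \<Longrightarrow> continuous_map (loop_space B b) (Qsp n B b) (Pair \<tau>)"
  by (intro cm_into_Q) (auto simp: cm_id)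

lemma singular_chain_tens:
  assumes "singular_chain n B c" "singular_chain j (loop_space B b) m"
  shows "singular_chain j (Qsp n B b) (tens j c m)"
  unfolding tens_def
  by (rule singular_chain_extend) (use assms in \<open>auto simp: singular_chain_def[of n] intro!: singular_chain_chain_map cm_Pair\<close>)

lemma chain_boundary_tens:
  assumes "singular_chain j X m"
  shows "chain_boundary j (tens j c m) = tens (j - Suc 0) c (chain_boundary j m)"
proof (induction c rule: frag_induction[OF subset_UNIV])
  case (2 \<tau>)
  then show ?case by (simp add: tens_of chain_boundary_chain_map[OF assms])
qed (simp_all add: tens_diff chain_boundary_diff)

lemma cycle_tens:
  assumes "singular_chain n B c" "singular_relcycle j (loop_space B b) {} m"
  shows "singular_relcycle j (Qsp n B b) {} (tens j c m)"
proof -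
  have m: "singular_chain j (loop_space B b) m" "chain_boundary j m = 0"
    using assms(2) by (simp_all add: singular_cycle)
  have "tens k c 0 = (0 :: (((nat \<Rightarrow> real) \<Rightarrow> 'a) \<times> (real \<Rightarrow> 'a)) chain)" for k
    by (simp add: tens_def frag_extend_def)
  then show ?thesis
    using chain_boundary_tens[OF m(1), of c] m(2) singular_chain_tens[OF assms(1) m(1)]
    by (simp add: singular_cycle)
qed

lemma boundary_tens:
  assumes "singular_simplex n B \<tau>" "singular_relboundary j (loop_space B b) {} m"
  shows "singular_relboundary j (Qsp n B b) {} (tens j (frag_of \<tau>) m)"
  unfolding tens_of by (rule boundary_chain_map[OF assms(2) cm_Pair[OF assms(1)]])

lemma dhQ_tens:
  assumes m: "singular_chain j X m"
  shows "dhQ n j (tens j c m) = tens j (chain_boundary (Suc n) c) m"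
proof (induction c rule: frag_induction[OF subset_UNIV])
  case (2 \<tau>)
  have "chain_map j (qface n k) (chain_map j (Pair \<tau>) m) = chain_map j (Pair (singular_face (Suc n) k \<tau>)) m" for k
    unfolding qface_def by (simp add: chain_map_compose[symmetric, THEN fun_cong, unfolded o_apply] o_def)
  then show ?case
    by (simp add: dhQ_def tens_of chain_boundary_of tens_sum tens_cmul del: sum.atMost_Suc)
qed (simp_all add: tens_diff dhQ_diff chain_boundary_diff)

lemma comp_tens:
  assumes m: "singular_chain j X m"
  shows "comp j \<rho> (tens j c m) = frag_cmul (poly_mapping.lookup c \<rho>) m"
proof (induction c rule: frag_induction[OF subset_UNIV])
  case (2 \<tau>)
  have "comp j \<rho> (chain_map j (Pair \<tau>) m) = (if \<tau> = \<rho> then m else 0)"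
    using m unfolding singular_chain_def
  proof (induction m rule: frag_induction)
    case (one \<sigma>)
    then have "singular_simplex j X \<sigma>" by simp
    then have "simplex_map j snd (simplex_map j (Pair \<tau>) \<sigma>) = \<sigma>"
      by (auto simp: simplex_map_def singular_simplex_def extensional_def fun_eq_iff)
    moreover have "fst (simplex_map j (Pair \<tau>) \<sigma> vert0) = \<tau>"
      using vert0_in[of j] by (simp add: simplex_map_def)
    ultimately show ?case by (cases "\<tau> = \<rho>") (simp_all add: comp_def)
  qed (auto simp: chain_map_diff comp_diff)
  then show ?case by (simp add: tens_of)
next
  case (3 a b)
  then show ?case by (simp add: tens_diff comp_diff lookup_minus frag_cmul_diff_distrib)
qed simp

lemma singular_chain_comp:
  assumes "singular_chain j (Qsp n B b) x"
  shows "singular_chain j (loop_space B b) (comp j \<tau> x)"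
  unfolding comp_def
  by (rule singular_chain_extend)
     (use assms in \<open>auto simp: singular_chain_of singular_chain_def[of j "Qsp n B b"] intro: singular_simplex_simplex_map cm_Q_snd\<close>)

lemma Q_simplex_fst:
  assumes \<sigma>: "singular_simplex j (Qsp n B b) \<sigma>" and "x \<in> standard_simplex j" "y \<in> standard_simplex j"
  shows "fst (\<sigma> x) = fst (\<sigma> y)"
proof -
  have "continuous_map (simplex_top j) (discrete_topology (singular_simplex_set n B)) (\<lambda>x. fst (\<sigma> x))"
    by (rule cm_comp[OF cm_Q_fst[of n B b]]) (use \<sigma> in \<open>simp add: singular_simplex_def\<close>)
  moreover have "connectedin (simplex_top j) (standard_simplex j)"
    by (simp add: connectedin_subtopology connectedin_standard_simplex)
  ultimately have "connectedin (discrete_topology (singular_simplex_set n B)) ((\<lambda>x. fst (\<sigma> x)) ` standard_simplex j)"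
    using connectedin_continuous_map_image by blast
  then show ?thesis
    unfolding connectedin_discrete_topology using assms(2,3) by auto
qed

text \<open>All faces of a simplex of the model lie in the same copy of the loop space as the
  simplex itself.\<close>

lemma comp_chain_boundary:
  assumes "singular_chain (Suc j) (Qsp n B b) x"
  shows "comp j \<tau> (chain_boundary (Suc j) x) = chain_boundary (Suc j) (comp (Suc j) \<tau> x)"
  using assms unfolding singular_chain_def
proof (induction x rule: frag_induction)
  case (one \<sigma>)
  then have \<sigma>: "singular_simplex (Suc j) (Qsp n B b) \<sigma>" by simp
  have f: "fst (singular_face (Suc j) k \<sigma> vert0) = fst (\<sigma> vert0)" if "k \<le> Suc j" for k
    using Q_simplex_fst[OF \<sigma> face_in_simplex[OF that vert0_in] vert0_in] vert0_in[of j] by (simp add: singular_face_def)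
  have g: "simplex_map j snd (singular_face (Suc j) k \<sigma>) = singular_face (Suc j) k (simplex_map (Suc j) snd \<sigma>)"
    if "k \<le> Suc j" for k
    using face_in_simplex[OF that] by (auto simp: simplex_map_def singular_face_def fun_eq_iff)
  have "comp j \<tau> (chain_boundary (Suc j) (frag_of \<sigma>)) =
      (\<Sum>k\<le>Suc j. frag_cmul ((-1) ^ k) (comp j \<tau> (frag_of (singular_face (Suc j) k \<sigma>))))"
    by (simp add: chain_boundary_of comp_sum comp_cmul del: sum.atMost_Suc)
  also have "\<dots> = (\<Sum>k\<le>Suc j. frag_cmul ((-1) ^ k) (if fst (\<sigma> vert0) = \<tau> then
      frag_of (singular_face (Suc j) k (simplex_map (Suc j) snd \<sigma>)) else 0))"
    by (rule sum.cong) (simp_all add: comp_def f g del: sum.atMost_Suc)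
  also have "\<dots> = chain_boundary (Suc j) (comp (Suc j) \<tau> (frag_of \<sigma>))"
    by (simp add: comp_def chain_boundary_of del: sum.atMost_Suc)
  finally show ?case .
qed (simp_all add: comp_diff chain_boundary_diff)

lemma comp_cycle:
  assumes "singular_relcycle j (Qsp n B b) {} x"
  shows "singular_relcycle j (loop_space B b) {} (comp j \<tau> x)"
proof (cases j)
  case (Suc k)
  then show ?thesis
    using assms comp_chain_boundary[of k n B b x \<tau>] singular_chain_comp[of j n B b x] by (simp add: singular_cycle)
qed (use assms singular_chain_comp[of 0 n B b x] in \<open>simp add: singular_cycle chain_boundary_def\<close>)

lemma comp_boundary:
  assumes "singular_relboundary j (Qsp n B b) {} x"
  shows "singular_relboundary j (loop_space B b) {} (comp j \<tau> x)"
  using assms comp_chain_boundary singular_chain_comp unfolding singular_boundary by metis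

text \<open>Every simplex of the model lies in the copy over one base simplex, and finitely many
  copies carry a given chain.\<close>

lemma Q_decomposition:
  assumes x: "singular_chain j (Qsp n B b) x"
  obtains T where "finite T" "\<And>\<tau>. \<tau> \<in> T \<Longrightarrow> singular_simplex n B \<tau>" "x = (\<Sum>\<tau>\<in>T. tens j (frag_of \<tau>) (comp j \<tau> x))"
proof -
  define T where "T = (\<lambda>\<sigma>. fst (\<sigma> vert0)) ` Poly_Mapping.keys x"
  have T: "finite T" by (simp add: T_def)
  let ?S = "{\<sigma>. singular_simplex j (Qsp n B b) \<sigma> \<and> fst (\<sigma> vert0) \<in> T}"
  have "Poly_Mapping.keys x \<subseteq> ?S" using x by (auto simp: singular_chain_def T_def)
  then have "x = (\<Sum>\<tau>\<in>T. tens j (frag_of \<tau>) (comp j \<tau> x))"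
  proof (induction x rule: frag_induction)
    case (one \<sigma>)
    then have \<sigma>: "singular_simplex j (Qsp n B b) \<sigma>" "fst (\<sigma> vert0) \<in> T" by auto
    let ?\<tau> = "fst (\<sigma> vert0)"
    have "simplex_map j (Pair ?\<tau>) (simplex_map j snd \<sigma>) = \<sigma>"
    proof
      fix y show "simplex_map j (Pair ?\<tau>) (simplex_map j snd \<sigma>) y = \<sigma> y"
        using Q_simplex_fst[OF \<sigma>(1) vert0_in, of y] \<sigma>(1)
        by (cases "y \<in> standard_simplex j") (auto simp: simplex_map_def singular_simplex_def extensional_def prod_eq_iff)
    qed
    then have "tens j (frag_of \<tau>) (comp j \<tau> (frag_of \<sigma>)) = (if \<tau> = ?\<tau> then frag_of \<sigma> else 0)" for \<tau>
      by (auto simp: comp_def tens_of)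
    then show ?case using T \<sigma>(2) by simp
  qed (simp_all add: comp_diff tens_of chain_map_diff sum_subtractf)
  moreover have "singular_simplex n B \<tau>" if tT: "\<tau> \<in> T" for \<tau>
  proof -
    obtain \<sigma> where "\<tau> = fst (\<sigma> vert0)" "singular_simplex j (Qsp n B b) \<sigma>"
      using tT x by (auto simp: T_def singular_chain_def)
    moreover then have "\<sigma> vert0 \<in> topspace (Qsp n B b)"
      using vert0_in[of j] by (auto simp: singular_simplex_def continuous_map_def)
    ultimately show ?thesis by (simp add: topspace_Q)
  qed
  ultimately show ?thesis using that T by blast
qed

lemma boundary_if_comp_boundary:
  assumes "singular_chain j (Qsp n B b) x" "\<And>\<tau>. singular_relboundary j (loop_space B b) {} (comp j \<tau> x)"
  shows "singular_relboundary j (Qsp n B b) {} x"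
proof -
  obtain T where T: "finite T" "\<And>\<tau>. \<tau> \<in> T \<Longrightarrow> singular_simplex n B \<tau>" "x = (\<Sum>\<tau>\<in>T. tens j (frag_of \<tau>) (comp j \<tau> x))"
    using Q_decomposition[OF assms(1)] by blast
  have "singular_relboundary j (Qsp n B b) {} (\<Sum>\<tau>\<in>T. tens j (frag_of \<tau>) (comp j \<tau> x))"
    by (rule singular_relboundary_sum[OF T(1)]) (intro boundary_tens T(2) assms(2))
  then show ?thesis using T(3) by simp
qed

section \<open>Homology with coefficients, up to torsion\<close>

text \<open>A cycle with coefficients in an arbitrary abelian group is a linear combination of ordinary
  cycles as soon as the coefficients involved are linearly independent; a linear relation between
  them is used to eliminate one coefficient, at the price of an integer factor.\<close>

lemma cycle_with_coefficients:
  fixes m :: "'s \<Rightarrow> ('m \<Rightarrow>\<^sub>0 int)" and c :: "'s \<Rightarrow> 'a chain"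
  assumes tors: "torsion_homology i B" and "finite T"
    and c: "\<And>s. s \<in> T \<Longrightarrow> singular_chain i B (c s)"
    and Z0: "0 \<in> Z" and Zadd: "\<And>x y. x \<in> Z \<Longrightarrow> y \<in> Z \<Longrightarrow> x + y \<in> Z" and Zcmul: "\<And>a x. x \<in> Z \<Longrightarrow> frag_cmul a x \<in> Z"
    and cyc: "\<And>\<rho>. (\<Sum>s\<in>T. frag_cmul (poly_mapping.lookup (chain_boundary i (c s)) \<rho>) (m s)) \<in> Z"
  shows "\<exists>N::int. \<exists>e. N > 0 \<and> (\<forall>s\<in>T. singular_chain (Suc i) B (e s)) \<and>
    (\<forall>\<rho>. (\<Sum>s\<in>T. frag_cmul (poly_mapping.lookup (frag_cmul N (c s) - chain_boundary (Suc i) (e s)) \<rho>) (m s)) \<in> Z)"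
  using \<open>finite T\<close> c cyc
proof (induction T arbitrary: c rule: finite_psubset_induct)
  case (psubset T)
  show ?case
  proof (cases "\<forall>k :: 's \<Rightarrow> int. (\<Sum>s\<in>T. frag_cmul (k s) (m s)) \<in> Z \<longrightarrow> (\<forall>s\<in>T. k s = 0)")
    case True
    have "\<exists>N::int. \<exists>e. N > 0 \<and> singular_chain (Suc i) B e \<and> chain_boundary (Suc i) e = frag_cmul N (c s)"
      if s: "s \<in> T" for s
    proof -
      have "poly_mapping.lookup (chain_boundary i (c s)) \<rho> = 0" for \<rho>
        using True[rule_format, OF psubset.prems(2)[of \<rho>] s] .
      then have "chain_boundary i (c s) = 0" by (intro poly_mapping_eqI) simp
      then show ?thesis
        using tors psubset.prems(1)[OF s] unfolding torsion_homology_def singular_cycle singular_boundary by blast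
    qed
    then obtain N e where Ne: "\<And>s. s \<in> T \<Longrightarrow> N s > (0::int)" "\<And>s. s \<in> T \<Longrightarrow> singular_chain (Suc i) B (e s)"
      "\<And>s. s \<in> T \<Longrightarrow> chain_boundary (Suc i) (e s) = frag_cmul (N s) (c s)"
      by metis
    \<comment> \<open>A common multiple of the individual factors, to which the fillings are
      rescaled.\<close>
    define P where "P = prod N T"
    have dv: "P = (P div N s) * N s" if "s \<in> T" for s
      using dvd_prodI[OF psubset.hyps that, of N] by (simp add: P_def)
    define e' where "e' s = frag_cmul (P div N s) (e s)" for s
    have "chain_boundary (Suc i) (e' s) = frag_cmul P (c s)" if "s \<in> T" for s
      using Ne(3)[OF that] dv[OF that] by (simp add: e'_def chain_boundary_cmul)
    then have "(\<Sum>s\<in>T. frag_cmul (poly_mapping.lookup (frag_cmul P (c s) - chain_boundary (Suc i) (e' s)) \<rho>) (m s)) = 0" for \<rho>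
      by (intro sum.neutral) simp
    moreover have "P > 0" unfolding P_def using Ne(1) by (simp add: prod_pos)
    ultimately show ?thesis
      using Ne(2) Z0 by (intro exI[of _ P] exI[of _ e']) (auto simp: e'_def intro: singular_chain_cmul)
  next
    case False
    then obtain k t where k: "(\<Sum>s\<in>T. frag_cmul (k s) (m s)) \<in> Z" and t: "t \<in> T" "k t \<noteq> 0" by blast
    \<comment> \<open>The sign is normalised so that the coefficient at \<open>t\<close>, which
      enters the final factor, is positive.\<close>
    define k' where "k' s = sgn (k t) * k s" for s
    have "(\<Sum>s\<in>T. frag_cmul (k' s) (m s)) = frag_cmul (sgn (k t)) (\<Sum>s\<in>T. frag_cmul (k s) (m s))"
      by (simp add: k'_def frag_cmul_sum o_def)
    then have k': "(\<Sum>s\<in>T. frag_cmul (k' s) (m s)) \<in> Z" and kt: "k' t > 0"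
      using Zcmul[OF k] t by (simp_all add: k'_def sgn_if)
    define U where "U = T - {t}"
    have U: "U \<subset> T" "T = insert t U" "t \<notin> U" "finite U" using t psubset.hyps by (auto simp: U_def)
    \<comment> \<open>Modulo \<open>Z\<close> the relation expresses \<open>k' t\<close> times
      \<open>m t\<close> by the other elements, and \<open>c'\<close> collects the coefficients that
      these receive.\<close>
    define c' where "c' s = frag_cmul (k' t) (c s) - frag_cmul (k' s) (c t)" for s
    have elim: "(\<Sum>s\<in>U. frag_cmul (k' t * f s - k' s * f t) (m s)) =
        frag_cmul (k' t) (\<Sum>s\<in>T. frag_cmul (f s) (m s)) + frag_cmul (- f t) (\<Sum>s\<in>T. frag_cmul (k' s) (m s))" for f :: "'s \<Rightarrow> int"
    proof -
      have "(\<Sum>s\<in>T. frag_cmul (k' t * f s - k' s * f t) (m s)) = (\<Sum>s\<in>U. frag_cmul (k' t * f s - k' s * f t) (m s))"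
        using U by simp
      moreover have "(\<Sum>s\<in>T. frag_cmul (k' t * f s - k' s * f t) (m s)) =
        frag_cmul (k' t) (\<Sum>s\<in>T. frag_cmul (f s) (m s)) + frag_cmul (- f t) (\<Sum>s\<in>T. frag_cmul (k' s) (m s))"
        by (simp add: frag_cmul_sum o_def sum.distrib[symmetric] mult.commute flip: frag_cmul_distrib)
      ultimately show ?thesis by simp
    qed
    have "(\<Sum>s\<in>U. frag_cmul (poly_mapping.lookup (chain_boundary i (c' s)) \<rho>) (m s)) \<in> Z" for \<rho>
    proof -
      have "poly_mapping.lookup (chain_boundary i (c' s)) \<rho> = k' t * poly_mapping.lookup (chain_boundary i (c s)) \<rho>
          - k' s * poly_mapping.lookup (chain_boundary i (c t)) \<rho>" for s
        by (simp add: c'_def chain_boundary_diff chain_boundary_cmul lookup_minus)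
      then show ?thesis
        using elim[of "\<lambda>s. poly_mapping.lookup (chain_boundary i (c s)) \<rho>"] psubset.prems(2)[of \<rho>] k' Zadd Zcmul by simp
    qed
    moreover have "singular_chain i B (c' s)" if "s \<in> U" for s
      unfolding c'_def using psubset.prems(1) t that U by (intro singular_chain_diff singular_chain_cmul) auto
    ultimately obtain N :: int and e where Ne: "N > 0" "\<forall>s\<in>U. singular_chain (Suc i) B (e s)"
      "\<And>\<rho>. (\<Sum>s\<in>U. frag_cmul (poly_mapping.lookup (frag_cmul N (c' s) - chain_boundary (Suc i) (e s)) \<rho>) (m s)) \<in> Z"
      using psubset.IH[OF U(1), of c'] by blast
    define e' where "e' s = (if s = t then 0 else e s)" for s
    have "(\<Sum>s\<in>T. frag_cmul (poly_mapping.lookup (frag_cmul (N * k' t) (c s) - chain_boundary (Suc i) (e' s)) \<rho>) (m s)) \<in> Z" for \<rho>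
    proof -
      let ?l = "\<lambda>s. poly_mapping.lookup (c s) \<rho>" and ?d = "\<lambda>s. poly_mapping.lookup (chain_boundary (Suc i) (e' s)) \<rho>"
      have e'U: "e' s = e s" if "s \<in> U" for s using that U by (auto simp: e'_def)
      have 1: "(\<Sum>s\<in>T. frag_cmul (?d s) (m s)) = (\<Sum>s\<in>U. frag_cmul (?d s) (m s))"
        using U by (simp add: e'_def)
      have "(\<Sum>s\<in>U. frag_cmul (N * (k' t * ?l s - k' s * ?l t) - ?d s) (m s)) \<in> Z"
        using Ne(3)[of \<rho>] e'U by (simp add: c'_def lookup_minus cong: sum.cong)
      moreover have "(\<Sum>s\<in>U. frag_cmul (N * X s - D s) (m s)) =
          frag_cmul N (\<Sum>s\<in>U. frag_cmul (X s) (m s)) - (\<Sum>s\<in>U. frag_cmul (D s) (m s))" for X D :: "'s \<Rightarrow> int"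
        by (simp add: frag_cmul_sum o_def frag_cmul_diff_distrib sum_subtractf)
      ultimately have 2: "frag_cmul N (frag_cmul (k' t) (\<Sum>s\<in>T. frag_cmul (?l s) (m s)) + frag_cmul (- ?l t) (\<Sum>s\<in>T. frag_cmul (k' s) (m s)))
          - (\<Sum>s\<in>T. frag_cmul (?d s) (m s)) \<in> Z" (is "?A \<in> Z")
        unfolding elim[of ?l, symmetric] 1 by simp
      have "(\<Sum>s\<in>T. frag_cmul (poly_mapping.lookup (frag_cmul (N * k' t) (c s) - chain_boundary (Suc i) (e' s)) \<rho>) (m s)) =
          frag_cmul (N * k' t) (\<Sum>s\<in>T. frag_cmul (?l s) (m s)) - (\<Sum>s\<in>T. frag_cmul (?d s) (m s))"
        by (simp add: frag_cmul_sum o_def lookup_minus frag_cmul_diff_distrib sum_subtractf mult.assoc)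
      also have "\<dots> = ?A + frag_cmul (N * ?l t) (\<Sum>s\<in>T. frag_cmul (k' s) (m s))"
        by (simp add: frag_cmul_distrib2 frag_cmul_diff flip: minus_frag_cmul)
      finally show ?thesis using Zadd[OF 2 Zcmul[OF k']] by simp
    qed
    moreover have "\<forall>s\<in>T. singular_chain (Suc i) B (e' s)" using Ne(2) U by (auto simp: e'_def)
    moreover have "N * k' t > 0" using Ne(1) kt by simp
    ultimately show ?thesis by blast
  qed
qed

text \<open>The base chains with coefficients in degree \<open>j\<close> of the loop space have
  torsion homology in degree i + 1 as soon as one of the two factors has. The cycles
  \<open>comp j \<tau> x\<close>, taken modulo boundaries, serve as the coefficients.\<close>

lemma Q_step:
  assumes x: "singular_relcycle j (Qsp (Suc i) B b) {} x"
    and dx: "singular_relboundary j (Qsp i B b) {} (dhQ i j x)"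
    and tors: "torsion_homology (Suc i) B \<or> torsion_homology j (loop_space B b)"
  obtains N :: int and u where "N > 0" "singular_relcycle j (Qsp (Suc (Suc i)) B b) {} u"
    "homologous_rel j (Qsp (Suc i) B b) {} (frag_cmul N x) (dhQ (Suc i) j u)"
proof -
  obtain T where T: "finite T" "\<And>\<tau>. \<tau> \<in> T \<Longrightarrow> singular_simplex (Suc i) B \<tau>"
      and xT: "x = (\<Sum>\<tau>\<in>T. tens j (frag_of \<tau>) (comp j \<tau> x))"
    using Q_decomposition[of j "Suc i" B b x] x unfolding singular_cycle by blast
  let ?m = "\<lambda>\<tau>. comp j \<tau> x"
  have m: "singular_relcycle j (loop_space B b) {} (?m \<tau>)" for \<tau> by (rule comp_cycle[OF x])
  then have mc: "singular_chain j (loop_space B b) (?m \<tau>)" for \<tau> by (simp add: singular_cycle)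
  show ?thesis
  proof (cases "torsion_homology (Suc i) B")
    case True
    have "(\<Sum>\<tau>\<in>T. frag_cmul (poly_mapping.lookup (chain_boundary (Suc i) (frag_of \<tau>)) \<rho>) (?m \<tau>)) = comp j \<rho> (dhQ i j x)" for \<rho>
    proof -
      have "dhQ i j x = (\<Sum>\<tau>\<in>T. tens j (chain_boundary (Suc i) (frag_of \<tau>)) (?m \<tau>))"
        by (subst xT) (simp add: dhQ_sum[OF T(1)] dhQ_tens[OF mc])
      then show ?thesis by (simp add: comp_sum[OF T(1)] comp_tens[OF mc])
    qed
    then have cyc: "(\<Sum>\<tau>\<in>T. frag_cmul (poly_mapping.lookup (chain_boundary (Suc i) (frag_of \<tau>)) \<rho>) (?m \<tau>))
        \<in> Collect (singular_relboundary j (loop_space B b) {})" for \<rho>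
      using comp_boundary[OF dx] by simp
    obtain N :: int and e where N: "N > 0" and e: "\<And>\<tau>. \<tau> \<in> T \<Longrightarrow> singular_chain (Suc (Suc i)) B (e \<tau>)"
      and Ne: "\<And>\<rho>. (\<Sum>\<tau>\<in>T. frag_cmul (poly_mapping.lookup (frag_cmul N (frag_of \<tau>) - chain_boundary (Suc (Suc i)) (e \<tau>)) \<rho>) (?m \<tau>))
         \<in> Collect (singular_relboundary j (loop_space B b) {})"
      using cycle_with_coefficients[OF True T(1), of frag_of "Collect (singular_relboundary j (loop_space B b) {})" ?m, OF _ _ _ _ cyc]
      by (auto simp: singular_chain_of T(2) singular_relboundary_add singular_relboundary_cmul)
    define u where "u = (\<Sum>\<tau>\<in>T. tens j (e \<tau>) (?m \<tau>))"
    have u: "singular_relcycle j (Qsp (Suc (Suc i)) B b) {} u"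
      unfolding u_def by (intro singular_relcycle_sum cycle_tens e m)
    define y where "y = frag_cmul N x - dhQ (Suc i) j u"
    have y: "y = (\<Sum>\<tau>\<in>T. tens j (frag_cmul N (frag_of \<tau>) - chain_boundary (Suc (Suc i)) (e \<tau>)) (?m \<tau>))"
      unfolding y_def u_def
      by (subst xT) (simp add: dhQ_sum[OF T(1)] dhQ_tens[OF mc] frag_cmul_sum o_def tens_diff tens_cmul sum_subtractf)
    have "singular_relboundary j (Qsp (Suc i) B b) {} y"
    proof (rule boundary_if_comp_boundary)
      show "singular_chain j (Qsp (Suc i) B b) y"
        using singular_relcycle_diff[OF singular_relcycle_cmul[OF x, of N] dhQ_cycle[OF u]] by (simp add: y_def singular_cycle)
      show "singular_relboundary j (loop_space B b) {} (comp j \<rho> y)" for \<rho>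
        using Ne[of \<rho>] unfolding y by (simp add: comp_sum[OF T(1)] comp_tens[OF mc])
    qed
    then show ?thesis using that[OF N u] by (simp add: homologous_rel_def y_def)
  next
    case False
    then have "\<exists>N::int. N > 0 \<and> singular_relboundary j (loop_space B b) {} (frag_cmul N (?m \<tau>))" for \<tau>
      using tors m by (auto simp: torsion_homology_def)
    then obtain N :: "_ \<Rightarrow> int" where N: "\<And>\<tau>. N \<tau> > 0" "\<And>\<tau>. singular_relboundary j (loop_space B b) {} (frag_cmul (N \<tau>) (?m \<tau>))"
      by metis
    \<comment> \<open>Torsion in the fibre: a common multiple of finitely many factors already makes
      \<open>x\<close> a boundary, and \<open>u\<close> can be taken to be 0.\<close>
    define P where "P = prod N T"
    have "frag_cmul P x = (\<Sum>\<tau>\<in>T. tens j (frag_of \<tau>) (frag_cmul (P div N \<tau>) (frag_cmul (N \<tau>) (?m \<tau>))))"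
    proof -
      have "(P div N \<tau>) * N \<tau> = P" if "\<tau> \<in> T" for \<tau>
        using dvd_prodI[OF T(1) that, of N] by (simp add: P_def)
      then show ?thesis
        by (subst xT) (simp add: frag_cmul_sum o_def tens_of cong: sum.cong)
    qed
    also have "singular_relboundary j (Qsp (Suc i) B b) {} \<dots>"
      by (intro singular_relboundary_sum T boundary_tens singular_relboundary_cmul N(2))
    finally have "singular_relboundary j (Qsp (Suc i) B b) {} (frag_cmul P x)" .
    moreover have "P > 0" unfolding P_def using N(1) by (simp add: prod_pos)
    ultimately show ?thesis using that[of P 0] by (simp add: homologous_rel_def)
  qed
qed

section \<open>The suspension theorem\<close>

context trivialisation begin

text \<open>Face 0 is compatible with \<open>RR\<close> only up to homotopy, whence an equality of
  classes and not of chains.\<close>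

lemma RR_dh:
  assumes x: "singular_relcycle j (G (Suc n)) {} x"
  shows "homologous_rel j (Q n) {} (chain_map j RR (dh n j x)) (dhQ n j (chain_map j RR x))"
proof -
  have "homologous_rel j (Q n) {} (chain_map j RR (chain_map j (gface n k) x)) (chain_map j (qface n k) (chain_map j RR x))"
    if k: "k \<le> Suc n" for k
  proof (cases k)
    case 0
    show ?thesis
      using homotopic_cycles[OF RR_gface_0 x] by (simp add: 0 chain_map_compose)
  next
    case (Suc l)
    have "chain_map j RR (chain_map j (gface n k) x) = chain_map j (qface n k) (chain_map j RR x)"
      by (rule chain_map_comp_eq) (use x k Suc in \<open>auto simp: singular_cycle intro: RR_gface_Suc\<close>)
    then show ?thesis by simp
  qed
  then show ?thesis
    unfolding dh_def dhQ_def
    by (simp add: chain_map_sum o_def del: sum.atMost_Suc)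
       (intro homologous_rel_finite_sum homologous_rel_cmul finite_atMost, simp)
qed

lemma PSI_RR_chain:
  "singular_relcycle j (G n) {} x \<Longrightarrow> homologous_rel j (G n) {} (chain_map j (PSI n) (chain_map j RR x)) x"
  using homotopic_cycles[OF PSI_RR, of j n x] chain_map_ident[of j "G n" x]
  by (simp add: chain_map_compose singular_cycle)

lemma RR_PSI_chain:
  "singular_relcycle j (Q n) {} x \<Longrightarrow> homologous_rel j (Q n) {} (chain_map j RR (chain_map j (PSI n) x)) x"
  using homotopic_cycles[OF RR_PSI, of j n x] chain_map_ident[of j "Q n" x]
  by (simp add: chain_map_compose singular_cycle)

lemma dhQ_homologous:
  "homologous_rel j (Q (Suc n)) {} x y \<Longrightarrow> homologous_rel j (Q n) {} (dhQ n j x) (dhQ n j y)"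
  using dhQ_boundary[of j n B b "x - y"] by (simp add: homologous_rel_def dhQ_diff)

text \<open>\<open>PSI\<close> is never compared with the faces directly: the statement for
  \<open>RR\<close> is transported by the inverse equivalences.\<close>

lemma dh_PSI:
  assumes x: "singular_relcycle j (Q (Suc n)) {} x"
  shows "homologous_rel j (G n) {} (dh n j (chain_map j (PSI (Suc n)) x)) (chain_map j (PSI n) (dhQ n j x))"
proof -
  let ?y = "chain_map j (PSI (Suc n)) x"
  have y: "singular_relcycle j (G (Suc n)) {} ?y" by (rule cycle_chain_map[OF x cm_PSI])
  have 1: "homologous_rel j (Q n) {} (chain_map j RR (dh n j ?y)) (dhQ n j x)"
    by (rule homologous_rel_trans[OF dhQ_homologous[OF RR_PSI_chain[OF x]] RR_dh[OF y]])
  have 2: "homologous_rel j (G n) {} (dh n j ?y) (chain_map j (PSI n) (chain_map j RR (dh n j ?y)))"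
    using PSI_RR_chain[OF dh_cycle[OF y]] homologous_rel_sym by blast
  show ?thesis
    by (rule homologous_rel_trans[OF homologous_rel_chain_map[OF 1 cm_PSI] 2])
qed

text \<open>The torsion statement for the model, carried back to the column. The bounding chain
  \<open>v\<close> is made explicit because the zigzags below continue with it.\<close>

lemma G_step:
  assumes x: "singular_relcycle j (G (Suc i)) {} x"
    and dx: "singular_relboundary j (G i) {} (dh i j x)"
    and tors: "torsion_homology (Suc i) B \<or> torsion_homology j F"
  obtains N :: int and u v where "N > 0" "singular_relcycle j (G (Suc (Suc i))) {} u"
    "singular_chain (Suc j) (G (Suc i)) v" "frag_cmul N x = dh (Suc i) j u + chain_boundary (Suc j) v"
proof -
  let ?x = "chain_map j RR x"
  have Rx: "singular_relcycle j (Q (Suc i)) {} ?x" by (rule cycle_chain_map[OF x cm_RR])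
  have "singular_relboundary j (Q i) {} (dhQ i j ?x)"
    by (rule homologous_rel_boundary[OF RR_dh[OF x] boundary_chain_map[OF dx cm_RR]])
  from Q_step[OF Rx this tors] obtain N :: int and u where N: "N > 0"
    and u: "singular_relcycle j (Q (Suc (Suc i))) {} u"
    and Nu: "homologous_rel j (Q (Suc i)) {} (frag_cmul N ?x) (dhQ (Suc i) j u)"
    by blast
  let ?u = "chain_map j (PSI (Suc (Suc i))) u"
  have 1: "homologous_rel j (G (Suc i)) {} (frag_cmul N x) (chain_map j (PSI (Suc i)) (frag_cmul N ?x))"
    using homologous_rel_cmul[OF PSI_RR_chain[OF x], of N] homologous_rel_sym by fastforce
  have 2: "homologous_rel j (G (Suc i)) {} (chain_map j (PSI (Suc i)) (frag_cmul N ?x)) (chain_map j (PSI (Suc i)) (dhQ (Suc i) j u))"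
    by (rule homologous_rel_chain_map[OF Nu cm_PSI])
  have 3: "homologous_rel j (G (Suc i)) {} (chain_map j (PSI (Suc i)) (dhQ (Suc i) j u)) (dh (Suc i) j ?u)"
    using dh_PSI[OF u] homologous_rel_sym by blast
  have "homologous_rel j (G (Suc i)) {} (frag_cmul N x) (dh (Suc i) j ?u)"
    by (rule homologous_rel_trans[OF 3 homologous_rel_trans[OF 2 1]])
  then obtain v where v: "singular_chain (Suc j) (G (Suc i)) v" "chain_boundary (Suc j) v = frag_cmul N x - dh (Suc i) j ?u"
    unfolding homologous_rel_def singular_boundary by blast
  show ?thesis
    by (rule that[OF N cycle_chain_map[OF u cm_PSI] v(1)]) (simp add: v(2))
qed

lemma frag_sign: "frag_cmul ((-1) ^ i) (frag_cmul ((-1) ^ i) c) = c"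
  by (simp flip: power_mult_distrib)

text \<open>The last nonzero column is a vertical cycle whose horizontal image bounds, so a multiple
  of it is removed by subtracting a total differential. What remains sits in columns 0 and 1, where
  the horizontal image becomes null-homologous after projection to the loop.\<close>

lemma descent:
  assumes n: "n \<ge> 1"
    and x: "\<And>i. i \<le> n \<Longrightarrow> singular_chain (n - i) (G i) (x i)"
    and D: "\<And>i. 1 \<le> i \<Longrightarrow> i < n \<Longrightarrow> dh i (n - Suc i) (x (Suc i)) + frag_cmul ((-1) ^ i) (chain_boundary (n - i) (x i)) = 0"
    and tors: "\<And>i. 2 \<le> i \<Longrightarrow> i \<le> n \<Longrightarrow> torsion_homology i B \<or> torsion_homology (n - i) F"
  shows "\<exists>N::int. N > 0 \<and> singular_relboundary (n - 1) F {}
    (frag_cmul N (chain_map (n - 1) rr (dh 0 (n - 1) (x 1) + chain_boundary n (x 0))))"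
proof -
  define tot where "tot y i = dh i (n - Suc i) (y (Suc i)) + frag_cmul ((-1) ^ i) (chain_boundary (n - i) (y i))"
    for y :: "nat \<Rightarrow> 'b path_simplex chain" and i
  have D: "tot x i = 0" if "1 \<le> i" "i < n" for i using D[OF that] by (simp add: tot_def)
  \<comment> \<open>After k rounds the top k columns are zero and the total differential is
    \<open>N\<close> times that of \<open>x\<close>, so the cycle equations persist.\<close>
  have "\<exists>(N::int) y. N > 0 \<and> (\<forall>i\<le>n. singular_chain (n - i) (G i) (y i)) \<and> (\<forall>i. n - k < i \<longrightarrow> i \<le> n \<longrightarrow> y i = 0) \<and>
      (\<forall>i<n. tot y i = frag_cmul N (tot x i))"
    if "k < n" for k
    using that
  proof (induction k)
    case 0
    show ?case using x by (intro exI[of _ 1] exI[of _ x]) auto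
  next
    case (Suc k)
    then obtain N :: int and y where N: "N > 0" and y: "\<And>i. i \<le> n \<Longrightarrow> singular_chain (n - i) (G i) (y i)"
      and y0: "\<And>i. n - k < i \<Longrightarrow> i \<le> n \<Longrightarrow> y i = 0"
      and yD: "\<And>i. i < n \<Longrightarrow> tot y i = frag_cmul N (tot x i)"
      by (metis Suc_lessD)
    obtain l where l: "n - k = Suc (Suc l)" using Suc.prems by (metis Suc_diff_Suc Suc_lessD)
    let ?m = "Suc (Suc l)" and ?j = "n - Suc (Suc l)"
    have ml: "?m \<le> n" "Suc l < n" "l < n" and jS: "n - Suc l = Suc ?j" "n - l = Suc (Suc ?j)" using l by auto
    have ym: "singular_chain ?j (G ?m) (y ?m)" using y[OF ml(1)] .
    have "chain_boundary ?j (y ?m) = 0"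
    proof (cases "?m = n")
      case True
      then show ?thesis by (simp add: chain_boundary_def)
    next
      case False
      then have mn: "?m < n" using ml by simp
      have "y (Suc ?m) = 0" using y0[of "Suc ?m"] l mn by simp
      then have "frag_cmul ((-1) ^ ?m) (chain_boundary ?j (y ?m)) = 0"
        using yD[OF mn] D[of ?m] mn by (simp add: tot_def)
      then show ?thesis by simp
    qed
    then have cyc: "singular_relcycle ?j (G ?m) {} (y ?m)" using ym by (simp add: singular_cycle)
    have "tot y (Suc l) = 0" using yD[OF ml(2)] D[of "Suc l"] ml by simp
    then have "dh (Suc l) ?j (y ?m) = - frag_cmul ((-1) ^ Suc l) (chain_boundary (Suc ?j) (y (Suc l)))"
      unfolding tot_def jS by (simp add: add_eq_0_iff2 eq_neg_iff_add_eq_0)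
    moreover have "singular_relboundary ?j (G (Suc l)) {} (chain_boundary (Suc ?j) (y (Suc l)))"
      unfolding singular_boundary using y[of "Suc l"] ml jS by auto
    ultimately have "singular_relboundary ?j (G (Suc l)) {} (dh (Suc l) ?j (y ?m))"
      by (simp only: singular_relboundary_minus singular_relboundary_cmul)
    moreover have "torsion_homology ?m B \<or> torsion_homology ?j F" using tors[of ?m] ml by simp
    ultimately obtain N' :: int and u v where N': "N' > 0" and u: "singular_relcycle ?j (G (Suc ?m)) {} u"
      and v: "singular_chain (Suc ?j) (G ?m) v" and uv: "frag_cmul N' (y ?m) = dh ?m ?j u + chain_boundary (Suc ?j) v"
      using G_step[OF cyc] by blast
    \<comment> \<open>This is \<open>N'\<close> times \<open>y\<close> minus the total differential
      of the element with \<open>u\<close> in column m + 1 and (-1)^m v in column m, where m = l +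
      2; hence the sign in column l + 1.\<close>
    define y' where "y' i = (if i = ?m then 0 else if i = Suc l then
       frag_cmul N' (y i) + frag_cmul ((-1) ^ Suc l) (dh (Suc l) (Suc ?j) v) else frag_cmul N' (y i))" for i
    have dv: "singular_chain (Suc ?j) (G (Suc l)) (dh (Suc l) (Suc ?j) v)" by (rule singular_chain_dh[OF v])
    have "singular_chain (n - i) (G i) (y' i)" if "i \<le> n" for i
      using y[OF that] dv jS by (auto simp: y'_def intro!: singular_chain_add singular_chain_cmul)
    moreover have "y' i = 0" if "n - Suc k < i" "i \<le> n" for i
      using y0[of i] that l by (auto simp: y'_def)
    moreover have "tot y' i = frag_cmul (N' * N) (tot x i)" if i: "i < n" for i
    proof -
      have "tot y' i = frag_cmul N' (tot y i)"
      proof -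
        consider "i < l" | "i = l" | "i = Suc l" | "i = ?m" | "i > ?m" by linarith
        then show ?thesis
        proof cases
          case 2
          have "dh l (Suc ?j) (dh (Suc l) (Suc ?j) v) = 0" by (rule dh_dh[OF v])
          then show ?thesis
            using 2 jS by (simp add: tot_def y'_def dh_add dh_cmul chain_boundary_cmul frag_cmul_distrib2)
              (simp add: mult.commute)
        next
          case 3
          have "dh (Suc l) ?j (dh ?m ?j u) = 0"
            using dh_dh[of ?j "Suc l" B b u] u by (simp add: singular_cycle)
          then have "frag_cmul N' (dh (Suc l) ?j (y ?m)) = dh (Suc l) ?j (chain_boundary (Suc ?j) v)"
            using arg_cong[OF uv, of "dh (Suc l) ?j"] by (simp add: dh_cmul dh_add)
          also have "\<dots> = chain_boundary (Suc ?j) (dh (Suc l) (Suc ?j) v)"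
            using chain_boundary_dh[OF v] by simp
          finally have "chain_boundary (Suc ?j) (dh (Suc l) (Suc ?j) v) = frag_cmul N' (dh (Suc l) ?j (y ?m))" ..
          then show ?thesis
            using 3 jS by (cases "even l")
              (simp_all add: tot_def y'_def chain_boundary_add chain_boundary_diff chain_boundary_cmul
                chain_boundary_minus frag_cmul_distrib2 frag_cmul_diff flip: minus_frag_cmul)
        next
          case 4
          then have "y (Suc i) = 0" using y0[of "Suc i"] l i by simp
          moreover have "tot y i = 0" using yD[OF i] D[of i] 4 i by simp
          ultimately show ?thesis using 4 by (simp add: tot_def y'_def)
        qed (simp_all add: tot_def y'_def dh_cmul chain_boundary_cmul frag_cmul_distrib2 mult.commute)
      qed
      then show ?thesis using yD[OF i] by simp
    qed
    moreover have "N' * N > 0" using N N' by simp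
    ultimately show ?case by blast
  qed
  from this[of "n - 1"] n obtain N :: int and y where N: "N > 0"
    and y: "\<And>i. i \<le> n \<Longrightarrow> singular_chain (n - i) (G i) (y i)"
    and y0: "\<And>i. 1 < i \<Longrightarrow> i \<le> n \<Longrightarrow> y i = 0" and yD: "\<And>i. i < n \<Longrightarrow> tot y i = frag_cmul N (tot x i)"
    by auto
  let ?j = "n - 1"
  have y1: "singular_chain ?j (G 1) (y 1)" using y[of 1] n by simp
  have "chain_boundary ?j (y 1) = 0"
  proof (cases "n = 1")
    case False
    then have "tot y 1 = 0" "y (Suc 1) = 0" using yD[of 1] D[of 1] y0[of 2] n by (auto simp: numeral_2_eq_2)
    then show ?thesis by (simp add: tot_def)
  qed (simp add: chain_boundary_def)
  then have cyc: "singular_relcycle ?j (G (Suc 0)) {} (y 1)" using y1 by (simp add: singular_cycle)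
  have snd_rr: "chain_map ?j rr c = chain_map ?j snd (chain_map ?j RR c)" for c
    by (simp add: RR_def o_def flip: chain_map_compose[THEN fun_cong, unfolded o_apply])
  \<comment> \<open>Both faces of a 1-simplex of the model carry the same loop, so the image of
    \<open>dhQ 0\<close> dies under \<open>snd\<close>. This is where trivial monodromy is
    used.\<close>
  have "chain_map ?j snd (chain_map ?j (qface 0 k) c) = chain_map ?j snd c" for k and c :: "(((nat \<Rightarrow> real) \<Rightarrow> 'b) \<times> (real \<Rightarrow> 'b)) chain"
    by (simp add: qface_def o_def flip: chain_map_compose[THEN fun_cong, unfolded o_apply])
  then have "chain_map ?j snd (dhQ 0 ?j (chain_map ?j RR (y 1))) = 0"
    by (simp add: dhQ_def chain_map_diff chain_map_add chain_map_minus)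
  then have "homologous_rel ?j F {} (chain_map ?j rr (dh 0 ?j (y 1))) 0"
    using homologous_rel_chain_map[OF RR_dh[OF cyc] cm_Q_snd] unfolding snd_rr by simp
  then have "singular_relboundary ?j F {} (chain_map ?j rr (dh 0 ?j (y 1)))"
    by (simp add: homologous_rel_def)
  moreover have "singular_relboundary ?j F {} (chain_map ?j rr (chain_boundary n (y 0)))"
  proof (rule boundary_chain_map[OF _ cm_rr])
    show "singular_relboundary ?j (G 0) {} (chain_boundary n (y 0))"
      unfolding singular_boundary using y[of 0] n by auto
  qed
  moreover have "frag_cmul N (chain_map ?j rr (dh 0 ?j (x 1) + chain_boundary n (x 0))) =
      chain_map ?j rr (dh 0 ?j (y 1)) + chain_map ?j rr (chain_boundary n (y 0))"
    using arg_cong[OF yD[of 0], of "chain_map ?j rr"] n by (simp add: tot_def chain_map_add)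
  ultimately show ?thesis using N singular_relboundary_add by metis
qed

text \<open>Up to homotopy \<open>fibre b\<close> is \<open>PSI 0\<close> after
  \<open>fibre_Q\<close>, and \<open>RR\<close>, the inverse of \<open>PSI 0\<close>, recovers the
  loop.\<close>

lemma rr_fibre:
  assumes z: "singular_relcycle j F {} z"
  shows "homologous_rel j F {} (chain_map j rr (chain_map j (fibre b) z)) z"
proof -
  have 1: "homologous_rel j (G 0) {} (chain_map j (fibre b) z) (chain_map j (PSI 0) (chain_map j fibre_Q z))"
    using homotopic_cycles[OF fibre_PSI z] homologous_rel_sym by (fastforce simp: chain_map_compose)
  have 2: "homologous_rel j (Q 0) {} (chain_map j RR (chain_map j (PSI 0) (chain_map j fibre_Q z))) (chain_map j fibre_Q z)"
    by (rule RR_PSI_chain[OF cycle_chain_map[OF z cm_fibre_Q]])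
  have snd_rr: "chain_map j rr c = chain_map j snd (chain_map j RR c)" for c
    by (simp add: RR_def o_def flip: chain_map_compose[THEN fun_cong, unfolded o_apply])
  have "chain_map j snd (chain_map j fibre_Q z) = chain_map j id z"
    by (simp add: fibre_Q_def o_def id_def flip: chain_map_compose[THEN fun_cong, unfolded o_apply])
  also have "\<dots> = z" using z by (simp add: singular_cycle chain_map_ident[of j F])
  finally have 3: "chain_map j snd (chain_map j fibre_Q z) = z" .
  have "homologous_rel j F {} (chain_map j rr (chain_map j (PSI 0) (chain_map j fibre_Q z))) z"
    using homologous_rel_chain_map[OF 2 cm_Q_snd] by (simp add: 3 snd_rr)
  from homologous_rel_trans[OF this homologous_rel_chain_map[OF 1 cm_rr]] show ?thesis .
qed

text \<open>A cycle of the loop space, placed in column 0, bounds in the total complex. The filling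
  \<open>x\<close> satisfies the cycle equations away from column 0, so \<open>descent\<close>
  pushes a multiple of it into columns 0 and 1, where it shows that a multiple of the cycle
  bounds.\<close>

theorem torsion_homology_loops:
  assumes q: "q \<ge> 1"
    and tors: "\<And>i. 2 \<le> i \<Longrightarrow> i \<le> Suc q \<Longrightarrow> torsion_homology i B \<or> torsion_homology (Suc q - i) F"
  shows "torsion_homology q F"
  unfolding torsion_homology_def
proof (intro allI impI)
  fix z assume z: "singular_relcycle q F {} z"
  define w where "w i = (if i = 0 then chain_map q (fibre b) z else 0)" for i :: nat
  have z': "singular_relcycle q (G 0) {} (chain_map q (fibre b) z)" by (rule cycle_chain_map[OF z cm_fibre[OF base]])
  have w: "singular_chain (q - i) (G i) (w i)" for i
    using z' by (simp add: w_def singular_cycle)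
  have wD: "dh i (q - Suc i) (w (Suc i)) + frag_cmul ((-1) ^ i) (chain_boundary (q - i) (w i)) = 0" for i
    using z' by (simp add: w_def singular_cycle)
  obtain x where x: "\<And>i. i \<le> Suc q \<Longrightarrow> singular_chain (Suc q - i) (G i) (x i)"
    and xw: "\<And>i. i \<le> q \<Longrightarrow> w i = dh i (q - i) (x (Suc i)) + frag_cmul ((-1) ^ i) (chain_boundary (Suc q - i) (x i))"
    using total_complex_exact[OF base q w wD] by metis
  have "\<exists>N::int. N > 0 \<and> singular_relboundary (Suc q - 1) F {}
    (frag_cmul N (chain_map (Suc q - 1) rr (dh 0 (Suc q - 1) (x 1) + chain_boundary (Suc q) (x 0))))"
  proof (rule descent[OF _ x _ tors])
    show "dh i (Suc q - Suc i) (x (Suc i)) + frag_cmul ((-1) ^ i) (chain_boundary (Suc q - i) (x i)) = 0"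
      if "1 \<le> i" "i < Suc q" for i
      using xw[of i] that by (simp add: w_def)
  qed auto
  then obtain N :: int where N: "N > 0" "singular_relboundary q F {} (frag_cmul N (chain_map q rr (chain_map q (fibre b) z)))"
    using xw[of 0] by (auto simp: w_def)
  have "homologous_rel q F {} (frag_cmul N (chain_map q rr (chain_map q (fibre b) z))) (frag_cmul N z)"
    by (rule homologous_rel_cmul[OF rr_fibre[OF z]])
  from homologous_rel_boundary[OF this N(2)] N(1)
  show "\<exists>N::int. N > 0 \<and> singular_relboundary q F {} (frag_cmul N z)" by blast
qed

text \<open>All differentials that start at the class of \<open>c\<close> in column n and end in a
  column from 1 to n - 2 vanish up to factors. The zigzag is extended one column at a time, and only
  its last differential, into column 0, is left unrestricted.\<close>

lemma ascent:
  assumes n: "n \<ge> 2" and c: "singular_relcycle n B {} c"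
    and tors: "\<And>i. 1 \<le> i \<Longrightarrow> i \<le> n - 2 \<Longrightarrow> torsion_homology i B \<or> torsion_homology (n - 1 - i) F"
  obtains N :: int and w where "N > 0" "\<And>i. i \<le> n \<Longrightarrow> singular_chain (n - i) (G i) (w i)"
    "w 0 = 0" "pr (w n) = frag_cmul N c"
    "\<And>i. 1 \<le> i \<Longrightarrow> i < n \<Longrightarrow> dh i (n - Suc i) (w (Suc i)) + frag_cmul ((-1) ^ i) (chain_boundary (n - i) (w i)) = 0"
proof -
  define tot where "tot y i = dh i (n - Suc i) (y (Suc i)) + frag_cmul ((-1) ^ i) (chain_boundary (n - i) (y i))"
    for y :: "nat \<Rightarrow> 'b path_simplex chain" and i
  note bB = base
  have "\<exists>(N::int) w. N > 0 \<and> (\<forall>i\<le>n. singular_chain (n - i) (G i) (w i)) \<and> (\<forall>i. i < n - k \<longrightarrow> w i = 0) \<and>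
      pr (w n) = frag_cmul N c \<and> (\<forall>i. n - k \<le> i \<longrightarrow> i < n \<longrightarrow> tot w i = 0)"
    if "1 \<le> k" "k < n" for k
    using that
  proof (induction k rule: dec_induct)
    case base
    \<comment> \<open>The zigzag starts with the constant loop attached to each simplex of
      \<open>c\<close>.\<close>
    define e where "e = frag_of (restrict (\<lambda>_. const_loop b) (standard_simplex 0))"
    have "const_loop b \<in> topspace F"
      using bB by (auto simp: topspace_loop_space loops_def pathin_def const_loop_def
          intro: continuous_map_eq[OF cm_const[OF bB]])
    then have e: "singular_relcycle 0 F {} e"
      using singular_simplex_const[of "const_loop b" F 0] by (simp add: e_def singular_cycle singular_chain_of chain_boundary_def)
    then have ec: "singular_chain 0 F e" by (simp add: singular_cycle)
    obtain l where l: "n = Suc l" using n by (cases n) auto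
    have cn: "singular_chain n B c" "chain_boundary n c = 0" using c by (simp_all add: singular_cycle)
    let ?t = "tens 0 c e"
    let ?w = "chain_map 0 (PSI n) ?t"
    have t: "singular_relcycle 0 (Q n) {} ?t" by (rule cycle_tens[OF cn(1) e])
    have w: "singular_relcycle 0 (G n) {} ?w" by (rule cycle_chain_map[OF t cm_PSI])
    have "pr ?w = c"
      using subset_UNIV
    proof (induction c rule: frag_induction)
      case (one \<tau>)
      show ?case
        using vert0_in[of 0] by (simp add: tens_of e_def pr_of simplex_map_def PSI_def)
    qed (simp_all add: tens_diff chain_map_diff pr_diff)
    moreover have "homologous_rel 0 (G l) {} (dh l 0 ?w) (chain_map 0 (PSI l) (dhQ l 0 ?t))"
      using dh_PSI[of 0 l ?t] t l by simp
    then have "singular_relboundary 0 (G l) {} (dh l 0 ?w)"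
      using cn(2) by (simp add: dhQ_tens[OF ec] l homologous_rel_def)
    then obtain v where v: "singular_chain 1 (G l) v" "chain_boundary 1 v = dh l 0 ?w"
      by (auto simp: singular_boundary)
    let ?w' = "\<lambda>i. if i = n then ?w else if i = l then frag_cmul (- ((-1) ^ l)) v else 0"
    have "singular_chain (n - i) (G i) (?w' i)" if "i \<le> n" for i
      using w v that l by (auto simp: singular_cycle intro: singular_chain_cmul)
    moreover have "tot ?w' l = 0"
      using l v(2) by (cases "even l") (simp_all add: tot_def chain_boundary_cmul chain_boundary_minus)
    ultimately show ?case
      using l by (intro exI[of _ 1] exI[of _ ?w']) (auto simp: less_Suc_eq le_less)
  next
    case (step k)
    then obtain N :: int and w where N: "N > 0" and w: "\<And>i. i \<le> n \<Longrightarrow> singular_chain (n - i) (G i) (w i)"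
      and w0: "\<And>i. i < n - k \<Longrightarrow> w i = 0" and wpr: "pr (w n) = frag_cmul N c"
      and wD: "\<And>i. n - k \<le> i \<Longrightarrow> i < n \<Longrightarrow> tot w i = 0"
      by (metis Suc_lessD)
    obtain l where l: "n - k = Suc (Suc l)" using step.prems by (metis Suc_diff_Suc Suc_lessD)
    let ?m = "Suc (Suc l)" and ?j = "n - Suc (Suc l)"
    have mn: "?m < n" and jS: "n - Suc l = Suc ?j" "?j = Suc (n - Suc ?m)" using l step by auto
    have wm: "singular_chain ?j (G ?m) (w ?m)" using w[of ?m] mn by simp
    define x where "x = dh (Suc l) ?j (w ?m)"
    have "tot w ?m = 0" using wD[of ?m] l mn by simp
    then have "frag_cmul ((-1) ^ ?m) (chain_boundary ?j (w ?m)) = - dh ?m (n - Suc ?m) (w (Suc ?m))"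
      unfolding tot_def by (simp add: add_eq_0_iff)
    from arg_cong[OF this, of "frag_cmul ((-1) ^ ?m)"]
    have "chain_boundary ?j (w ?m) = frag_cmul ((-1) ^ ?m) (- dh ?m (n - Suc ?m) (w (Suc ?m)))"
      unfolding frag_sign .
    then have "chain_boundary ?j x = frag_cmul ((-1) ^ ?m) (- dh (Suc l) (n - Suc ?m) (dh ?m (n - Suc ?m) (w (Suc ?m))))"
      unfolding x_def chain_boundary_dh[OF wm] using jS by (simp add: dh_cmul dh_minus)
    moreover have "dh (Suc l) (n - Suc ?m) (dh ?m (n - Suc ?m) (w (Suc ?m))) = 0"
      by (rule dh_dh[OF w]) (use mn in simp)
    ultimately have x: "singular_relcycle ?j (G (Suc l)) {} x"
      using singular_chain_dh[OF wm] by (simp add: singular_cycle x_def)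
    have "singular_relboundary ?j (G l) {} (dh l ?j x)"
      using dh_dh[OF wm] by (simp add: x_def)
    moreover have "torsion_homology (Suc l) B \<or> torsion_homology ?j F"
      using tors[of "Suc l"] mn by (simp add: diff_diff_eq)
    ultimately obtain N' :: int and u v where N': "N' > 0" and u: "singular_relcycle ?j (G ?m) {} u"
      and v: "singular_chain (Suc ?j) (G (Suc l)) v" and uv: "frag_cmul N' x = dh (Suc l) ?j u + chain_boundary (Suc ?j) v"
      using G_step[OF x] by blast
    \<comment> \<open>Subtracting the vertical cycle \<open>u\<close> leaves the equation in column
      m = l + 2 intact and makes the horizontal image of that column the boundary of
      \<open>v\<close>, which therefore continues the zigzag up to sign.\<close>
    define w' where "w' i = (if i = ?m then frag_cmul N' (w i) - u else if i = Suc l then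
       frag_cmul (- ((-1) ^ Suc l)) v else frag_cmul N' (w i))" for i
    have "singular_chain (n - i) (G i) (w' i)" if "i \<le> n" for i
      using w[OF that] v u jS by (auto simp: w'_def singular_cycle intro!: singular_chain_diff singular_chain_cmul)
    moreover have "w' i = 0" if "i < n - Suc k" for i
      using w0[of i] that l by (auto simp: w'_def)
    moreover have "pr (w' n) = frag_cmul (N' * N) c"
      using mn wpr by (auto simp: w'_def pr_cmul)
    moreover have "tot w' i = 0" if i: "n - Suc k \<le> i" "i < n" for i
    proof -
      consider "i = Suc l" | "i = ?m" | "i > ?m" using i l by linarith
      then show ?thesis
      proof cases
        case 1
        have "dh (Suc l) ?j (w' ?m) = chain_boundary (Suc ?j) v"
          using uv by (simp add: w'_def dh_diff dh_cmul x_def)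
        then show ?thesis
          using 1 jS by (cases "even l") (simp_all add: tot_def w'_def chain_boundary_cmul chain_boundary_minus)
      next
        case 2
        have "frag_cmul N' (tot w ?m) = tot w' ?m"
          using u jS by (simp add: tot_def w'_def dh_cmul chain_boundary_diff chain_boundary_cmul frag_cmul_distrib2 singular_cycle mult.commute)
        then show ?thesis using wD[of ?m] 2 l mn by simp
      next
        case 3
        have "frag_cmul N' (tot w i) = tot w' i"
          using 3 by (simp add: tot_def w'_def dh_cmul chain_boundary_cmul frag_cmul_distrib2 mult.commute)
        then show ?thesis using wD[of i] 3 l i by simp
      qed
    qed
    moreover have "N' * N > 0" using N N' by simp
    ultimately show ?case by blast
  qed
  from this[of "n - 1"] n have "\<exists>(N::int) w. N > 0 \<and> (\<forall>i\<le>n. singular_chain (n - i) (G i) (w i)) \<and> w 0 = 0 \<and>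
      pr (w n) = frag_cmul N c \<and> (\<forall>i. 1 \<le> i \<longrightarrow> i < n \<longrightarrow> tot w i = 0)"
    by simp
  then show ?thesis using that unfolding tot_def by blast
qed

end

text \<open>If looping \<open>v\<close> has a right homotopy inverse, the homology suspension of \<open>A\<close> in degree \<open>n\<close>
  factors through the homology of \<open>Y\<close>; on the other hand it is rationally onto.\<close>

theorem torsion_homology_right_inverse:
  assumes v: "continuous_map Y A v" and y0: "y0 \<in> topspace Y"
    and triv: "trivialisation A (v y0) lam"
    and s: "continuous_map (loop_space A (v y0)) (loop_space Y y0) s"
    and vs: "homotopic_with (\<lambda>_. True) (loop_space A (v y0)) (loop_space A (v y0)) (loop_map v \<circ> s) id"
    and l: "l \<ge> 1"
    and tors: "\<And>i. 1 \<le> i \<Longrightarrow> i < l \<Longrightarrow> torsion_homology i A \<or> torsion_homology (l - i) (loop_space A (v y0))"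
    and torsY: "torsion_homology (Suc l) Y"
  shows "torsion_homology (Suc l) A"
  unfolding torsion_homology_def
proof (intro allI impI)
  fix c assume c: "singular_relcycle (Suc l) A {} c"
  interpret trivialisation A "v y0" lam by (rule triv)
  let ?n = "Suc l" and ?f = "fibre (v y0)"
  have tors': "torsion_homology i A \<or> torsion_homology (?n - 1 - i) F" if "1 \<le> i" "i \<le> ?n - 2" for i
    using tors[of i] that l by auto
  have n2: "?n \<ge> 2" using l by simp
  obtain N :: int and w where N: "N > 0" and w: "\<And>i. i \<le> ?n \<Longrightarrow> singular_chain (?n - i) (G i) (w i)"
    and w0: "w 0 = 0" and wn: "pr (w ?n) = frag_cmul N c"
    and wD: "\<And>i. 1 \<le> i \<Longrightarrow> i < ?n \<Longrightarrow> dh i (?n - Suc i) (w (Suc i)) + frag_cmul ((-1) ^ i) (chain_boundary (?n - i) (w i)) = 0"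
    using ascent[OF n2 c tors'] by blast
  \<comment> \<open>The transgression of \<open>c\<close>, the end of the zigzag in column
    0.\<close>
  define z where "z = dh 0 l (w 1)"
  have w1: "singular_chain l (G (Suc 0)) (w 1)" using w[of 1] by simp
  have w2: "singular_chain (l - 1) (G (Suc (Suc 0))) (w 2)" using w[of 2] l by (simp add: numeral_2_eq_2)
  have "chain_boundary l (w 1) = dh 1 (l - 1) (w 2)"
    using wD[of 1] l by (simp add: numeral_2_eq_2)
  then have "chain_boundary l z = 0"
    unfolding z_def using chain_boundary_dh[OF w1] dh_dh[OF w2] by simp
  then have z: "singular_relcycle l (G 0) {} z"
    using singular_chain_dh[OF w1] by (simp add: singular_cycle z_def)
  let ?R = "chain_map l RR z"
  have R: "singular_relcycle l (Q 0) {} ?R" by (rule cycle_chain_map[OF z cm_RR])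
  \<comment> \<open>\<open>Lam\<close> moves \<open>z\<close> into the fibre over \<open>b\<close>:
    modulo a boundary and the horizontal image of \<open>u\<close> below, \<open>z\<close> comes
    from the class \<open>m\<close> of the loop space.\<close>
  let ?L = "chain_map l Lam ?R"
  have L: "singular_relcycle l (Q (Suc 0)) {} ?L" using cycle_chain_map[OF R cm_Lam] by simp
  define u where "u = chain_map l (PSI (Suc 0)) ?L"
  have u: "singular_relcycle l (G (Suc 0)) {} u" unfolding u_def by (rule cycle_chain_map[OF L cm_PSI])
  define m where "m = chain_map l rr z"
  have m: "singular_relcycle l F {} m" unfolding m_def by (rule cycle_chain_map[OF z cm_rr])
  have mR: "m = chain_map l snd ?R"
    by (simp add: m_def RR_def o_def flip: chain_map_compose[THEN fun_cong, unfolded o_apply])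
  have Rc: "singular_chain l (Q 0) ?R" using R by (simp add: singular_cycle)
  have "chain_map l (qface 0 0) ?L = ?R"
    using chain_map_comp_eq[OF Rc, of "qface 0 0" Lam id id] qface_Lam(1) chain_map_ident[OF Rc] by simp
  moreover have "chain_map l (qface 0 1) ?L = chain_map l fibre_Q m"
    unfolding mR using chain_map_comp_eq[OF Rc, of "qface 0 1" Lam fibre_Q snd] qface_Lam(2) by simp
  ultimately have "dhQ 0 l ?L = ?R - chain_map l fibre_Q m"
    by (simp add: dhQ_def)
  then have 1: "homologous_rel l (G 0) {} (dh 0 l u) (chain_map l (PSI 0) ?R - chain_map l (PSI 0) (chain_map l fibre_Q m))"
    using dh_PSI[OF L] by (simp add: u_def chain_map_diff)
  have 2: "homologous_rel l (G 0) {} (chain_map l (PSI 0) (chain_map l fibre_Q m)) (chain_map l ?f m)"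
    using homotopic_cycles[OF fibre_PSI m] by (simp add: chain_map_compose)
  have "homologous_rel l (G 0) {} (dh 0 l u) (z - chain_map l ?f m)"
    by (rule homologous_rel_trans[OF homologous_rel_diff[OF PSI_RR_chain[OF z] 2] 1])
  then have "homologous_rel l (G 0) {} (z - chain_map l ?f m) (dh 0 l u)" using homologous_rel_sym by blast
  then obtain v1 where v1: "singular_chain ?n (G 0) v1" "chain_boundary ?n v1 = z - chain_map l ?f m - dh 0 l u"
    by (auto simp: homologous_rel_def singular_boundary)
  \<comment> \<open>Here the right inverse enters: \<open>m\<close> is homologous to the image of a
    cycle of the loop space of \<open>Y\<close>.\<close>
  let ?s = "chain_map l s m"
  have sm: "singular_relcycle l (loop_space Y y0) {} ?s" by (rule cycle_chain_map[OF m s])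
  have "homologous_rel l F {} (chain_map l (loop_map v) ?s) m"
    using homotopic_cycles[OF vs m] chain_map_ident[of l F m] m by (simp add: chain_map_compose singular_cycle)
  from homologous_rel_chain_map[OF this cm_fibre[OF base]]
  have "homologous_rel l (G 0) {} (chain_map l ?f m) (chain_map l ?f (chain_map l (loop_map v) ?s))"
    using homologous_rel_sym by blast
  moreover define t where "t = chain_map l (fibre y0) ?s"
  have "chain_map l ?f (chain_map l (loop_map v) ?s) = chain_map l (gmap 0 v) t"
    unfolding t_def by (rule chain_map_comp_eq[of l "loop_space Y y0"]) (use sm in \<open>simp_all add: singular_cycle gmap_fibre\<close>)
  ultimately obtain v2 where v2: "singular_chain ?n (G 0) v2" "chain_boundary ?n v2 = chain_map l ?f m - chain_map l (gmap 0 v) t"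
    by (auto simp: homologous_rel_def singular_boundary)
  have t: "singular_relcycle l (Gam 0 Y y0) {} t"
    unfolding t_def by (rule cycle_chain_map[OF sm cm_fibre[OF y0]])
  \<comment> \<open>In the total complex of \<open>Y\<close> this cycle bounds; the filling is then
    pushed forward to \<open>A\<close>, and its top column gives the cycle of \<open>Y\<close> that
    is sought.\<close>
  let ?T = "\<lambda>i. if i = 0 then t else 0"
  have T: "singular_chain (l - i) (Gam i Y y0) (?T i)" for i using t by (simp add: singular_cycle)
  have TD: "dh i (l - Suc i) (?T (Suc i)) + frag_cmul ((-1) ^ i) (chain_boundary (l - i) (?T i)) = 0" for i
    using t by (simp add: singular_cycle)
  obtain x where x: "\<And>i. i \<le> ?n \<Longrightarrow> singular_chain (?n - i) (Gam i Y y0) (x i)"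
    and xT: "\<And>i. i \<le> l \<Longrightarrow> ?T i = dh i (l - i) (x (Suc i)) + frag_cmul ((-1) ^ i) (chain_boundary (?n - i) (x i))"
    using total_complex_exact[OF y0 l T TD] by blast
  define y where "y i = chain_map (?n - i) (gmap i v) (x i)" for i
  have y: "singular_chain (?n - i) (G i) (y i)" if "i \<le> ?n" for i
    unfolding y_def by (rule singular_chain_chain_map[OF x[OF that] cm_gmap[OF v]])
  have yD: "dh i (l - i) (y (Suc i)) + frag_cmul ((-1) ^ i) (chain_boundary (?n - i) (y i)) = chain_map (l - i) (gmap i v) (?T i)"
    if i: "i \<le> l" for i
  proof -
    have "dh i (l - i) (y (Suc i)) = chain_map (l - i) (gmap i v) (dh i (l - i) (x (Suc i)))"
      using dh_gmap[of "l - i" i Y y0 "x (Suc i)" v] x[of "Suc i"] i by (simp add: y_def)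
    moreover have "chain_boundary (?n - i) (y i) = chain_map (l - i) (gmap i v) (chain_boundary (?n - i) (x i))"
      unfolding y_def using chain_boundary_chain_map[OF x[of i], of "gmap i v"] i by simp
    ultimately show ?thesis
      unfolding xT[OF i] by (simp add: chain_map_add)
  qed
  \<comment> \<open>The corrections turn the zigzag of \<open>c\<close> into a genuine total cycle,
    because the contributions of \<open>w\<close>, \<open>y\<close>, \<open>u\<close>,
    \<open>v1\<close> and \<open>v2\<close> to column 0 cancel.\<close>
  define W where "W i = w i - y i - (if i = 1 then u else 0) - (if i = 0 then v1 + v2 else 0)" for i
  have W: "singular_chain (?n - i) (G i) (W i)" if "i \<le> ?n" for i
    unfolding W_def
    by (intro singular_chain_diff w[OF that] y[OF that])
       (use u v1 v2 in \<open>auto simp: singular_cycle intro: singular_chain_add\<close>)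
  have WD: "dh i (?n - Suc i) (W (Suc i)) + frag_cmul ((-1) ^ i) (chain_boundary (?n - i) (W i)) = 0" if i: "i < ?n" for i
  proof -
    consider "i = 0" | "i = 1" | "i > 1" by linarith
    then show ?thesis
    proof cases
      case 1
      have "dh 0 l (y (Suc 0)) + chain_boundary ?n (y 0) = chain_map l (gmap 0 v) t"
        using yD[of 0] by simp
      then show ?thesis
        using 1 v1(2) v2(2) w0 z_def by (simp add: W_def dh_diff dh_add chain_boundary_diff chain_boundary_add chain_boundary_minus algebra_simps)
    next
      case 2
      have "chain_boundary l u = 0" using u by (simp add: singular_cycle)
      moreover have "dh 1 (l - 1) (y 2) - chain_boundary l (y 1) = 0"
        using yD[of 1] l by (simp add: numeral_2_eq_2)
      ultimately show ?thesis
        using wD[of 1] 2 l by (simp add: W_def dh_diff chain_boundary_diff chain_boundary_add numeral_2_eq_2 algebra_simps)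
    next
      case 3
      have "dh i (l - i) (y (Suc i)) + frag_cmul ((-1) ^ i) (chain_boundary (?n - i) (y i)) = 0"
        using yD[of i] 3 i by simp
      moreover have "dh i (l - i) (w (Suc i)) + frag_cmul ((-1) ^ i) (chain_boundary (?n - i) (w i)) = 0"
        using wD[of i] 3 i by simp
      moreover have "dh i (l - i) (W (Suc i)) + frag_cmul ((-1) ^ i) (chain_boundary (?n - i) (W i)) =
          (dh i (l - i) (w (Suc i)) + frag_cmul ((-1) ^ i) (chain_boundary (?n - i) (w i))) -
          (dh i (l - i) (y (Suc i)) + frag_cmul ((-1) ^ i) (chain_boundary (?n - i) (y i)))"
        using 3 by (simp add: W_def dh_diff chain_boundary_diff frag_cmul_diff algebra_simps)
      ultimately show ?thesis by simp
    qed
  qed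
  obtain X where X: "\<And>i. i \<le> Suc ?n \<Longrightarrow> singular_chain (Suc ?n - i) (G i) (X i)"
    and XW: "\<And>i. i \<le> ?n \<Longrightarrow> W i = dh i (?n - i) (X (Suc i)) + frag_cmul ((-1) ^ i) (chain_boundary (Suc ?n - i) (X i))"
    \<comment> \<open>Exactness of the total complex of \<open>A\<close>: in the top column,
      \<open>pr\<close> turns \<open>W\<close> into a boundary, so \<open>N\<close> times
      \<open>c\<close> is homologous to the image of a cycle of \<open>Y\<close>.\<close>
    using total_complex_exact[OF base _ W WD] by auto
  have Xn: "singular_chain 0 (G (Suc ?n)) (X (Suc ?n))" "singular_chain (Suc 0) (G ?n) (X ?n)"
    using X[of "Suc ?n"] X[of ?n] by (simp_all add: Suc_diff_le)
  have "pr (W ?n) = chain_boundary (Suc ?n) (pr (X (Suc ?n)))"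
    using XW[of ?n] pr_chain_boundary[OF Xn(2)] by (simp add: pr_add pr_cmul pr_dh Suc_diff_le)
  moreover have "pr (W ?n) = frag_cmul N c - chain_map ?n v (pr (x ?n))"
    using l wn pr_gmap[of ?n v "x ?n"] by (simp add: W_def pr_diff y_def)
  ultimately have 3: "frag_cmul N c = chain_map ?n v (pr (x ?n)) + chain_boundary (Suc ?n) (pr (X (Suc ?n)))"
    by (simp add: algebra_simps)
  have xn: "singular_chain 0 (Gam ?n Y y0) (x ?n)" "singular_chain (Suc 0) (Gam l Y y0) (x l)"
    using x[of ?n] x[of l] by (simp_all add: Suc_diff_le)
  have "0 = dh l 0 (x ?n) + frag_cmul ((-1) ^ l) (chain_boundary (Suc 0) (x l))"
    using xT[of l] l by (simp add: Suc_diff_le)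
  from arg_cong[OF this, of pr] have "chain_boundary ?n (pr (x ?n)) = 0"
    using pr_chain_boundary[OF xn(2)] by (simp add: pr_add pr_cmul pr_dh)
  then have "singular_relcycle ?n Y {} (pr (x ?n))"
    using singular_chain_pr[OF xn(1)] by (simp add: singular_cycle)
  then obtain M :: int where M: "M > 0" "singular_relboundary ?n Y {} (frag_cmul M (pr (x ?n)))"
    using torsY unfolding torsion_homology_def by blast
  have "frag_cmul (M * N) c = chain_map ?n v (frag_cmul M (pr (x ?n))) + frag_cmul M (chain_boundary (Suc ?n) (pr (X (Suc ?n))))"
    using arg_cong[OF 3, of "frag_cmul M"] by (simp add: frag_cmul_distrib2)
  moreover have "singular_relboundary ?n A {} (chain_map ?n v (frag_cmul M (pr (x ?n))))"
    by (rule boundary_chain_map[OF M(2) v])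
  moreover have "singular_relboundary ?n A {} (chain_boundary (Suc ?n) (pr (X (Suc ?n))))"
    using singular_chain_pr[OF Xn(1)] singular_boundary by blast
  ultimately have "singular_relboundary ?n A {} (frag_cmul (M * N) c)"
    by (simp add: singular_relboundary_add singular_relboundary_cmul)
  moreover have "M * N > 0" using M N by simp
  ultimately show "\<exists>N::int. N > 0 \<and> singular_relboundary ?n A {} (frag_cmul N c)" by blast
qed

section \<open>Vertices of CW complexes are nondegenerate\<close>

definition dnorm :: "nat \<Rightarrow> (nat \<Rightarrow> real) \<Rightarrow> real" where
  "dnorm n z = sqrt (\<Sum>i<n. (z i)\<^sup>2)"

lemma topspace_disc: "topspace (disc n) = {z. (\<forall>i\<ge>n. z i = 0) \<and> (\<Sum>i<n. (z i)\<^sup>2) \<le> 1}"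
  by (auto simp: disc_def topspace_Euclidean_space)

lemma disc_interior_eq: "disc_interior n = {z \<in> topspace (disc n). dnorm n z < 1}"
  by (auto simp: disc_interior_def topspace_disc topspace_Euclidean_space dnorm_def)

lemma disc_boundary_eq: "disc_boundary n = {z \<in> topspace (disc n). dnorm n z = 1}"
  by (auto simp: disc_boundary_def topspace_disc topspace_Euclidean_space dnorm_def)

lemma topspace_disc_dnorm: "topspace (disc n) = {z. (\<forall>i\<ge>n. z i = 0) \<and> dnorm n z \<le> 1}"
  by (auto simp: topspace_disc dnorm_def)

lemma dnorm_scale: "dnorm n (\<lambda>i. z i / c) = dnorm n z / \<bar>c\<bar>"
  by (simp add: dnorm_def power_divide real_sqrt_divide flip: sum_divide_distrib)

lemma cm_disc: "continuous_map W (disc n) f \<longleftrightarrow>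
    (\<forall>i. continuous_map W euclideanreal (\<lambda>w. f w i)) \<and> (\<forall>w \<in> topspace W. f w \<in> topspace (disc n))"
  by (auto simp: disc_def Euclidean_space_def continuous_map_in_subtopology continuous_map_componentwise_UNIV
      topspace_Euclidean_space)

lemma cm_disc_coord: "continuous_map W (disc n) f \<Longrightarrow> continuous_map W euclideanreal (\<lambda>w. f w i)"
  by (simp add: cm_disc)

lemma cm_dnorm:
  assumes "continuous_map W (disc n) f"
  shows "continuous_map W euclideanreal (\<lambda>w. dnorm n (f w))"
  unfolding dnorm_def
proof (rule cm_comp[of euclideanreal euclideanreal sqrt])
  show "continuous_map euclideanreal euclideanreal sqrt"
    using continuous_on_real_sqrt[OF continuous_on_id] by simp
  show "continuous_map W euclideanreal (\<lambda>w. \<Sum>i<n. (f w i)\<^sup>2)"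
    by (intro continuous_intros cm_disc_coord[OF assms]) auto
qed

lemma compact_disc: "compact_space (disc n)"
proof -
  have "compactin (powertop_real UNIV) (PiE UNIV (\<lambda>i. {-1..1::real}))"
    by (simp add: compactin_PiE)
  moreover have "closedin (powertop_real UNIV) (topspace (disc n))"
  proof -
    have c: "continuous_map (Euclidean_space n) euclideanreal (\<lambda>z. \<Sum>i<n. (z i)\<^sup>2)"
      unfolding Euclidean_space_def by (intro continuous_intros) auto
    have "closedin euclideanreal {..1}" by simp
    from closedin_continuous_map_preimage[OF c this]
    have "closedin (Euclidean_space n) (topspace (disc n))" by (simp add: disc_def Int_def)
    then show ?thesis
      using closedin_Euclidean_space_iff[of n "topspace (disc n)"] by (simp add: euclidean_product_topology)
  qed
  moreover have "topspace (disc n) \<subseteq> PiE UNIV (\<lambda>i. {-1..1})"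
  proof
    fix z assume z: "z \<in> topspace (disc n)"
    have "z i \<in> {-1..1}" for i
    proof (cases "i < n")
      case True
      then have "(z i)\<^sup>2 \<le> (\<Sum>i<n. (z i)\<^sup>2)" by (intro member_le_sum) auto
      then have "(z i)\<^sup>2 \<le> 1" using z by (simp add: topspace_disc)
      then have "\<bar>z i\<bar> \<le> 1" by (simp add: abs_square_le_1)
      then show ?thesis by auto
    qed (use z in \<open>simp add: topspace_disc\<close>)
    then show "z \<in> PiE UNIV (\<lambda>i. {-1..1})" by auto
  qed
  ultimately have "compactin (powertop_real UNIV) (topspace (disc n))"
    using closed_compactin by blast
  moreover have "disc n = subtopology (powertop_real UNIV) (topspace (disc n))"
    by (simp add: disc_def Euclidean_space_def subtopology_subtopology Int_assoc)
  ultimately show ?thesis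
    using compact_space_subtopology by metis
qed

text \<open>The retraction of the cylinder over the disc onto its bottom and side by projection from the
  point \<open>(0, 2)\<close>.\<close>

definition cyl_ret :: "nat \<Rightarrow> (nat \<Rightarrow> real) \<times> real \<Rightarrow> (nat \<Rightarrow> real) \<times> real" where
  "cyl_ret n p = (if 2 * dnorm n (fst p) \<le> 2 - snd p then ((\<lambda>i. fst p i / ((2 - snd p) / 2)), 0)
     else ((\<lambda>i. fst p i / dnorm n (fst p)), 2 - (2 - snd p) / dnorm n (fst p)))"

lemma cyl_ret_low:
  assumes z: "z \<in> topspace (disc n)" and s: "s \<in> {0..1}" and c: "2 * dnorm n z \<le> 2 - s"
  shows "(\<lambda>i. z i / ((2 - s) / 2)) \<in> topspace (disc n)"
proof -
  have "dnorm n (\<lambda>i. z i / ((2 - s) / 2)) = dnorm n z / ((2 - s) / 2)"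
    using s by (simp only: dnorm_scale) simp
  also have "\<dots> \<le> 1" using s c by (simp add: field_simps)
  finally show ?thesis using z by (simp add: topspace_disc_dnorm)
qed

lemma cyl_ret_high:
  assumes z: "z \<in> topspace (disc n)" and s: "s \<in> {0..1}" and c: "2 - s \<le> 2 * dnorm n z"
  shows "(\<lambda>i. z i / dnorm n z) \<in> disc_boundary n" "2 - (2 - s) / dnorm n z \<in> {0..1}" "dnorm n z > 0"
proof -
  show pos: "dnorm n z > 0" using s c by simp
  have "dnorm n (\<lambda>i. z i / dnorm n z) = 1" using pos by (simp add: dnorm_scale)
  then show "(\<lambda>i. z i / dnorm n z) \<in> disc_boundary n"
    using z by (simp add: disc_boundary_eq topspace_disc_dnorm)
  have "dnorm n z \<le> 1" using z by (simp add: topspace_disc_dnorm)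
  then have "dnorm n z \<le> 2 - s" using s by auto
  then show "2 - (2 - s) / dnorm n z \<in> {0..1}" using pos c by (simp add: field_simps)
qed

context
  fixes X :: "'a topology" and C :: "'a cell set" and x0 :: 'a and \<Phi>0 :: "(nat \<Rightarrow> real) \<Rightarrow> 'a"
  assumes CW: "CW_structure X C" and vertex: "(0, \<Phi>0) \<in> C" "x0 \<in> open_cell (0, \<Phi>0)"
begin

lemma CW_facts:
  shows CW_Hausdorff: "Hausdorff_space X"
    and CW_char: "(n, \<Phi>) \<in> C \<Longrightarrow> continuous_map (disc n) X \<Phi>"
    and CW_inj: "(n, \<Phi>) \<in> C \<Longrightarrow> inj_on \<Phi> (disc_interior n)"
    and CW_cover: "topspace X = (\<Union>e \<in> C. open_cell e)"
    and CW_disjoint: "disjoint_family_on open_cell C"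
    and CW_attach: "(n, \<Phi>) \<in> C \<Longrightarrow> \<exists>F \<subseteq> C. finite F \<and> (\<forall>e \<in> F. fst e < n) \<and> \<Phi> ` disc_boundary n \<subseteq> (\<Union>e \<in> F. open_cell e)"
    and CW_weak: "A \<subseteq> topspace X \<Longrightarrow> closedin X A \<longleftrightarrow> (\<forall>(n, \<Phi>) \<in> C. closedin (disc n) {z \<in> topspace (disc n). \<Phi> z \<in> A})"
proof -
  note CW1 = CW[unfolded CW_structure_def, THEN conjunct2]
  note CW2 = CW1[THEN conjunct2] note CW3 = CW2[THEN conjunct2] note CW4 = CW3[THEN conjunct2]
  show "Hausdorff_space X" by (rule CW[unfolded CW_structure_def, THEN conjunct1])
  show "topspace X = (\<Union>e \<in> C. open_cell e)" by (rule CW2[THEN conjunct1])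
  show "disjoint_family_on open_cell C" by (rule CW3[THEN conjunct1])
  show "A \<subseteq> topspace X \<Longrightarrow> closedin X A \<longleftrightarrow> (\<forall>(n, \<Phi>) \<in> C. closedin (disc n) {z \<in> topspace (disc n). \<Phi> z \<in> A})"
    by (rule CW4[THEN conjunct2, rule_format])
  assume e: "(n, \<Phi>) \<in> C"
  from bspec[OF CW1[THEN conjunct1] e] show "continuous_map (disc n) X \<Phi>" by simp
  from bspec[OF CW4[THEN conjunct1] e]
  show "\<exists>F \<subseteq> C. finite F \<and> (\<forall>e \<in> F. fst e < n) \<and> \<Phi> ` disc_boundary n \<subseteq> (\<Union>e \<in> F. open_cell e)"
    by simp
  from bspec[OF CW1[THEN conjunct1] e] have "embedding_map (subtopology (disc n) (disc_interior n)) X \<Phi>" by simp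
  then have "inj_on \<Phi> (topspace (subtopology (disc n) (disc_interior n)))"
    unfolding embedding_map_def by (rule homeomorphic_imp_injective_map)
  moreover have "topspace (subtopology (disc n) (disc_interior n)) = disc_interior n"
    by (auto simp: disc_interior_eq)
  ultimately show "inj_on \<Phi> (disc_interior n)" by simp
qed

definition cell_of :: "'a \<Rightarrow> 'a cell" where
  "cell_of x = (THE e. e \<in> C \<and> x \<in> open_cell e)"

lemma cell_of_eq: "e \<in> C \<Longrightarrow> x \<in> open_cell e \<Longrightarrow> cell_of x = e"
  unfolding cell_of_def using CW_disjoint by (intro the_equality) (auto simp: disjoint_family_on_def)

lemma cell_of: "x \<in> topspace X \<Longrightarrow> cell_of x \<in> C \<and> x \<in> open_cell (cell_of x)"
  using CW_cover cell_of_eq by (metis UN_E)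

definition push :: "'a \<times> real \<Rightarrow> 'a \<times> real" where
  "push p = (if fst p = x0 then p else
     (let e = cell_of (fst p); q = cyl_ret (fst e) (the_inv_into (disc_interior (fst e)) (snd e) (fst p), snd p)
      in (snd e (fst q), snd q)))"

definition fixed :: "('a \<times> real) set" where
  "fixed = {p. snd p = 0 \<or> fst p = x0}"

definition dimn :: "'a \<Rightarrow> nat" where
  "dimn x = fst (cell_of x)"

text \<open>A push moves a point above an open cell either to the bottom or above a cell of lower
  dimension, so finitely many pushes retract the cylinder onto its bottom and the interval above
  the vertex.\<close>

definition retr :: "'a \<times> real \<Rightarrow> 'a \<times> real" where
  "retr p = (push ^^ Suc (dimn (fst p))) p"

lemma push_cell:
  assumes e: "(n, \<Phi>) \<in> C" and z: "z \<in> disc_interior n" and ne: "\<Phi> z \<noteq> x0"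
  shows "push (\<Phi> z, s) = (let q = cyl_ret n (z, s) in (\<Phi> (fst q), snd q))"
proof -
  have "cell_of (\<Phi> z) = (n, \<Phi>)" using e z by (intro cell_of_eq) (auto simp: open_cell_def)
  moreover have "the_inv_into (disc_interior n) \<Phi> (\<Phi> z) = z"
    by (rule the_inv_into_f_f[OF CW_inj[OF e] z])
  ultimately show ?thesis using ne by (simp add: push_def)
qed

lemma push_fixed: "p \<in> fixed \<Longrightarrow> fst p \<in> topspace X \<Longrightarrow> push p = p"
proof -
  assume p: "p \<in> fixed" "fst p \<in> topspace X"
  show "push p = p"
  proof (cases "fst p = x0")
    case False
    then have s: "snd p = 0" using p by (simp add: fixed_def)
    obtain n \<Phi> where e: "cell_of (fst p) = (n, \<Phi>)" by fastforce
    then have "(n, \<Phi>) \<in> C" "fst p \<in> \<Phi> ` disc_interior n" using cell_of[OF p(2)] by (auto simp: open_cell_def)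
    then obtain z where z: "(n, \<Phi>) \<in> C" "z \<in> disc_interior n" "fst p = \<Phi> z" by blast
    then have "2 * dnorm n z \<le> 2 - 0" by (simp add: disc_interior_eq)
    then have "push (\<Phi> z, 0) = (\<Phi> z, 0)"
      using push_cell[OF z(1,2)] False z(3) by (simp add: cyl_ret_def)
    then show ?thesis using s z(3) by (metis prod.collapse)
  qed (simp add: push_def)
qed

lemma push_cases:
  assumes x: "x \<in> topspace X" and s: "s \<in> {0..1}"
  shows "fst (push (x, s)) \<in> topspace X \<and> snd (push (x, s)) \<in> {0..1} \<and>
    (push (x, s) \<in> fixed \<or> dimn (fst (push (x, s))) < dimn x)"
proof (cases "x = x0")
  case True
  then show ?thesis using x s by (simp add: push_def fixed_def)
next
  case False
  obtain n \<Phi> where e: "cell_of x = (n, \<Phi>)" by fastforce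
  then have "(n, \<Phi>) \<in> C" "x \<in> \<Phi> ` disc_interior n" using cell_of[OF x] by (auto simp: open_cell_def)
  then obtain z where z: "(n, \<Phi>) \<in> C" "z \<in> disc_interior n" "x = \<Phi> z" by blast
  have zd: "z \<in> topspace (disc n)" using z by (simp add: disc_interior_eq)
  have p: "push (x, s) = (\<Phi> (fst (cyl_ret n (z, s))), snd (cyl_ret n (z, s)))"
    using push_cell[OF z(1,2)] False z(3) by (simp add: Let_def)
  have \<Phi>: "\<Phi> y \<in> topspace X" if "y \<in> topspace (disc n)" for y
    using continuous_map_image_subset_topspace[OF CW_char[OF z(1)]] that by blast
  show ?thesis
  proof (cases "2 * dnorm n z \<le> 2 - s")
    case True
    then show ?thesis using \<Phi>[OF cyl_ret_low[OF zd s True]] by (simp add: p cyl_ret_def fixed_def)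
  next
    case False
    then have h: "(\<lambda>i. z i / dnorm n z) \<in> disc_boundary n" "2 - (2 - s) / dnorm n z \<in> {0..1}"
      using cyl_ret_high[OF zd s] by auto
    obtain F where F: "F \<subseteq> C" "\<forall>e\<in>F. fst e < n" "\<Phi> ` disc_boundary n \<subseteq> (\<Union>e\<in>F. open_cell e)"
      using CW_attach[OF z(1)] by blast
    then obtain e' where e': "e' \<in> F" "\<Phi> (\<lambda>i. z i / dnorm n z) \<in> open_cell e'" using h(1) by blast
    then have "dimn (\<Phi> (\<lambda>i. z i / dnorm n z)) < n"
      using cell_of_eq[of e'] F by (auto simp: dimn_def)
    moreover have "dimn x = n" using e by (simp add: dimn_def)
    ultimately show ?thesis
      using False h \<Phi>[of "\<lambda>i. z i / dnorm n z"] by (simp add: p cyl_ret_def disc_boundary_eq)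
  qed
qed

text \<open>Once a point is fixed further pushes do nothing, so every number of pushes above the
  dimension gives the same result.\<close>

lemma push_iterate:
  assumes "fst p \<in> topspace X" "snd p \<in> {0..1}" "dimn (fst p) < m"
  shows "(push ^^ m) p = retr p \<and> retr p \<in> fixed \<and> fst (retr p) \<in> topspace X \<and> snd (retr p) \<in> {0..1}"
proof -
  have fx: "(push ^^ m) p = p" if "p \<in> fixed" "fst p \<in> topspace X" for m p
    by (induction m) (use push_fixed[OF that] in auto)
  have "(push ^^ m) p = (push ^^ Suc d) p \<and> (push ^^ m) p \<in> fixed \<and> fst ((push ^^ m) p) \<in> topspace X \<and> snd ((push ^^ m) p) \<in> {0..1}"
    if "dimn (fst p) = d" "fst p \<in> topspace X" "snd p \<in> {0..1}" "d < m" for p m d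
    using that
  proof (induction d arbitrary: p m rule: less_induct)
    case (less d)
    obtain x s where p: "p = (x, s)" by fastforce
    have c: "fst (push p) \<in> topspace X \<and> snd (push p) \<in> {0..1} \<and> (push p \<in> fixed \<or> dimn (fst (push p)) < d)"
      using push_cases[of x s] less.prems p by auto
    obtain l where m: "m = Suc l" using less.prems(4) by (cases m) auto
    have pm: "(push ^^ m) p = (push ^^ l) (push p)" "(push ^^ Suc d) p = (push ^^ d) (push p)"
      unfolding m by (simp_all add: funpow_swap1)
    show ?case
    proof (cases "push p \<in> fixed")
      case True
      then show ?thesis using c fx[OF True] unfolding pm by simp
    next
      case False
      then have d: "dimn (fst (push p)) < d" using c by blast
      have "dimn (fst (push p)) < l" using d less.prems(4) m by simp
      with less.IH[OF d refl, of l] less.IH[OF d refl, of d] c d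
      show ?thesis unfolding pm by auto
    qed
  qed
  from this[OF refl assms(1,2), of m] this[OF refl assms(1,2), of "Suc (dimn (fst p))"] assms(3)
  show ?thesis by (simp add: retr_def)
qed

lemma retr_push:
  assumes "fst p \<in> topspace X" "snd p \<in> {0..1}"
  shows "retr (push p) = retr p"
proof -
  obtain x s where p: "p = (x, s)" by fastforce
  have c: "fst (push p) \<in> topspace X \<and> snd (push p) \<in> {0..1}"
    using push_cases[of x s] assms p by auto
  let ?m = "Suc (dimn (fst p) + dimn (fst (push p)))"
  have "retr (push p) = (push ^^ ?m) (push p)" using push_iterate[of "push p" ?m] c by simp
  also have "\<dots> = (push ^^ Suc ?m) p" by (simp add: funpow_swap1)
  also have "\<dots> = retr p" using push_iterate[OF assms, of "Suc ?m"] by simp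
  finally show ?thesis .
qed

lemma retr_fixed: "p \<in> fixed \<Longrightarrow> fst p \<in> topspace X \<Longrightarrow> retr p = p"
proof -
  assume p: "p \<in> fixed" "fst p \<in> topspace X"
  have "(push ^^ m) p = p" for m by (induction m) (simp_all add: push_fixed[OF p])
  then show ?thesis unfolding retr_def .
qed

lemma cell_image_closed:
  assumes "(n, \<Phi>) \<in> C"
  shows "closedin X (\<Phi> ` topspace (disc n))"
  using compactin_imp_closedin[OF CW_Hausdorff image_compactin[OF _ CW_char[OF assms]]] compact_disc
  by (simp add: compact_space_def)

text \<open>Induction on the dimension of the cell. Over its interior \<open>retr\<close> absorbs
  one push, hence is \<open>cyl_ret\<close> followed by the bottom or by the map over the boundary;
  the latter is continuous by induction, as the boundary lies in finitely many closed cells of lower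
  dimension.\<close>

lemma cm_retr_cell:
  "(n, \<Phi>) \<in> C \<Longrightarrow> continuous_map (prod_topology (disc n) unit_interval) (prod_topology X unit_interval) (\<lambda>p. retr (\<Phi> (fst p), snd p))"
proof (induction n arbitrary: \<Phi> rule: less_induct)
  case (less n)
  note \<Phi> = CW_char[OF less.prems]
  let ?P = "prod_topology (disc n) unit_interval" and ?Y = "prod_topology X unit_interval"
  have \<Phi>in: "\<Phi> z \<in> topspace X" if "z \<in> topspace (disc n)" for z
    using continuous_map_image_subset_topspace[OF \<Phi>] that by blast
  show ?case
  proof (cases "\<Phi> = \<Phi>0 \<and> n = 0")
    case True
    have "disc_interior 0 = topspace (disc 0)" "topspace (disc 0) = {\<lambda>_. 0}"
      by (auto simp: disc_interior_eq dnorm_def topspace_disc)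
    then have "\<Phi> z = x0" if "z \<in> topspace (disc n)" for z
      using that vertex(2) True by (auto simp: open_cell_def)
    then have "retr (\<Phi> (fst p), snd p) = (\<Phi> (fst p), snd p)" if "p \<in> topspace ?P" for p
      using that \<Phi>in by (intro retr_fixed) (auto simp: fixed_def)
    moreover have "continuous_map ?P ?Y (\<lambda>p. (\<Phi> (fst p), snd p))"
      by (intro continuous_map_pairedI cm_comp[OF \<Phi> cm_fst'] cm_snd')
    ultimately show ?thesis by (metis (no_types, lifting) continuous_map_eq)
  next
    case False
    have nx: "\<Phi> z \<noteq> x0" if "z \<in> disc_interior n" for z
    proof
      assume "\<Phi> z = x0"
      then have "cell_of x0 = (n, \<Phi>)" using less.prems that by (intro cell_of_eq) (auto simp: open_cell_def)
      then show False using cell_of_eq[OF vertex] False by simp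
    qed
    let ?B = "prod_topology (subtopology (disc n) (disc_boundary n)) unit_interval"
    obtain F where F: "F \<subseteq> C" "finite F" "\<And>e. e \<in> F \<Longrightarrow> fst e < n" "\<Phi> ` disc_boundary n \<subseteq> (\<Union>e\<in>F. open_cell e)"
      using CW_attach[OF less.prems] by blast
    have tB: "topspace ?B = disc_boundary n \<times> {0..1}" by (auto simp: disc_boundary_eq)
    have \<Phi>B: "continuous_map ?B X (\<lambda>p. \<Phi> (fst p))"
      by (rule cm_comp[OF cm_sub[OF \<Phi>] cm_fst'])
    have bd: "continuous_map ?B ?Y (\<lambda>p. retr (\<Phi> (fst p), snd p))"
    proof (rule pasting_lemma_closed[where I = F and T = "\<lambda>e. {p \<in> topspace ?B. \<Phi> (fst p) \<in> snd e ` topspace (disc (fst e))}"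
          and f = "\<lambda>e p. retr (\<Phi> (fst p), snd p)"])
      fix e assume e: "e \<in> F"
      obtain k \<Psi> where k: "e = (k, \<Psi>)" by fastforce
      then have kC: "(k, \<Psi>) \<in> C" "k < n" using e F by auto
      let ?K = "\<Psi> ` topspace (disc k)"
      show "closedin ?B {p \<in> topspace ?B. \<Phi> (fst p) \<in> snd e ` topspace (disc (fst e))}"
        using closedin_continuous_map_preimage[OF \<Phi>B cell_image_closed[OF kC(1)]] k by simp
      let ?q = "\<lambda>p. (\<Psi> (fst p), snd p)"
      have q: "continuous_map (prod_topology (disc k) unit_interval) (prod_topology (subtopology X ?K) unit_interval) ?q"
        by (intro continuous_map_pairedI cm_snd' continuous_map_into_subtopology cm_comp[OF CW_char[OF kC(1)] cm_fst']) auto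
      have "?q ` topspace (prod_topology (disc k) unit_interval) = topspace (prod_topology (subtopology X ?K) unit_interval)"
        using continuous_map_image_subset_topspace[OF CW_char[OF kC(1)]] by force
      \<comment> \<open>By compactness a closed cell times the interval is a quotient of its disc
        times the interval, so continuity descends from the disc.\<close>
      from continuous_imp_quotient_map[OF q _ _ this]
      have "quotient_map (prod_topology (disc k) unit_interval) (prod_topology (subtopology X ?K) unit_interval) ?q"
        by (simp add: compact_space_prod_topology compact_disc compact_unit_interval Hausdorff_space_prod_topology
            Hausdorff_space_subtopology CW_Hausdorff)
      then have r: "continuous_map (prod_topology (subtopology X ?K) unit_interval) ?Y retr"
        by (rule continuous_compose_quotient_map) (use less.IH[OF kC(2,1)] in \<open>simp add: o_def\<close>)
      show "continuous_map (subtopology ?B {p \<in> topspace ?B. \<Phi> (fst p) \<in> snd e ` topspace (disc (fst e))}) ?Y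
          (\<lambda>p. retr (\<Phi> (fst p), snd p))"
        by (rule cm_comp[OF r], intro continuous_map_pairedI continuous_map_into_subtopology cm_sub[OF \<Phi>B] cm_sub[OF cm_snd'])
           (auto simp: k)
    next
      fix p assume p: "p \<in> topspace ?B"
      then have "fst p \<in> disc_boundary n" unfolding tB by auto
      then have "\<Phi> (fst p) \<in> \<Phi> ` disc_boundary n" by (rule imageI)
      then have "\<Phi> (fst p) \<in> (\<Union>e\<in>F. open_cell e)" using F(4) by blast
      then obtain e where "e \<in> F" "\<Phi> (fst p) \<in> open_cell e" by blast
      moreover then have "\<Phi> (fst p) \<in> snd e ` topspace (disc (fst e))"
        by (auto simp: open_cell_def disc_interior_eq)
      ultimately show "\<exists>j. j \<in> F \<and> p \<in> {p \<in> topspace ?B. \<Phi> (fst p) \<in> snd j ` topspace (disc (fst j))} \<and>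
          retr (\<Phi> (fst p), snd p) = retr (\<Phi> (fst p), snd p)" using p by blast
    qed (use F in auto)
    \<comment> \<open>On the boundary of the disc the projection fixes the point, so the same
      formula holds there although the push of this cell does not apply.\<close>
    have eq: "retr (\<Phi> (fst p), snd p) = (if 2 * dnorm n (fst p) \<le> 2 - snd p then (\<Phi> (\<lambda>i. fst p i / ((2 - snd p) / 2)), 0)
        else retr (\<Phi> (\<lambda>i. fst p i / dnorm n (fst p)), 2 - (2 - snd p) / dnorm n (fst p)))" if p: "p \<in> topspace ?P" for p
    proof -
      obtain z s where zs: "p = (z, s)" and z: "z \<in> topspace (disc n)" and s: "s \<in> {0..1}" using p by auto
      show ?thesis
      proof (cases "z \<in> disc_interior n")
        case True
        have "retr (\<Phi> z, s) = retr (push (\<Phi> z, s))" using retr_push[of "(\<Phi> z, s)"] \<Phi>in[OF z] s by simp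
        also have "push (\<Phi> z, s) = (\<Phi> (fst (cyl_ret n (z, s))), snd (cyl_ret n (z, s)))"
          using push_cell[OF less.prems True nx[OF True]] by (simp add: Let_def)
        finally have *: "retr (\<Phi> z, s) = retr \<dots>" .
        show ?thesis
        proof (cases "2 * dnorm n z \<le> 2 - s")
          case True
          then show ?thesis
            using * retr_fixed[of "(\<Phi> (\<lambda>i. z i / ((2 - s) / 2)), 0)"] \<Phi>in[OF cyl_ret_low[OF z s True]]
            by (simp add: zs cyl_ret_def fixed_def)
        qed (use * in \<open>simp add: zs cyl_ret_def\<close>)
      next
        case False
        then have 1: "dnorm n z = 1" using z by (auto simp: disc_interior_eq topspace_disc_dnorm)
        show ?thesis
        proof (cases "s = 0")
          case True
          then show ?thesis using 1 retr_fixed[of "(\<Phi> z, 0)"] \<Phi>in[OF z] by (simp add: zs fixed_def)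
        qed (use 1 s in \<open>simp add: zs\<close>)
      qed
    qed
    have s: "continuous_map ?P euclideanreal snd" by (rule cm_interval_real[OF cm_snd'])
    have z: "continuous_map ?P (disc n) fst" by (rule cm_fst')
    have r: "continuous_map ?P euclideanreal (\<lambda>p. dnorm n (fst p))" by (rule cm_dnorm[OF z])
    have "continuous_map ?P ?Y (\<lambda>p. if 2 * dnorm n (fst p) \<le> 2 - snd p then (\<Phi> (\<lambda>i. fst p i / ((2 - snd p) / 2)), 0)
        else retr (\<Phi> (\<lambda>i. fst p i / dnorm n (fst p)), 2 - (2 - snd p) / dnorm n (fst p)))"
    proof (rule cm_if_le)
      let ?V = "subtopology ?P {p \<in> topspace ?P. 2 * dnorm n (fst p) \<le> 2 - snd p}"
      have "continuous_map ?V (disc n) (\<lambda>p. (\<lambda>i. fst p i / ((2 - snd p) / 2)))"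
        unfolding cm_disc
      proof (intro conjI allI ballI)
        show "continuous_map ?V euclideanreal (\<lambda>p. fst p i / ((2 - snd p) / 2))" for i
          by (intro continuous_intros cm_sub[OF s] cm_disc_coord[OF cm_sub[OF z]]) auto
        show "(\<lambda>i. fst p i / ((2 - snd p) / 2)) \<in> topspace (disc n)" if "p \<in> topspace ?V" for p
          using that by (intro cyl_ret_low) auto
      qed
      from cm_comp[OF \<Phi> this]
      show "continuous_map ?V ?Y (\<lambda>p. (\<Phi> (\<lambda>i. fst p i / ((2 - snd p) / 2)), 0))"
        by (intro continuous_map_pairedI) (simp_all add: cm_interval)
      let ?U = "subtopology ?P {p \<in> topspace ?P. 2 - snd p \<le> 2 * dnorm n (fst p)}"
      have U: "fst p \<in> topspace (disc n)" "snd p \<in> {0..1}" "2 - snd p \<le> 2 * dnorm n (fst p)" if "p \<in> topspace ?U" for p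
        using that by auto
      have ne: "dnorm n (fst p) \<noteq> 0" if "p \<in> topspace ?U" for p
        using cyl_ret_high(3)[OF U[OF that]] by simp
      have "continuous_map ?U ?B (\<lambda>p. ((\<lambda>i. fst p i / dnorm n (fst p)), 2 - (2 - snd p) / dnorm n (fst p)))"
      proof (rule continuous_map_pairedI, rule continuous_map_into_subtopology)
        show "continuous_map ?U (disc n) (\<lambda>p. (\<lambda>i. fst p i / dnorm n (fst p)))"
          unfolding cm_disc
        proof (intro conjI allI ballI)
          show "continuous_map ?U euclideanreal (\<lambda>p. fst p i / dnorm n (fst p))" for i
            by (intro continuous_map_real_divide cm_sub[OF r] cm_disc_coord[OF cm_sub[OF z]] ne)
          show "(\<lambda>i. fst p i / dnorm n (fst p)) \<in> topspace (disc n)" if "p \<in> topspace ?U" for p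
            using cyl_ret_high(1)[OF U[OF that]] by (simp add: disc_boundary_eq)
        qed
        show "(\<lambda>p. (\<lambda>i. fst p i / dnorm n (fst p))) \<in> topspace ?U \<rightarrow> disc_boundary n"
          using cyl_ret_high(1)[OF U] by blast
        show "continuous_map ?U unit_interval (\<lambda>p. 2 - (2 - snd p) / dnorm n (fst p))"
          unfolding cm_interval
        proof
          show "continuous_map ?U euclideanreal (\<lambda>p. 2 - (2 - snd p) / dnorm n (fst p))"
            by (intro continuous_map_diff continuous_map_real_divide continuous_map_canonical_const cm_sub[OF r] cm_sub[OF s] ne)
          show "\<forall>p\<in>topspace ?U. 0 \<le> 2 - (2 - snd p) / dnorm n (fst p) \<and> 2 - (2 - snd p) / dnorm n (fst p) \<le> 1"
            using cyl_ret_high(2)[OF U] by (meson atLeastAtMost_iff)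
        qed
      qed
      from cm_comp[OF bd this]
      show "continuous_map ?U ?Y (\<lambda>p. retr (\<Phi> (\<lambda>i. fst p i / dnorm n (fst p)), 2 - (2 - snd p) / dnorm n (fst p)))"
        by simp
      fix p assume p: "p \<in> topspace ?P" "2 * dnorm n (fst p) = 2 - snd p"
      have d: "(2 - snd p) / 2 = dnorm n (fst p)" using p(2) by simp
      have pz: "fst p \<in> topspace (disc n)" "snd p \<in> {0..1}" using p(1) by auto
      have "\<Phi> (\<lambda>i. fst p i / dnorm n (fst p)) \<in> topspace X"
        using \<Phi>in[OF cyl_ret_low[OF pz]] p(2) unfolding d by simp
      moreover have "2 - (2 - snd p) / dnorm n (fst p) = 0"
        using cyl_ret_high(3)[OF pz eq_refl[OF p(2)[symmetric]]] unfolding p(2)[symmetric] by simp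
      ultimately show "(\<Phi> (\<lambda>i. fst p i / ((2 - snd p) / 2)), 0) =
          retr (\<Phi> (\<lambda>i. fst p i / dnorm n (fst p)), 2 - (2 - snd p) / dnorm n (fst p))"
        unfolding d by (simp add: retr_fixed fixed_def)
    qed (intro continuous_intros r s)+
    then show ?thesis by (rule continuous_map_eq) (simp add: eq)
  qed
qed

text \<open>By the weak topology \<open>X\<close> is a quotient of the disjoint union of its discs.
  The interval is locally compact, so this stays a quotient after taking the product with
  it.\<close>

lemma cm_retr: "continuous_map (prod_topology X unit_interval) (prod_topology X unit_interval) retr"
proof -
  let ?D = "\<lambda>e :: 'a cell. disc (fst e)"
  let ?S = "sum_topology ?D C"
  let ?q = "\<lambda>w. snd (fst w) (snd w)"
  have qin: "snd e z \<in> topspace X" if "e \<in> C" "z \<in> topspace (disc (fst e))" for e z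
    using continuous_map_image_subset_topspace[OF CW_char[of "fst e" "snd e"]] that by auto
  have "quotient_map ?S X ?q"
    unfolding quotient_map_closedin
  proof (intro conjI allI impI)
    show "?q ` topspace ?S = topspace X"
    proof
      show "?q ` topspace ?S \<subseteq> topspace X" using qin by auto
      show "topspace X \<subseteq> ?q ` topspace ?S"
      proof
        fix x assume "x \<in> topspace X"
        from cell_of[OF this] obtain z where "cell_of x \<in> C" "z \<in> disc_interior (fst (cell_of x))" "x = snd (cell_of x) z"
          by (auto simp: open_cell_def)
        then show "x \<in> ?q ` topspace ?S"
          by (intro image_eqI[of _ _ "(cell_of x, z)"]) (auto simp: disc_interior_eq)
      qed
    qed
    fix U assume U: "U \<subseteq> topspace X"
    have "closedin ?S {w \<in> topspace ?S. ?q w \<in> U} \<longleftrightarrow> (\<forall>e\<in>C. closedin (disc (fst e)) {z \<in> topspace (disc (fst e)). snd e z \<in> U})"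
      unfolding closedin_sum_topology by (auto simp: cong: conj_cong)
    also have "\<dots> \<longleftrightarrow> closedin X U" using CW_weak[OF U] by auto
    finally show "closedin ?S {w \<in> topspace ?S. ?q w \<in> U} = closedin X U" .
  qed
  from quotient_map_prod_left[OF _ _ this, of unit_interval]
  have quo: "quotient_map (prod_topology ?S unit_interval) (prod_topology X unit_interval) (\<lambda>(w, s). (?q w, s))"
    using compact_unit_interval Hausdorff_unit_interval compact_imp_locally_compact_space by blast
  show ?thesis
  proof (rule continuous_compose_quotient_map[OF quo])
    let ?P = "prod_topology ?S unit_interval"
    have c: "continuous_map ?S (discrete_topology C) fst"
      unfolding continuous_map_def
    proof (intro conjI allI impI)
      fix U assume "openin (discrete_topology C) U"
      have "openin (disc n) {z. ((n, \<Phi>), z) \<in> {w \<in> topspace ?S. fst w \<in> U}}" if "(n, \<Phi>) \<in> C" for n \<Phi>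
        using that by (cases "(n, \<Phi>) \<in> U") auto
      then show "openin ?S {w \<in> topspace ?S. fst w \<in> U}"
        by (auto simp: openin_sum_topology)
    qed auto
    show "continuous_map ?P (prod_topology X unit_interval) (retr \<circ> (\<lambda>(w, s). (?q w, s)))"
    proof (rule cm_slices[OF cm_comp[OF c cm_fst']])
      fix e assume e: "e \<in> C"
      let ?V = "subtopology ?P {p \<in> topspace ?P. fst (fst p) = e}"
      have "continuous_map (subtopology ?S {w \<in> topspace ?S. fst w = e}) (disc (fst e)) snd"
        unfolding continuous_map_def
      proof (intro conjI allI impI)
        show "snd \<in> topspace (subtopology ?S {w \<in> topspace ?S. fst w = e}) \<rightarrow> topspace (disc (fst e))" by auto
        fix U assume U: "openin (disc (fst e)) U"
        have "openin (disc a) {x. (a, b) = e \<and> x \<in> U}" for a and b :: "(nat \<Rightarrow> real) \<Rightarrow> 'a"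
          using U by (cases "(a, b) = e") auto
        then have "openin ?S ({e} \<times> U)"
          using U openin_subset[OF U] e by (auto simp: openin_sum_topology)
        moreover have "{x \<in> topspace (subtopology ?S {w \<in> topspace ?S. fst w = e}). snd x \<in> U} = {e} \<times> U \<inter> {w \<in> topspace ?S. fst w = e}"
          using openin_subset[OF U] e by auto
        ultimately show "openin (subtopology ?S {w \<in> topspace ?S. fst w = e}) {x \<in> topspace (subtopology ?S {w \<in> topspace ?S. fst w = e}). snd x \<in> U}"
          by (auto simp: openin_subtopology)
      qed
      moreover have "continuous_map ?V (subtopology ?S {w \<in> topspace ?S. fst w = e}) fst"
        by (rule continuous_map_into_subtopology[OF cm_sub[OF cm_fst']]) auto
      ultimately have "continuous_map ?V (disc (fst e)) (\<lambda>p. snd (fst p))"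
        by (rule cm_comp)
      then have "continuous_map ?V (prod_topology (disc (fst e)) unit_interval) (\<lambda>p. (snd (fst p), snd p))"
        by (intro continuous_map_pairedI cm_sub[OF cm_snd'])
      from cm_comp[OF cm_retr_cell[of "fst e" "snd e"] this] e
      have "continuous_map ?V (prod_topology X unit_interval) (\<lambda>p. retr (snd e (snd (fst p)), snd p))"
        by simp
      then show "continuous_map ?V (prod_topology X unit_interval) (retr \<circ> (\<lambda>(w, s). (?q w, s)))"
        by (rule continuous_map_eq) (auto simp: case_prod_beta)
    qed
  qed
qed

end

text \<open>A point at height 1 is retracted to the bottom or to the interval above the vertex.
  \<open>V\<close> is the open set on which the height stays positive, which forces the second case,
  and the first coordinate of the retraction is the deformation.\<close>

theorem CW_vertex_nondegenerate:
  assumes "pointed_CW_complex X x0"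
  obtains k V where "continuous_map (prod_topology X unit_interval) X (\<lambda>p. k (snd p) (fst p))"
    "\<And>x. x \<in> topspace X \<Longrightarrow> k 0 x = x" "\<And>s. s \<in> {0..1} \<Longrightarrow> k s x0 = x0"
    "openin X V" "x0 \<in> V" "\<And>x. x \<in> V \<Longrightarrow> k 1 x = x0" "Hausdorff_space X"
proof -
  obtain C e where CW: "CW_structure X C" and e: "e \<in> C" "fst e = 0" "x0 \<in> open_cell e"
    using assms by (auto simp: pointed_CW_complex_def)
  obtain \<Phi>0 where \<Phi>0: "e = (0, \<Phi>0)" using e(2) by (cases e) auto
  note v = CW e(1,3)[unfolded \<Phi>0]
  note G = cm_retr[OF v]
  let ?G = "retr C x0"
  have x0: "x0 \<in> topspace X" using CW_cover[OF v] e by blast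
  define V where "V = {x \<in> topspace X. 0 < snd (?G (x, 1))}"
  show ?thesis
  proof (rule that[of "\<lambda>s x. fst (?G (x, s))" V])
    show "continuous_map (prod_topology X unit_interval) X (\<lambda>p. fst (?G (fst p, snd p)))"
      using cm_fst[OF G] by simp
    show "fst (?G (x, 0)) = x" if "x \<in> topspace X" for x
      using retr_fixed[OF v, of "(x, 0)"] that by (simp add: fixed_def[OF v])
    show f: "fst (?G (x0, s)) = x0" if "s \<in> {0..1}" for s
      using retr_fixed[OF v, of "(x0, s)"] x0 by (simp add: fixed_def[OF v])
    have "continuous_map X (prod_topology X unit_interval) (\<lambda>x. (x, 1))"
      by (intro continuous_map_pairedI cm_id) simp
    from cm_interval_real[OF cm_snd[OF cm_comp[OF G this]]]
    have "continuous_map X euclideanreal (\<lambda>x. snd (?G (x, 1)))" .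
    from openin_continuous_map_preimage[OF this, of "{0<..}"]
    show "openin X V" by (simp add: V_def)
    show "x0 \<in> V"
      using retr_fixed[OF v, of "(x0, 1)"] x0 by (simp add: fixed_def[OF v] V_def)
    show "fst (?G (x, 1)) = x0" if "x \<in> V" for x
      using push_iterate[OF v, of "(x, 1)" "Suc (dimn C x)"] that by (auto simp: V_def fixed_def[OF v])
  qed (rule CW_Hausdorff[OF v])
qed

section \<open>Homology of the mapping cone\<close>

definition tors_group :: "('g, 'm) monoid_scheme \<Rightarrow> bool" where
  "tors_group H \<longleftrightarrow> (\<forall>h \<in> carrier H. \<exists>N::nat. N > 0 \<and> h [^]\<^bsub>H\<^esub> N = \<one>\<^bsub>H\<^esub>)"

lemma tors_group_epi:
  assumes "group G" "group H" "h \<in> hom G H" "h ` carrier G = carrier H" "tors_group G"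
  shows "tors_group H"
  unfolding tors_group_def
proof
  fix y assume "y \<in> carrier H"
  then obtain x where x: "x \<in> carrier G" "y = h x" using assms(4) by blast
  then obtain N :: nat where N: "N > 0" "x [^]\<^bsub>G\<^esub> N = \<one>\<^bsub>G\<^esub>" using assms(5) by (auto simp: tors_group_def)
  have "y [^]\<^bsub>H\<^esub> N = h (x [^]\<^bsub>G\<^esub> N)" using hom_nat_pow[OF assms(3) x(1) assms(1,2)] x by simp
  then show "\<exists>N::nat. N > 0 \<and> y [^]\<^bsub>H\<^esub> N = \<one>\<^bsub>H\<^esub>" using N hom_one[OF assms(3,1,2)] by auto
qed

lemma tors_group_mono:
  assumes "group G" "group H" "h \<in> hom G H" "inj_on h (carrier G)" "tors_group H"
  shows "tors_group G"
  unfolding tors_group_def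
proof
  fix x assume x: "x \<in> carrier G"
  then have "h x \<in> carrier H" using assms(3) by (auto simp: hom_def)
  then obtain N :: nat where N: "N > 0" "h x [^]\<^bsub>H\<^esub> N = \<one>\<^bsub>H\<^esub>" using assms(5) by (auto simp: tors_group_def)
  then have "h (x [^]\<^bsub>G\<^esub> N) = h \<one>\<^bsub>G\<^esub>"
    using hom_nat_pow[OF assms(3) x assms(1,2)] hom_one[OF assms(3,1,2)] by simp
  then have "x [^]\<^bsub>G\<^esub> N = \<one>\<^bsub>G\<^esub>"
    using assms(1,4) x by (metis inj_onD monoid.nat_pow_closed group.is_monoid monoid.one_closed)
  then show "\<exists>N::nat. N > 0 \<and> x [^]\<^bsub>G\<^esub> N = \<one>\<^bsub>G\<^esub>" using N by blast
qed

lemma tors_group_iso: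
  assumes "group G" "group H" "h \<in> iso G H"
  shows "tors_group G \<longleftrightarrow> tors_group H"
  using assms tors_group_epi[of G H h] tors_group_mono[of G H h] by (auto simp: iso_def bij_betw_def)

lemma tors_group_trivial:
  assumes "trivial_group G"
  shows "tors_group G"
  unfolding tors_group_def
proof
  fix h assume "h \<in> carrier G"
  then have "h = \<one>\<^bsub>G\<^esub>" "group G" using assms by (auto simp: trivial_group_def)
  then show "\<exists>N::nat. N > 0 \<and> h [^]\<^bsub>G\<^esub> N = \<one>\<^bsub>G\<^esub>"
    by (intro exI[of _ 1]) (simp add: group.is_monoid monoid.nat_pow_one)
qed

lemma inj_on_relativization:
  assumes "trivial_group (homology_group p (subtopology X S))"
  shows "inj_on (hom_induced p X {} X S id) (carrier (homology_group p X))"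
proof -
  let ?i = "hom_induced p (subtopology X S) {} X {} id"
  have k: "kernel (homology_group p X) (relative_homology_group p X S) (hom_induced p X {} X S id) =
      ?i ` carrier (homology_group p (subtopology X S))"
    using homology_exactness_axiom_3[of p X S] by simp
  also have "\<dots> = {\<one>\<^bsub>homology_group p X\<^esub>}"
    using assms hom_one[OF hom_induced_hom[of p "subtopology X S" "{}" X "{}" id]] by (simp add: trivial_group_def)
  finally have ker: "kernel (homology_group p X) (relative_homology_group p X S) (hom_induced p X {} X S id) =
      {\<one>\<^bsub>homology_group p X\<^esub>}" .
  have "group_hom (homology_group p X) (relative_homology_group p X S) (hom_induced p X {} X S id)"
    by (simp add: group_hom_def group_hom_axioms_def hom_induced_hom)
  from group_hom.inj_iff_trivial_ker[OF this] show ?thesis using ker by simp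
qed

lemma surj_relativization:
  assumes "trivial_group (homology_group (p - 1) (subtopology X S))"
  shows "hom_induced p X {} X S id ` carrier (homology_group p X) = carrier (relative_homology_group p X S)"
proof -
  have "kernel (relative_homology_group p X S) (homology_group (p - 1) (subtopology X S)) (hom_boundary p X S) =
      hom_induced p X {} X S id ` carrier (homology_group p X)"
    using homology_exactness_axiom_1[of p X S] by simp
  moreover have "hom_boundary p X S c = \<one>\<^bsub>homology_group (p - 1) (subtopology X S)\<^esub>" for c
    using hom_boundary_carrier[of p X S c] assms by (simp add: trivial_group_def)
  ultimately show ?thesis by (auto simp: kernel_def)
qed

section \<open>Excision around the image of the target in the cone\<close>

context
  fixes X :: "'a topology" and x0 :: 'a and Y :: "'b topology" and y0 :: 'b and f :: "'a \<Rightarrow> 'b"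
begin

text \<open>The part of the cylinder that the cone glues into \<open>Y\<close>, whose copy in the
  cone is \<open>base_part\<close>.\<close>

definition "ends = topspace X \<times> {0, 1::real} \<union> {x0} \<times> {0..1}"
definition "base_part = (Inr ` topspace Y :: (('a \<times> real) + 'b) set)"

context
  fixes k :: "real \<Rightarrow> 'a \<Rightarrow> 'a" and V :: "'a set"
  assumes f: "continuous_map X Y f" and fx0: "f x0 = y0"
    and x0: "x0 \<in> topspace X" and XH: "Hausdorff_space X"
    and k: "continuous_map (prod_topology X unit_interval) X (\<lambda>p. k (snd p) (fst p))"
    and k0: "\<And>x. x \<in> topspace X \<Longrightarrow> k 0 x = x" and kx0: "\<And>s. s \<in> {0..1} \<Longrightarrow> k s x0 = x0"
    and V: "openin X V" "x0 \<in> V" and k1: "\<And>x. x \<in> V \<Longrightarrow> k 1 x = x0"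
begin

abbreviation (input) "P \<equiv> prod_topology X unit_interval"
abbreviation (input) "A \<equiv> mapping_cone X x0 Y y0 f"
abbreviation (input) "kap \<equiv> cone_proj x0 y0 f"

text \<open>An open set around \<open>ends\<close> that can be pushed into \<open>ends\<close>; near
  the interval above \<open>x0\<close> this rests on the nondegeneracy of the vertex.\<close>

definition "nbh = {p \<in> topspace P. snd p < 1/3 \<or> 2/3 < snd p \<or> fst p \<in> V}"
definition "base_nbh = base_part \<union> kap ` nbh"

lemma y0: "y0 \<in> topspace Y"
  using continuous_map_image_subset_topspace[OF f] x0 fx0 by blast

lemma topspace_A: "topspace A = Inl ` ((topspace X - {x0}) \<times> {0<..<1}) \<union> base_part"
  by (simp add: topspace_mapping_cone[OF f y0] cone_points_def base_part_def)

lemma f_in: "x \<in> topspace X \<Longrightarrow> f x \<in> topspace Y"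
  using continuous_map_image_subset_topspace[OF f] by blast

lemma kap_Inl: "x \<noteq> x0 \<Longrightarrow> 0 < t \<Longrightarrow> t < 1 \<Longrightarrow> kap (x, t) = Inl (x, t)"
  by (simp add: cone_proj_def)

lemma kap_Inl': "p \<in> (topspace X - {x0}) \<times> {0<..<1} \<Longrightarrow> kap p = Inl p"
  by (cases p) (simp add: kap_Inl)

lemma kap_cases:
  assumes "p \<in> topspace P"
  shows "p \<in> ends \<Longrightarrow> kap p \<in> base_part" "p \<notin> ends \<Longrightarrow> kap p = Inl p \<and> p \<in> (topspace X - {x0}) \<times> {0<..<1}"
proof -
  show "p \<in> ends \<Longrightarrow> kap p \<in> base_part" using assms f_in y0 by (auto simp: cone_proj_def ends_def base_part_def)
  assume "p \<notin> ends"
  then have "p \<in> (topspace X - {x0}) \<times> {0<..<1}" using assms by (auto simp: ends_def)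
  then show "kap p = Inl p \<and> p \<in> (topspace X - {x0}) \<times> {0<..<1}" using kap_Inl' by blast
qed

lemma kap_in: "p \<in> topspace P \<Longrightarrow> kap p \<in> topspace A"
  using kap_cases[of p] by (cases "p \<in> ends") (auto simp: topspace_A)

lemma cm_kap: "continuous_map P A kap"
  unfolding continuous_map_def
proof (intro conjI allI impI)
  show "kap \<in> topspace P \<rightarrow> topspace A" using kap_in by blast
  fix U assume "openin A U"
  then show "openin P {p \<in> topspace P. kap p \<in> U}" by (simp add: openin_mapping_cone)
qed

lemma cm_from_cone:
  assumes 1: "continuous_map P Z (\<lambda>p. h (kap p))" and 2: "continuous_map Y Z (\<lambda>y. h (Inr y))"
  shows "continuous_map A Z h"
  unfolding continuous_map_def
proof (intro conjI allI impI)
  show "h \<in> topspace A \<rightarrow> topspace Z"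
  proof
    fix a assume "a \<in> topspace A"
    then consider p where "a = Inl p" "p \<in> (topspace X - {x0}) \<times> {0<..<1}" | y where "a = Inr y" "y \<in> topspace Y"
      by (auto simp: topspace_A base_part_def)
    then show "h a \<in> topspace Z"
    proof cases
      case 1
      then have "kap p = a" "p \<in> topspace P" using kap_Inl' by auto
      then show ?thesis using continuous_map_image_subset_topspace[OF assms(1)] by auto
    next
      case 2
      then show ?thesis using continuous_map_image_subset_topspace[OF assms(2)] by auto
    qed
  qed
  fix U assume U: "openin Z U"
  have "{p \<in> topspace X \<times> {0..1}. kap p \<in> {a \<in> topspace A. h a \<in> U}} = {p \<in> topspace P. h (kap p) \<in> U}"
    using kap_in by auto
  moreover have "{y \<in> topspace Y. Inr y \<in> {a \<in> topspace A. h a \<in> U}} = {y \<in> topspace Y. h (Inr y) \<in> U}"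
    by (auto simp: topspace_A base_part_def)
  moreover have "topspace A = cone_points X x0 Y" by (rule topspace_mapping_cone[OF f y0])
  ultimately show "openin A {a \<in> topspace A. h a \<in> U}"
    unfolding openin_mapping_cone[of _ _ _ _ _ "{a \<in> topspace A. h a \<in> U}"]
    using openin_continuous_map_preimage[OF 1 U] openin_continuous_map_preimage[OF 2 U] by auto
qed

lemma openin_P_minus_ends: "openin P (topspace P - ends)"
proof -
  have "openin X (topspace X - {x0})"
    using Hausdorff_imp_t1_space[OF XH] x0 by (simp add: t1_space_closedin_singleton openin_diff)
  moreover have "openin unit_interval {0<..<1}"
    by (auto simp: openin_open intro!: exI[of _ "{0<..<1}"])
  moreover have "topspace P - ends = (topspace X - {x0}) \<times> {0<..<1}" by (auto simp: ends_def)
  ultimately show ?thesis by (simp add: openin_prod_Times_iff)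
qed

lemma openin_Inl:
  assumes "openin P U" "U \<subseteq> topspace P - ends"
  shows "openin A (Inl ` U)"
proof -
  have U: "p \<in> (topspace X - {x0}) \<times> {0<..<1}" if "p \<in> U" for p using that assms(2) by (auto simp: ends_def)
  have 1: "{p \<in> topspace X \<times> {0..1}. kap p \<in> Inl ` U} = U"
    using U by (force simp: cone_proj_def split: if_splits)
  have 2: "{y \<in> topspace Y. Inr y \<in> (Inl ` U :: (('a \<times> real) + 'b) set)} = {}" by auto
  have 3: "Inl ` U \<subseteq> cone_points X x0 Y" using U by (auto simp: cone_points_def)
  show ?thesis unfolding openin_mapping_cone 1 2 using assms(1) 3 by simp
qed

lemma topspace_A_minus_base: "topspace A - base_part = Inl ` (topspace P - ends)"
  by (auto simp: topspace_A base_part_def ends_def)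

lemma closedin_base_part: "closedin A base_part"
proof -
  have "openin A (topspace A - base_part)"
    unfolding topspace_A_minus_base by (rule openin_Inl[OF openin_P_minus_ends order_refl])
  moreover have "base_part \<subseteq> topspace A" unfolding topspace_A by blast
  ultimately show ?thesis unfolding closedin_def by blast
qed

lemma closedin_ends: "closedin P ends"
proof -
  have "ends \<subseteq> topspace P" using x0 by (auto simp: ends_def)
  then show ?thesis using openin_P_minus_ends by (simp add: closedin_def)
qed

lemma openin_nbh: "openin P nbh"
proof -
  have t: "continuous_map P euclideanreal snd" by (rule cm_interval_real[OF cm_snd'])
  have "nbh = {p \<in> topspace P. snd p \<in> {..<1/3}} \<union> {p \<in> topspace P. snd p \<in> {2/3<..}} \<union> {p \<in> topspace P. fst p \<in> V}"
    by (auto simp: nbh_def)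
  moreover have "openin P {p \<in> topspace P. snd p \<in> {..<1/3}}" "openin P {p \<in> topspace P. snd p \<in> {2/3<..}}"
    by (rule openin_continuous_map_preimage[OF t], simp)+
  moreover have "openin P {p \<in> topspace P. fst p \<in> V}" by (rule openin_continuous_map_preimage[OF cm_fst' V(1)])
  ultimately show ?thesis by (simp only: openin_Un)
qed

lemma ends_nbh: "ends \<subseteq> nbh"
  using x0 V by (auto simp: ends_def nbh_def)

lemma kap_base_nbh: "p \<in> topspace P \<Longrightarrow> kap p \<in> base_nbh \<longleftrightarrow> p \<in> nbh"
proof
  assume p: "p \<in> topspace P" "kap p \<in> base_nbh"
  show "p \<in> nbh"
  proof (cases "p \<in> ends")
    case False
    then have e: "kap p = Inl p" using kap_cases(2)[OF p(1)] by simp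
    then obtain q where q: "q \<in> nbh" "kap q = Inl p" using p(2) by (auto simp: base_nbh_def base_part_def)
    then have "q = p" using kap_cases[of q] by (cases "q \<in> ends") (auto simp: nbh_def base_part_def)
    then show ?thesis using q by simp
  qed (use ends_nbh in auto)
qed (auto simp: base_nbh_def)

lemma openin_base_nbh: "openin A base_nbh"
proof -
  have "{p \<in> topspace X \<times> {0..1}. kap p \<in> base_nbh} = nbh"
    using kap_base_nbh by (auto simp: nbh_def)
  moreover have "{y \<in> topspace Y. Inr y \<in> base_nbh} = topspace Y" by (auto simp: base_nbh_def base_part_def)
  moreover have "base_nbh \<subseteq> cone_points X x0 Y"
    using kap_in by (auto simp: base_nbh_def nbh_def topspace_A simp flip: topspace_mapping_cone[OF f y0])
  ultimately show ?thesis unfolding openin_mapping_cone using openin_nbh by simp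
qed

text \<open>The middle third of the interval is stretched over the whole, and \<open>V\<close> is
  contracted to the vertex by \<open>k\<close>. The time given to \<open>k\<close> fades out on the
  last third, because points at height 1 are seen in the cone through \<open>f\<close> and must
  stay; at height 0 everything is glued to \<open>y0\<close> anyway.\<close>

definition "mov s p = (k (s * min 1 (3 * (1 - snd p))) (fst p), (1 - s) * snd p + s * max 0 (min 1 (3 * snd p - 1)))"
  for s :: real

lemma cm_mov: "continuous_map (prod_topology unit_interval P) P (\<lambda>q. mov (fst q) (snd q))"
proof -
  let ?Q = "prod_topology unit_interval P"
  have s: "continuous_map ?Q euclideanreal fst" by (rule cm_interval_real[OF cm_fst'])
  have t: "continuous_map ?Q euclideanreal (\<lambda>q. snd (snd q))" by (rule cm_interval_real[OF cm_snd[OF cm_snd']])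
  have "continuous_map ?Q unit_interval (\<lambda>q. fst q * min 1 (3 * (1 - snd (snd q))))"
    by (auto simp: cm_interval intro!: continuous_intros s t mult_le_one)
  then have "continuous_map ?Q (prod_topology X unit_interval) (\<lambda>q. (fst (snd q), fst q * min 1 (3 * (1 - snd (snd q)))))"
    by (intro continuous_map_pairedI cm_fst[OF cm_snd'])
  from cm_comp[OF k this] have "continuous_map ?Q X (\<lambda>q. k (fst q * min 1 (3 * (1 - snd (snd q)))) (fst (snd q)))" by simp
  moreover have "continuous_map ?Q unit_interval (\<lambda>q. (1 - fst q) * snd (snd q) + fst q * max 0 (min 1 (3 * snd (snd q) - 1)))"
    unfolding cm_interval
  proof (intro conjI ballI)
    fix q assume "q \<in> topspace ?Q"
    then have "fst q \<in> {0..1}" "snd (snd q) \<in> {0..1}" by auto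
    then show "0 \<le> (1 - fst q) * snd (snd q) + fst q * max 0 (min 1 (3 * snd (snd q) - 1))"
      "(1 - fst q) * snd (snd q) + fst q * max 0 (min 1 (3 * snd (snd q) - 1)) \<le> 1"
      using convex_bound_le[of "snd (snd q)" 1 "max 0 (min 1 (3 * snd (snd q) - 1))" "1 - fst q" "fst q"] by auto
  qed (intro continuous_intros s t)
  ultimately show ?thesis unfolding mov_def by (intro continuous_map_pairedI)
qed

lemma mov_in: "s \<in> {0..1} \<Longrightarrow> p \<in> topspace P \<Longrightarrow> mov s p \<in> topspace P"
  using continuous_map_image_subset_topspace[OF cm_mov] by fastforce

lemma mov_ends:
  assumes s: "s \<in> {0..1}" and p: "p \<in> ends"
  shows "mov s p \<in> ends" "kap (mov s p) = kap p"
proof -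
  obtain x t where xt: "p = (x, t)" by fastforce
  have pP: "mov s p \<in> topspace P" using mov_in[OF s] p ends_nbh by (auto simp: nbh_def)
  consider "x = x0" "t \<in> {0..1}" | "t = 0" | "t = 1" "x \<in> topspace X" using p xt by (auto simp: ends_def)
  then have "mov s p \<in> ends \<and> kap (mov s p) = kap p"
  proof cases
    case 1
    have "s * min 1 (3 * (1 - t)) \<in> {0..1}" using s 1 by (auto intro: mult_le_one)
    then have "fst (mov s p) = x0" using 1 xt kx0 by (simp add: mov_def)
    then show ?thesis using pP 1 xt by (cases "mov s p") (auto simp: ends_def cone_proj_def)
  next
    case 2
    then have "snd (mov s p) = 0" using xt by (simp add: mov_def)
    then show ?thesis using pP 2 xt by (cases "mov s p") (auto simp: ends_def cone_proj_def)
  next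
    case 3
    then have "mov s p = p" using xt k0 by (simp add: mov_def)
    then show ?thesis using p by simp
  qed
  then show "mov s p \<in> ends" "kap (mov s p) = kap p" by auto
qed

lemma mov_0: "p \<in> topspace P \<Longrightarrow> mov 0 p = p"
  using k0 by (auto simp: mov_def)

lemma mov_1: 
  assumes "p \<in> nbh"
  shows "mov 1 p \<in> ends"
proof -
  obtain x t where xt: "p = (x, t)" by fastforce
  have p: "mov 1 p \<in> topspace P" using assms mov_in[of 1 p] by (simp add: nbh_def)
  have t: "t \<in> {0..1}" using assms xt by (auto simp: nbh_def)
  have "snd (mov 1 p) = 0 \<or> snd (mov 1 p) = 1 \<or> fst (mov 1 p) = x0"
  proof (cases "t < 1/3 \<or> 2/3 < t")
    case False
    then have "x \<in> V" using assms xt by (auto simp: nbh_def)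
    then show ?thesis using False by (simp add: mov_def xt k1)
  qed (auto simp: mov_def xt)
  then show ?thesis using p by (cases "mov 1 p") (auto simp: ends_def)
qed

definition "mova s a = (case a of Inl p \<Rightarrow> kap (mov s p) | Inr y \<Rightarrow> Inr y)" for s

lemma mova_kap:
  assumes "s \<in> {0..1}" "p \<in> topspace P"
  shows "mova s (kap p) = kap (mov s p)"
proof (cases "p \<in> ends")
  case True
  then show ?thesis using kap_cases(1)[OF assms(2)] mov_ends(2)[OF assms(1) True] by (auto simp: mova_def base_part_def)
qed (use kap_cases(2)[OF assms(2)] in \<open>auto simp: mova_def\<close>)

text \<open>The homotopy is regarded as a map from the cone to a space of paths, to which the
  quotient topology of the cone applies directly; evaluation then gives the map on the
  product.\<close>

lemma cm_mova: "continuous_map (prod_topology unit_interval A) A (\<lambda>q. mova (fst q) (snd q))"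
proof -
  let ?S = "{g. continuous_map unit_interval A g}"
  let ?M = "cotop unit_interval A ?S"
  have "continuous_map A ?M (\<lambda>a s. mova s a)"
  proof (rule cm_from_cone)
    let ?R = "prod_topology P unit_interval"
    have "continuous_map ?R (prod_topology unit_interval P) (\<lambda>z. (snd z, fst z))"
      by (intro continuous_map_pairedI cm_fst' cm_snd')
    from cm_comp[OF cm_kap cm_comp[OF cm_mov this]]
    have "continuous_map ?R A (\<lambda>z. kap (mov (snd z) (fst z)))" by simp
    then have c: "continuous_map ?R A (\<lambda>z. mova (snd z) (kap (fst z)))"
      by (rule continuous_map_eq) (auto simp: mova_kap)
    show "continuous_map P ?M (\<lambda>p s. mova s (kap p))"
    proof (rule cm_into_cotop[OF _ c])
      fix p assume p: "p \<in> topspace P"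
      have "continuous_map unit_interval ?R (\<lambda>s. (p, s))" by (intro continuous_map_pairedI cm_id cm_const p)
      from cm_comp[OF c this] show "(\<lambda>s. mova s (kap p)) \<in> ?S" by simp
    qed
    have i: "continuous_map Y A Inr" by (rule continuous_map_cone_inclusion[OF f y0])
    show "continuous_map Y ?M (\<lambda>y s. mova s (Inr y))"
    proof (rule cm_into_cotop)
      show "continuous_map (prod_topology Y unit_interval) A (\<lambda>z. mova (snd z) (Inr (fst z)))"
        using cm_comp[OF i cm_fst'] by (simp add: mova_def)
      show "(\<lambda>s. mova s (Inr y)) \<in> ?S" if "y \<in> topspace Y" for y
        using that by (simp add: mova_def topspace_A base_part_def)
    qed
  qed
  from cm_eval[OF compact_unit_interval Hausdorff_unit_interval _ cm_comp[OF this cm_snd'] cm_fst']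
  show ?thesis by simp
qed

lemma mova_0:
  assumes "a \<in> topspace A"
  shows "mova 0 a = a"
proof -
  consider p where "a = Inl p" "p \<in> (topspace X - {x0}) \<times> {0<..<1}" | "a \<in> base_part"
    using assms by (auto simp: topspace_A)
  then show ?thesis
  proof cases
    case 1
    then have "p \<in> topspace P" by auto
    then show ?thesis using 1 kap_Inl' by (simp add: mova_def mov_0)
  qed (auto simp: mova_def base_part_def)
qed

lemma mova_base: "a \<in> base_part \<Longrightarrow> mova s a = a"
  by (auto simp: mova_def base_part_def)

lemma mova_1: "a \<in> base_nbh \<Longrightarrow> mova 1 a \<in> base_part"
proof -
  assume "a \<in> base_nbh"
  then consider "a \<in> base_part" | p where "p \<in> nbh" "a = kap p" by (auto simp: base_nbh_def)
  then show ?thesis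
  proof cases
    case 2
    then have "p \<in> topspace P" by (simp add: nbh_def)
    then show ?thesis
      using 2 mova_kap[of 1 p] mov_1[OF 2(1)] kap_cases(1)[OF mov_in[of 1 p]] by simp
  qed (simp add: mova_base)
qed

lemma cm_mov_1: "continuous_map P P (mov 1)"
proof -
  have "continuous_map P (prod_topology unit_interval P) (\<lambda>p. (1, p))"
    by (intro continuous_map_pairedI cm_id cm_const) simp
  from cm_comp[OF cm_mov this] show ?thesis by simp
qed

lemma cm_mova_1: "continuous_map A A (mova 1)"
proof -
  have "continuous_map A (prod_topology unit_interval A) (\<lambda>p. (1, p))"
    by (intro continuous_map_pairedI cm_id cm_const) simp
  from cm_comp[OF cm_mova this] show ?thesis by simp
qed

lemma base_part_sub: "base_part \<subseteq> base_nbh" "base_nbh \<subseteq> topspace A" "base_part \<subseteq> topspace A"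
  using openin_subset[OF openin_base_nbh] by (auto simp: base_nbh_def topspace_A)

lemma ends_sub: "nbh \<subseteq> topspace P" "ends \<subseteq> topspace P"
  using ends_nbh by (auto simp: nbh_def)

text \<open>Excising \<open>ends\<close> from the cylinder and \<open>base_part\<close> from the
  cone leaves two pairs that \<open>kap\<close> identifies homeomorphically.\<close>

lemma kap_nbh_iso: "hom_induced i P nbh A base_nbh kap \<in> iso (relative_homology_group i P nbh) (relative_homology_group i A base_nbh)"
proof -
  let ?PE = "subtopology P (topspace P - ends)" and ?AE = "subtopology A (topspace A - base_part)"
  let ?n = "nbh - ends" and ?b = "base_nbh - base_part"
  have 1: "hom_induced i ?PE ?n P nbh id \<in> iso (relative_homology_group i ?PE ?n) (relative_homology_group i P nbh)"
    using homology_excision_axiom[of P ends nbh "topspace P" i] closedin_ends ends_nbh openin_nbh ends_sub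
    by (simp add: closure_of_closedin interior_of_openin subtopology_topspace del: topspace_prod_topology)
  have 2: "hom_induced i ?AE ?b A base_nbh id \<in> iso (relative_homology_group i ?AE ?b) (relative_homology_group i A base_nbh)"
    using homology_excision_axiom[of A base_part base_nbh "topspace A" i] closedin_base_part base_part_sub openin_base_nbh
    by (simp add: closure_of_closedin interior_of_openin subtopology_topspace)
  have tPE: "topspace ?PE = topspace P - ends" by auto
  have tAE: "topspace ?AE = Inl ` (topspace P - ends)" unfolding topspace_A_minus_base[symmetric] by auto
  have Inl: "kap p = Inl p" if "p \<in> topspace P - ends" for p using kap_cases(2)[of p] that by simp
  have img: "kap ` (topspace P - ends) = topspace A - base_part"
    unfolding topspace_A_minus_base using Inl by (intro image_cong) auto
  have hom: "homeomorphic_map ?PE ?AE kap"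
  proof (rule bijective_open_imp_homeomorphic_map)
    show "continuous_map ?PE ?AE kap"
      by (rule continuous_map_into_subtopology[OF cm_sub[OF cm_kap]]) (use img tPE in auto)
    show "open_map ?PE ?AE kap"
      unfolding open_map_def
    proof (intro allI impI)
      fix U assume "openin ?PE U"
      then have U: "openin P U" "U \<subseteq> topspace P - ends"
        using openin_P_minus_ends by (simp_all add: openin_open_subtopology)
      have e: "kap ` U = Inl ` U" using U(2) Inl by (intro image_cong) auto
      have "openin A (topspace A - base_part)" using closedin_base_part by (simp add: closedin_def)
      then show "openin ?AE (kap ` U)"
        using openin_Inl[OF U] U(2) unfolding e by (auto simp: openin_open_subtopology topspace_A_minus_base)
    qed
    show "kap ` topspace ?PE = topspace ?AE" using img tPE tAE topspace_A_minus_base by simp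
    show "inj_on kap (topspace ?PE)" unfolding tPE using Inl by (auto simp: inj_on_def)
  qed
  have nb: "?n \<subseteq> topspace P - ends" using ends_sub by auto
  have "kap ` ?n = ?b"
  proof
    show "kap ` ?n \<subseteq> ?b" using nb Inl by (auto simp: base_nbh_def base_part_def)
    show "?b \<subseteq> kap ` ?n"
    proof
      fix a assume a: "a \<in> ?b"
      then obtain p where p: "p \<in> nbh" "a = kap p" by (auto simp: base_nbh_def)
      then have "p \<notin> ends" using a kap_cases(1)[of p] ends_sub by auto
      then show "a \<in> kap ` ?n" using p by blast
    qed
  qed
  then have 3: "hom_induced i ?PE ?n ?AE ?b kap \<in> iso (relative_homology_group i ?PE ?n) (relative_homology_group i ?AE ?b)"
    using nb tPE by (intro homeomorphic_map_relative_homology_iso[OF hom]) auto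
  have kn: "kap \<in> nbh \<rightarrow> base_nbh" by (auto simp: base_nbh_def)
  have "hom_induced i P nbh A base_nbh kap \<circ> hom_induced i ?PE ?n P nbh id = hom_induced i ?PE ?n A base_nbh kap"
    using hom_induced_compose[of ?PE P id ?n nbh A kap base_nbh i] cm_kap kn by (simp add: continuous_map_from_subtopology)
  also have "\<dots> = hom_induced i ?AE ?b A base_nbh id \<circ> hom_induced i ?PE ?n ?AE ?b kap"
    using hom_induced_compose[of ?PE ?AE kap ?n ?b A id base_nbh i] \<open>kap ` ?n = ?b\<close> homeomorphic_imp_continuous_map[OF hom]
    by (force simp: continuous_map_from_subtopology)
  finally have comm: "hom_induced i P nbh A base_nbh kap \<circ> hom_induced i ?PE ?n P nbh id =
    hom_induced i ?AE ?b A base_nbh id \<circ> hom_induced i ?PE ?n ?AE ?b kap" .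
  let ?H = "hom_induced i P nbh A base_nbh kap" and ?e = "hom_induced i ?PE ?n P nbh id"
  let ?g = "hom_induced i ?AE ?b A base_nbh id \<circ> hom_induced i ?PE ?n ?AE ?b kap"
  have e: "bij_betw ?e (carrier (relative_homology_group i ?PE ?n)) (carrier (relative_homology_group i P nbh))"
    using 1 by (simp add: iso_def)
  have "bij_betw ?g (carrier (relative_homology_group i ?PE ?n)) (carrier (relative_homology_group i A base_nbh))"
    using 2 3 by (auto simp: iso_def intro: bij_betw_trans)
  then have "bij_betw ?H (carrier (relative_homology_group i P nbh)) (carrier (relative_homology_group i A base_nbh))"
    unfolding comm[symmetric] using bij_betw_comp_iff[OF e] by blast
  then show ?thesis by (simp add: iso_def hom_induced_hom)
qed

text \<open>The map for \<open>ends\<close> is a retract of the isomorphism for the neighbourhoods: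
  the inclusions have left inverses induced by \<open>mov 1\<close> and \<open>mova 1\<close>, and
  these commute with \<open>kap\<close>. A retract of an isomorphism is an isomorphism.\<close>

proposition kap_iso: "hom_induced i P ends A base_part kap \<in> iso (relative_homology_group i P ends) (relative_homology_group i A base_part)"
proof -
  let ?a = "hom_induced i A base_part A base_nbh id" and ?m = "hom_induced i A base_nbh A base_part (mova 1)"
  let ?a' = "hom_induced i P ends P nbh id" and ?m' = "hom_induced i P nbh P ends (mov 1)"
  let ?K = "hom_induced i P ends A base_part kap" and ?W = "hom_induced i P nbh A base_nbh kap"
  have kap: "kap \<in> ends \<rightarrow> base_part" "kap \<in> nbh \<rightarrow> base_nbh"
    using kap_cases(1) ends_sub by (auto simp: base_nbh_def)
  have mv: "mova 1 \<in> base_nbh \<rightarrow> base_part" "mov 1 \<in> nbh \<rightarrow> ends" using mova_1 mov_1 by auto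
  have sub: "id \<in> base_part \<rightarrow> base_nbh" "id \<in> ends \<rightarrow> nbh" using base_part_sub ends_nbh by auto
  have hA: "homotopic_with (\<lambda>h. h \<in> base_part \<rightarrow> base_part) A A id (mova 1)"
    by (rule homotopic_relI[OF cm_mova]) (use mova_0 mova_base base_part_sub in auto)
  have hP: "homotopic_with (\<lambda>h. h \<in> ends \<rightarrow> ends) P P id (mov 1)"
    by (rule homotopic_relI[OF cm_mov]) (use mov_0 mov_ends(1) ends_sub in auto)
  have ma: "?m (?a y) = y" if "y \<in> carrier (relative_homology_group i A base_part)" for y
  proof -
    have "?m (?a y) = hom_induced i A base_part A base_part (mova 1) y"
      using hom_induced_compose'[of A A id base_part base_nbh A "mova 1" base_part i y] sub mv cm_mova_1 by simp
    also have "\<dots> = y" using homology_homotopy_axiom[OF hA, of i] hom_induced_id[OF that] by simp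
    finally show ?thesis .
  qed
  have ma': "?m' (?a' y) = y" if "y \<in> carrier (relative_homology_group i P ends)" for y
  proof -
    have "?m' (?a' y) = hom_induced i P ends P ends (mov 1) y"
      using hom_induced_compose'[of P P id ends nbh P "mov 1" ends i y] sub mv cm_mov_1 by simp
    also have "\<dots> = y" using homology_homotopy_axiom[OF hP, of i] hom_induced_id[OF that] by simp
    finally show ?thesis .
  qed
  have sq1: "?W (?a' y) = ?a (?K y)" for y
    using hom_induced_compose'[of P P id ends nbh A kap base_nbh i y] hom_induced_compose'[of P A kap ends base_part A id base_nbh i y]
      sub kap cm_kap by simp
  have sq2: "?K (?m' y) = ?m (?W y)" for y
  proof -
    have "?K (?m' y) = hom_induced i P nbh A base_part (kap \<circ> mov 1) y"
      using hom_induced_compose'[of P P "mov 1" nbh ends A kap base_part i y] mv kap cm_kap cm_mov_1 by simp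
    also have "hom_induced i P nbh A base_part (kap \<circ> mov 1) = hom_induced i P nbh A base_part (mova 1 \<circ> kap)"
      by (rule hom_induced_eq) (simp add: mova_kap)
    also have "\<dots> y = ?m (?W y)"
      using hom_induced_compose'[of P A kap nbh base_nbh A "mova 1" base_part i y] mv kap cm_kap cm_mova_1 by simp
    finally show ?thesis .
  qed
  have W: "inj_on ?W (carrier (relative_homology_group i P nbh))"
      "?W ` carrier (relative_homology_group i P nbh) = carrier (relative_homology_group i A base_nbh)"
    using kap_nbh_iso[of i] by (auto simp: iso_def bij_betw_def)
  have "inj_on ?K (carrier (relative_homology_group i P ends))"
  proof (rule inj_onI)
    fix y z assume yz: "y \<in> carrier (relative_homology_group i P ends)" "z \<in> carrier (relative_homology_group i P ends)" "?K y = ?K z"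
    then have "?W (?a' y) = ?W (?a' z)" by (simp add: sq1)
    then have "?a' y = ?a' z" using inj_onD[OF W(1)] hom_induced_carrier by blast
    then show "y = z" using ma' yz by metis
  qed
  moreover have "?K ` carrier (relative_homology_group i P ends) = carrier (relative_homology_group i A base_part)"
  proof
    show "?K ` carrier (relative_homology_group i P ends) \<subseteq> carrier (relative_homology_group i A base_part)"
      using hom_induced_carrier by blast
    show "carrier (relative_homology_group i A base_part) \<subseteq> ?K ` carrier (relative_homology_group i P ends)"
    proof
      fix y assume y: "y \<in> carrier (relative_homology_group i A base_part)"
      have "?a y \<in> ?W ` carrier (relative_homology_group i P nbh)" unfolding W(2) by (rule hom_induced_carrier)
      then obtain z where z: "z \<in> carrier (relative_homology_group i P nbh)" "?a y = ?W z" by blast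
      have "y = ?K (?m' z)" using ma[OF y] z(2) sq2 by simp
      then show "y \<in> ?K ` carrier (relative_homology_group i P ends)"
        using hom_induced_carrier by blast
    qed
  qed
  ultimately show ?thesis by (simp add: iso_def bij_betw_def hom_induced_hom)
qed

end

end

section \<open>The cylinder relative to its ends\<close>

context
  fixes X :: "'a topology" and x0 :: 'a
  assumes x0: "x0 \<in> topspace X"
begin

abbreviation (input) "cylX \<equiv> prod_topology X unit_interval"

definition "bottom_end = topspace X \<times> {0::real} \<union> {x0} \<times> {0..1}"
text \<open>Half of the interval above \<open>x0\<close> is kept: what is excised from
  \<open>ends\<close> is then the closed set at height at most 1/2, which lies in the part of
  \<open>ends\<close> below height 1, an open subset contained in \<open>bottom_end\<close>.\<close>

definition "top_end = topspace X \<times> {1::real} \<union> {x0} \<times> {1/2<..1}"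

lemma bottom_ends: "bottom_end \<subseteq> ends X x0"
  by (auto simp: bottom_end_def ends_def)

lemma trivial_cylinder_bottom: "trivial_group (relative_homology_group i cylX bottom_end)"
proof (rule trivial_relative_homology_group_gen)
  let ?B = "subtopology cylX bottom_end"
  have t: "continuous_map (prod_topology unit_interval cylX) euclideanreal (\<lambda>q. snd (snd q))"
    by (rule cm_interval_real[OF cm_snd[OF cm_snd']])
  have s: "continuous_map (prod_topology unit_interval cylX) euclideanreal fst" by (rule cm_interval_real[OF cm_fst'])
  have c: "continuous_map (prod_topology unit_interval cylX) cylX (\<lambda>q. (fst (snd q), fst q * snd (snd q)))"
    by (intro continuous_map_pairedI cm_fst[OF cm_snd'])
       (auto simp: cm_interval intro!: continuous_intros s t mult_le_one)
  have f: "continuous_map cylX cylX (\<lambda>p. (fst p, 0))"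
    by (intro continuous_map_pairedI cm_fst' cm_const) simp
  show "continuous_map cylX ?B (\<lambda>p. (fst p, 0))"
    using f by (auto simp: continuous_map_in_subtopology bottom_end_def)
  have "homotopic_with (\<lambda>_. True) cylX cylX (\<lambda>p. (fst p, 0)) id"
    by (rule homotopicI[OF c]) auto
  then show "homotopic_with (\<lambda>_. True) cylX cylX (\<lambda>p. (fst p, 0)) id" .
  show "homotopic_with (\<lambda>_. True) ?B ?B (\<lambda>p. (fst p, 0)) id"
  proof (rule homotopicI)
    have "continuous_map (prod_topology unit_interval ?B) (prod_topology unit_interval cylX) (\<lambda>q. (fst q, snd q))"
      by (intro continuous_map_pairedI cm_fst') (use cm_snd'[of unit_interval ?B] in \<open>simp add: continuous_map_in_subtopology\<close>)
    from cm_comp[OF c this]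
    show "continuous_map (prod_topology unit_interval ?B) ?B (\<lambda>q. (fst (snd q), fst q * snd (snd q)))"
      by (auto simp: continuous_map_in_subtopology bottom_end_def intro: mult_le_one)
  qed auto
qed

text \<open>The exact sequence of the triple, in which the cylinder relative to
  \<open>bottom_end\<close> is trivial because it shrinks onto its bottom.\<close>

lemma iso_relboundary_ends:
  "hom_relboundary i cylX (ends X x0) bottom_end
    \<in> iso (relative_homology_group i cylX (ends X x0)) (relative_homology_group (i - 1) (subtopology cylX (ends X x0)) bottom_end)"
proof (rule very_short_exact_sequence)
  show "exact_seq
         ([relative_homology_group (i - 1) cylX bottom_end, relative_homology_group (i - 1) (subtopology cylX (ends X x0)) bottom_end,
           relative_homology_group i cylX (ends X x0), relative_homology_group i cylX bottom_end],
          [hom_induced (i - 1) (subtopology cylX (ends X x0)) bottom_end cylX bottom_end id, hom_relboundary i cylX (ends X x0) bottom_end,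
           hom_induced i cylX bottom_end cylX (ends X x0) id])"
    using homology_exactness_triple_1[OF bottom_ends] homology_exactness_triple_2[OF bottom_ends] by simp
qed (rule trivial_cylinder_bottom)+

lemma iso_excision_ends:
  "hom_induced i (subtopology cylX top_end) (bottom_end \<inter> top_end) (subtopology cylX (ends X x0)) bottom_end id
    \<in> iso (relative_homology_group i (subtopology cylX top_end) (bottom_end \<inter> top_end))
        (relative_homology_group i (subtopology cylX (ends X x0)) bottom_end)"
proof -
  let ?E = "subtopology cylX (ends X x0)"
  let ?Z = "{p \<in> topspace ?E. snd p \<in> {..1/2}}"
  have t: "continuous_map ?E euclideanreal snd"
    by (rule cm_sub[OF cm_interval_real[OF cm_snd']])
  have cl: "?E closure_of ?Z = ?Z"
    by (rule closure_of_closedin, rule closedin_continuous_map_preimage[OF t]) simp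
  have op: "openin ?E {p \<in> topspace ?E. snd p \<in> {..<1}}"
    by (rule openin_continuous_map_preimage[OF t]) simp
  have "?Z \<subseteq> ?E interior_of bottom_end"
    by (rule order_trans[OF _ interior_of_maximal[OF _ op]]) (auto simp: ends_def bottom_end_def)
  then have "?E closure_of ?Z \<subseteq> ?E interior_of bottom_end" unfolding cl .
  from homology_excision_axiom[OF this bottom_ends, of i]
  have e: "hom_induced i (subtopology ?E (ends X x0 - ?Z)) (bottom_end - ?Z) (subtopology ?E (ends X x0)) bottom_end id
    \<in> iso (relative_homology_group i (subtopology ?E (ends X x0 - ?Z)) (bottom_end - ?Z))
          (relative_homology_group i (subtopology ?E (ends X x0)) bottom_end)" .
  have "ends X x0 - ?Z = top_end" "bottom_end - ?Z = bottom_end \<inter> top_end" "ends X x0 \<inter> top_end = top_end"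
    using x0 by (auto simp: ends_def top_end_def bottom_end_def)
  then show ?thesis using e by (simp add: subtopology_subtopology)
qed

lemma iso_top_end:
  "hom_induced i X {x0} (subtopology cylX top_end) (bottom_end \<inter> top_end) (\<lambda>x. (x, 1))
    \<in> iso (relative_homology_group i X {x0}) (relative_homology_group i (subtopology cylX top_end) (bottom_end \<inter> top_end))"
proof (rule homotopy_equivalence_relative_homology_group_isomorphism)
  let ?W = "subtopology cylX top_end"
  have "continuous_map X cylX (\<lambda>x. (x, 1))" by (intro continuous_map_pairedI cm_id cm_const) simp
  then show "continuous_map X ?W (\<lambda>x. (x, 1))" by (auto simp: continuous_map_in_subtopology top_end_def)
  show "continuous_map ?W X fst" by (rule cm_sub[OF cm_fst'])
  show "(\<lambda>x. (x, 1)) \<in> {x0} \<rightarrow> bottom_end \<inter> top_end" "fst \<in> bottom_end \<inter> top_end \<rightarrow> {x0}"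
    by (auto simp: bottom_end_def top_end_def)
  show "homotopic_with (\<lambda>h. h \<in> {x0} \<rightarrow> {x0}) X X (fst \<circ> (\<lambda>x. (x, 1))) id"
    by (rule homotopic_with_equal) (auto simp: o_def)
  show "homotopic_with (\<lambda>k. k \<in> bottom_end \<inter> top_end \<rightarrow> bottom_end \<inter> top_end) ?W ?W ((\<lambda>x. (x, 1)) \<circ> fst) id"
  proof (rule homotopic_relI)
    let ?h = "\<lambda>q. (fst (snd q), (1 - fst q) + fst q * snd (snd q))"
    have in_unit: "0 \<le> (1 - s) + s * t" "(1 - s) + s * t \<le> 1" if "s \<in> {0..1}" "t \<in> {0..1}" for s t :: real
      using that mult_left_mono[of t 1 s] by auto
    have half: "1/2 < (1 - s) + s * t" if "s \<in> {0..1}" "1/2 < t" for s t :: real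
    proof (cases "s = 1")
      case False
      have "s * (1/2) \<le> s * t" using that by (intro mult_left_mono) auto
      then show ?thesis using that False by auto
    qed (use that in auto)
    have t: "continuous_map (prod_topology unit_interval cylX) euclideanreal (\<lambda>q. snd (snd q))"
      by (rule cm_interval_real[OF cm_snd[OF cm_snd']])
    have s: "continuous_map (prod_topology unit_interval cylX) euclideanreal fst" by (rule cm_interval_real[OF cm_fst'])
    have c: "continuous_map (prod_topology unit_interval cylX) cylX ?h"
    proof (intro continuous_map_pairedI cm_fst[OF cm_snd'])
      show "continuous_map (prod_topology unit_interval cylX) unit_interval (\<lambda>q. (1 - fst q) + fst q * snd (snd q))"
        unfolding cm_interval using in_unit by (auto intro!: continuous_intros s t)
    qed
    have "continuous_map (prod_topology unit_interval ?W) (prod_topology unit_interval cylX) (\<lambda>q. (fst q, snd q))"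
      by (intro continuous_map_pairedI cm_fst') (use cm_snd'[of unit_interval ?W] in \<open>simp add: continuous_map_in_subtopology\<close>)
    from cm_comp[OF c this] have c': "continuous_map (prod_topology unit_interval ?W) cylX ?h" by simp
    have te: "?h (s, w) \<in> top_end" if "s \<in> {0..1}" "w \<in> top_end" for s w
      using that half[of s "snd w"] in_unit[of s "snd w"] by (cases w) (auto simp: top_end_def)
    then have "?h \<in> topspace (prod_topology unit_interval ?W) \<rightarrow> top_end" by auto
    then show "continuous_map (prod_topology unit_interval ?W) ?W ?h"
      using c' by (simp add: continuous_map_in_subtopology)
    show "?h (0, w) = ((\<lambda>x. (x, 1)) \<circ> fst) w" "?h (1, w) = id w" if "w \<in> topspace ?W" for w
      by simp_all
    show "?h (s, w) \<in> bottom_end \<inter> top_end" if "s \<in> {0..1}" "w \<in> topspace ?W" "w \<in> bottom_end \<inter> top_end" for s w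
      using that te[of s w] in_unit[of s "snd w"] by (cases w) (auto simp: bottom_end_def top_end_def)
    show "bottom_end \<inter> top_end \<subseteq> topspace ?W" using x0 by (auto simp: bottom_end_def)
  qed
qed

text \<open>The three isomorphisms compose to a suspension isomorphism, which lowers the degree by
  one.\<close>

lemma tors_group_ends:
  "tors_group (relative_homology_group i cylX (ends X x0)) \<longleftrightarrow> tors_group (relative_homology_group (i - 1) X {x0})"
  using tors_group_iso[OF _ _ iso_relboundary_ends[of i]] tors_group_iso[OF _ _ iso_excision_ends[of "i - 1"]]
    tors_group_iso[OF _ _ iso_top_end[of "i - 1"]] by simp

lemma retract_point: "{x0} retract_of_space X"
  unfolding retract_of_space_def using x0
  by (intro conjI exI[of _ "\<lambda>_. x0"]) (auto simp: continuous_map_in_subtopology)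

lemma tors_group_pointed: "i \<noteq> 0 \<Longrightarrow> tors_group (relative_homology_group i X {x0}) \<longleftrightarrow> tors_group (homology_group i X)"
proof -
  assume i: "i \<noteq> 0"
  have t: "trivial_group (homology_group i (subtopology X {x0}))"
    by (rule homology_dimension_axiom[OF _ i]) (use x0 in auto)
  have "hom_induced i X {} X {x0} id \<in> iso (homology_group i X) (relative_homology_group i X {x0})"
    unfolding iso_def bij_betw_def
    using inj_on_relativization[OF t] epi_hom_induced_relativization[of "{x0}" X i] retract_point by (simp add: hom_induced_hom)
  then show ?thesis using tors_group_iso by (metis group_relative_homology_group)
qed

end

section \<open>The long exact sequence of the cone\<close>

context
  fixes X :: "'a topology" and x0 :: 'a and Y :: "'b topology" and y0 :: 'b and f :: "'a \<Rightarrow> 'b"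
  assumes f: "continuous_map X Y f" and fx0: "f x0 = y0"
    and CW: "pointed_CW_complex X x0" and x0: "x0 \<in> topspace X"
begin

abbreviation (input) "coneXY \<equiv> mapping_cone X x0 Y y0 f"

lemma homeomorphic_base_part: "homeomorphic_map Y (subtopology coneXY (base_part Y)) Inr"
proof (rule bijective_closed_imp_homeomorphic_map)
  have y0: "y0 \<in> topspace Y" using continuous_map_image_subset_topspace[OF f] x0 fx0 by blast
  obtain XH: "Hausdorff_space X" by (rule CW_vertex_nondegenerate[OF CW])
  have tA: "topspace coneXY = cone_points X x0 Y" by (rule topspace_mapping_cone[OF f y0])
  have i: "continuous_map Y coneXY Inr" by (rule continuous_map_cone_inclusion[OF f y0])
  then show "continuous_map Y (subtopology coneXY (base_part Y)) Inr"
    by (auto simp: continuous_map_in_subtopology base_part_def)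
  show "Inr ` topspace Y = topspace (subtopology coneXY (base_part Y))" "inj_on Inr (topspace Y)"
    unfolding topspace_subtopology tA by (auto simp: base_part_def cone_points_def)
  show "closed_map Y (subtopology coneXY (base_part Y)) Inr"
    unfolding closed_map_def
  proof (intro allI impI)
    fix C assume C: "closedin Y C"
    let ?P = "prod_topology X unit_interval"
    \<comment> \<open>The preimage of the copy of \<open>C\<close> in the cylinder: a part of the
      top and, if \<open>y0\<close> lies in \<open>C\<close>, also the bottom and the interval above
      \<open>x0\<close>, which collapse to \<open>y0\<close>.\<close>
    let ?M = "{p \<in> topspace ?P. snd p \<in> {1}} \<inter> {p \<in> topspace ?P. f (fst p) \<in> C}"
    let ?N = "if y0 \<in> C then {p \<in> topspace ?P. snd p \<in> {0}} \<union> {p \<in> topspace ?P. fst p \<in> {x0}} else {}"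
    have t: "continuous_map ?P euclideanreal snd" by (rule cm_interval_real[OF cm_snd'])
    have x0c: "closedin X {x0}" using Hausdorff_imp_t1_space[OF XH] x0 by (simp add: t1_space_closedin_singleton)
    have "closedin ?P {p \<in> topspace ?P. snd p \<in> {r}}" for r
      by (rule closedin_continuous_map_preimage[OF t]) simp
    moreover have "closedin ?P {p \<in> topspace ?P. f (fst p) \<in> C}"
      by (rule closedin_continuous_map_preimage[OF cm_comp[OF f cm_fst'] C])
    moreover have "closedin ?P {p \<in> topspace ?P. fst p \<in> {x0}}"
      by (rule closedin_continuous_map_preimage[OF cm_fst' x0c])
    ultimately have "closedin ?P ?M" "closedin ?P ?N"
      by (auto intro!: closedin_Int closedin_Un simp del: topspace_prod_topology insert_iff)
    then have cl: "closedin ?P (?M \<union> ?N)" by (rule closedin_Un)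
    have CY: "C \<subseteq> topspace Y" using C by (rule closedin_subset)
    have "{z \<in> topspace X \<times> {0..1}. cone_proj x0 y0 f z \<in> topspace coneXY - Inr ` C} = topspace ?P - (?M \<union> ?N)" (is "?L = ?R")
    proof (intro Set.set_eqI iffI)
      fix z assume "z \<in> ?L"
      then show "z \<in> ?R" using fx0 by (cases z) (auto simp: cone_proj_def split: if_splits)
    next
      fix z assume z: "z \<in> ?R"
      then have "f (fst z) \<in> topspace Y" using continuous_map_image_subset_topspace[OF f] by auto
      then show "z \<in> ?L" using z y0 unfolding tA
        by (cases z) (auto simp: cone_proj_def cone_points_def split: if_splits)
    qed
    moreover have "{y \<in> topspace Y. Inr y \<in> topspace coneXY - Inr ` C} = topspace Y - C"
      unfolding tA by (auto simp: cone_points_def)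
    ultimately have "openin coneXY (topspace coneXY - Inr ` C)"
      unfolding openin_mapping_cone[of _ _ _ _ _ "topspace coneXY - Inr ` C"] using cl C tA
      by (simp add: openin_diff del: topspace_prod_topology)
    moreover have "Inr ` C \<subseteq> topspace coneXY" unfolding tA using CY by (auto simp: cone_points_def)
    ultimately have "closedin coneXY (Inr ` C)" by (simp add: closedin_def)
    then show "closedin (subtopology coneXY (base_part Y)) (Inr ` C)"
      by (rule closedin_subset_topspace) (use CY in \<open>auto simp: base_part_def\<close>)
  qed
qed

lemma trivial_base_part:
  "trivial_group (homology_group i Y) \<Longrightarrow> trivial_group (homology_group i (subtopology coneXY (base_part Y)))"
  using homeomorphic_map_homology_iso[OF homeomorphic_base_part, of i]
  by (metis is_isoI isomorphic_group_triviality group_relative_homology_group)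

lemma tors_group_cone_base:
  "tors_group (relative_homology_group i coneXY (base_part Y)) \<longleftrightarrow> tors_group (relative_homology_group (i - 1) X {x0})"
proof -
  obtain k :: "real \<Rightarrow> 'a \<Rightarrow> 'a" and V where k: "continuous_map (prod_topology X unit_interval) X (\<lambda>p. k (snd p) (fst p))"
    "\<And>x. x \<in> topspace X \<Longrightarrow> k 0 x = x" "\<And>s. s \<in> {0..1} \<Longrightarrow> k s x0 = x0"
    "openin X V" "x0 \<in> V" "\<And>x. x \<in> V \<Longrightarrow> k 1 x = x0" "Hausdorff_space X"
    by (rule CW_vertex_nondegenerate[OF CW]) blast
  from tors_group_iso[OF _ _ kap_iso[OF f fx0 x0 k(7,1-6)]] show ?thesis
    using tors_group_ends[OF x0] by simp
qed

lemma tors_group_cone: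
  assumes "trivial_group (homology_group i Y)" "trivial_group (homology_group (i - 1) X)" "i \<noteq> 1"
  shows "tors_group (homology_group i coneXY)"
proof -
  have "tors_group (relative_homology_group i coneXY (base_part Y))"
    unfolding tors_group_cone_base using tors_group_pointed[OF x0, of "i - 1"] assms tors_group_trivial by simp
  from tors_group_mono[OF _ _ hom_induced_hom inj_on_relativization[OF trivial_base_part[OF assms(1)]] this]
  show ?thesis by simp
qed

text \<open>As \<open>Y\<close> has no homology one degree lower, the homology of the cone maps onto
  the relative group, which in terms of torsion is the homology of \<open>X\<close> shifted by
  one.\<close>

lemma tors_group_cone_source:
  assumes "trivial_group (homology_group (i - 1) Y)" "tors_group (homology_group i coneXY)" "i \<noteq> 1"
  shows "tors_group (homology_group (i - 1) X)"
proof -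
  from tors_group_epi[OF _ _ hom_induced_hom surj_relativization[OF trivial_base_part[OF assms(1)]] assms(2)]
  have "tors_group (relative_homology_group i coneXY (base_part Y))" by simp
  then show ?thesis unfolding tors_group_cone_base using tors_group_pointed[OF x0, of "i - 1"] assms by simp
qed

end

section \<open>Torsion of cycles and of groups, and the homology of local spheres\<close>

lemma torsion_homology_iff: "torsion_homology j X \<longleftrightarrow> tors_group (homology_group (int j) X)"
proof -
  let ?R = "relcycle_group j X {}" and ?H = "homology_group (int j) X"
  let ?q = "homologous_rel_set j X {}"
  have hom: "?q \<in> hom ?R ?H"
    using normal.r_coset_hom_Mod[OF normal_subgroup_singular_relboundary_relcycle[of j X "{}"]]
    by (simp add: nontrivial_relative_homology_group right_coset_singular_relboundary)
  have powR: "z [^]\<^bsub>?R\<^esub> N = frag_cmul (int N) z" for z and N :: nat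
    by (simp add: relcycle_group_def chain_group_def pow_subgroup_generated)
  have key: "?q z [^]\<^bsub>?H\<^esub> N = \<one>\<^bsub>?H\<^esub> \<longleftrightarrow> singular_relboundary j X {} (frag_cmul (int N) z)"
    if z: "singular_relcycle j X {} z" for z and N :: nat
  proof -
    have "?q z [^]\<^bsub>?H\<^esub> N = ?q (frag_cmul (int N) z)"
      using hom_nat_pow[OF hom _ group_relcycle_group group_relative_homology_group, of z N] z by (simp add: powR)
    then show ?thesis by (simp add: homologous_rel_set_eq_relboundary)
  qed
  have "tors_group ?H \<longleftrightarrow>
      (\<forall>z. singular_relcycle j X {} z \<longrightarrow> (\<exists>N::nat. N > 0 \<and> singular_relboundary j X {} (frag_cmul (int N) z)))"
    unfolding tors_group_def carrier_relative_homology_group using key by auto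
  also have "\<dots> \<longleftrightarrow> torsion_homology j X"
    unfolding torsion_homology_def by (metis of_nat_0_less_iff zero_less_imp_eq_int)
  finally show ?thesis by simp
qed

text \<open>The sphere has no homology in this degree, so every element of the target is killed by a
  number prime to \<open>p\<close>, and in a \<open>p\<close>-local group such an element is
  trivial.\<close>

lemma p_localisation_trivial:
  assumes loc: "p_localisation p (nsphere n) X l" and i: "i > 0" "i \<noteq> int n"
  shows "trivial_group (homology_group i X)"
proof -
  let ?G = "homology_group i (nsphere n)" and ?H = "homology_group i X" and ?h = "hom_induced i (nsphere n) {} X {} l"
  interpret H: group ?H by simp
  have h: "?h \<in> hom ?G ?H" and pl: "p_local_group p ?H"
    and cok: "\<And>h. h \<in> carrier ?H \<Longrightarrow> \<exists>k::nat. coprime k p \<and> h [^]\<^bsub>?H\<^esub> k \<in> ?h ` carrier ?G"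
    using loc i(1) by (auto simp: p_localisation_def p_localisation_hom_def)
  have "trivial_group ?G"
    using reduced_homology_group_nsphere(2)[OF i(2)] i(1) by (simp add: un_reduced_homology_group)
  then have G: "?h ` carrier ?G = {\<one>\<^bsub>?H\<^esub>}"
    using hom_one[OF h] by (simp add: trivial_group_def)
  have "x = \<one>\<^bsub>?H\<^esub>" if x: "x \<in> carrier ?H" for x
  proof -
    obtain k :: nat where k: "coprime k p" "x [^]\<^bsub>?H\<^esub> k = \<one>\<^bsub>?H\<^esub>" using cok[OF x] G by auto
    then have "inj_on (\<lambda>g. g [^]\<^bsub>?H\<^esub> k) (carrier ?H)"
      using pl by (auto simp: p_local_group_def bij_betw_def)
    then show ?thesis using k x H.nat_pow_one by (metis inj_onD H.one_closed)
  qed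
  then show ?thesis using H.one_closed by (auto simp: trivial_group_def)
qed

text \<open>The kernel of the localisation is torsion, so a torsion target would make the homology
  of the sphere torsion, but it is infinite cyclic.\<close>

lemma p_localisation_not_tors:
  assumes p: "prime p" and loc: "p_localisation p (nsphere n) X l" and n: "n > 0"
  shows "\<not> tors_group (homology_group (int n) X)"
proof
  let ?G = "homology_group (int n) (nsphere n)" and ?H = "homology_group (int n) X"
    and ?h = "hom_induced (int n) (nsphere n) {} X {} l"
  interpret G: group ?G by simp
  assume t: "tors_group ?H"
  have h: "?h \<in> hom ?G ?H"
    and ker: "\<And>g. g \<in> carrier ?G \<Longrightarrow> ?h g = \<one>\<^bsub>?H\<^esub> \<Longrightarrow> \<exists>k::nat. coprime k p \<and> g [^]\<^bsub>?G\<^esub> k = \<one>\<^bsub>?G\<^esub>"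
  proof -
    have "p_localisation_hom p ?G ?H ?h" using loc n by (auto simp: p_localisation_def)
    then show "?h \<in> hom ?G ?H"
      and "\<And>g. g \<in> carrier ?G \<Longrightarrow> ?h g = \<one>\<^bsub>?H\<^esub> \<Longrightarrow> \<exists>k::nat. coprime k p \<and> g [^]\<^bsub>?G\<^esub> k = \<one>\<^bsub>?G\<^esub>"
      unfolding p_localisation_hom_def by blast+
  qed
  have "tors_group ?G" unfolding tors_group_def
  proof
    fix g assume g: "g \<in> carrier ?G"
    then have "?h g \<in> carrier ?H" by (rule hom_carrier[OF h, THEN subsetD, OF imageI])
    then obtain N :: nat where N: "N > 0" "?h g [^]\<^bsub>?H\<^esub> N = \<one>\<^bsub>?H\<^esub>" using t by (auto simp: tors_group_def)
    then have "?h (g [^]\<^bsub>?G\<^esub> N) = \<one>\<^bsub>?H\<^esub>" using hom_nat_pow[OF h g] by simp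
    then obtain k :: nat where k: "coprime k p" "(g [^]\<^bsub>?G\<^esub> N) [^]\<^bsub>?G\<^esub> k = \<one>\<^bsub>?G\<^esub>"
      using ker G.nat_pow_closed[OF g] by blast
    \<comment> \<open>Zero is coprime to \<open>p\<close> only if \<open>p\<close> is 1.\<close>
    have "k > 0" using k(1) p by (cases k) auto
    then show "\<exists>N::nat. N > 0 \<and> g [^]\<^bsub>?G\<^esub> N = \<one>\<^bsub>?G\<^esub>"
      using k(2) N(1) G.nat_pow_pow[OF g] by (metis nat_0_less_mult_iff)
  qed
  moreover obtain e where e: "e \<in> iso ?G integer_group"
    using reduced_homology_group_nsphere(1)[of n] n by (auto simp: un_reduced_homology_group is_iso_def)
  ultimately have "tors_group integer_group" using tors_group_iso[OF _ group_integer_group e] by simp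
  then have "\<exists>N::nat. N > 0 \<and> (1::int) [^]\<^bsub>integer_group\<^esub> N = \<one>\<^bsub>integer_group\<^esub>"
    unfolding tors_group_def by (rule bspec) simp
  then show False by auto
qed

section \<open>Path components of loop spaces and of the cone\<close>

lemma cm_interval_square:
  assumes "continuous_map W unit_interval f" "continuous_map W unit_interval g"
  shows "continuous_map W (prod_topology unit_interval unit_interval) (\<lambda>w. (f w, g w))"
  using assms by (rule continuous_map_pairedI)

lemma path_component_loop_spaceI:
  assumes k: "continuous_map (prod_topology unit_interval unit_interval) Y (\<lambda>z. k (fst z) (snd z))"
    and "\<And>u. u \<in> {0..1} \<Longrightarrow> k u 0 = b" "\<And>u. u \<in> {0..1} \<Longrightarrow> k u 1 = b"
    and "\<And>t. t \<in> {0..1} \<Longrightarrow> k 0 t = g t" "\<And>t. t \<in> {0..1} \<Longrightarrow> k 1 t = h t"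
  shows "path_component_of (loop_space Y b) (restrict g {0..1}) (restrict h {0..1})"
  unfolding path_component_of_def
proof (intro exI conjI)
  let ?f = "\<lambda>u. restrict (k u) {0..1}"
  show "?f 0 = restrict g {0..1}" "?f 1 = restrict h {0..1}"
    by (rule restrict_ext, use assms in simp)+
  have "continuous_map (prod_topology unit_interval unit_interval) Y (\<lambda>z. ?f (fst z) (snd z))"
    by (rule continuous_map_eq[OF k]) auto
  then show "pathin (loop_space Y b) ?f"
    unfolding pathin_def by (intro cm_into_loop_space) (use assms(2,3) in auto)
qed

definition "trapezoid t = min 1 (min (3 * t) (3 - 3 * t))" for t :: real

text \<open>The three sides of the square of a free homotopy to a constant loop form a loop
  \<open>\<delta> \<circ> trapezoid\<close>, which contracts because it runs back and forth along \<open>\<delta>\<close>.\<close>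

lemma path_connected_loop_space:
  assumes Y: "simply_connected_space Y" and y0: "y0 \<in> topspace Y"
  shows "path_connected_space (loop_space Y y0)"
proof -
  have con: "path_component_of (loop_space Y y0) g (const_loop y0)" if g: "g \<in> loops Y y0" for g
  proof -
    have "pathin Y (\<lambda>_. y0)" using y0 by (simp add: pathin_def)
    then have "homotopic_with (\<lambda>r. r 1 = r 0) unit_interval Y g (\<lambda>_. y0)"
      using Y g by (simp add: simply_connected_space_def loops_def)
    then obtain H where H: "continuous_map (prod_topology unit_interval unit_interval) Y H"
      and H0: "\<And>t. H (0, t) = g t" and H1: "\<And>t. H (1, t) = y0" and loop: "\<And>s. s \<in> {0..1} \<Longrightarrow> H (s, 1) = H (s, 0)"
      unfolding homotopic_with_def by auto
    let ?S = "prod_topology unit_interval unit_interval"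
    let ?m = "\<lambda>t. max 0 (min 1 (3 * t - 1)) :: real"
    have g01: "g 0 = y0" "g 1 = y0" "g \<in> extensional {0..1}" using g by (auto simp: loops_def)
    have u: "continuous_map ?S euclideanreal fst" and t: "continuous_map ?S euclideanreal snd"
      by (rule cm_interval_real[OF cm_fst'] cm_interval_real[OF cm_snd'])+
    have trap: "0 \<le> trapezoid r" "trapezoid r \<le> 1" if "r \<in> {0..1}" for r using that by (auto simp: trapezoid_def)
    have c1: "continuous_map ?S unit_interval (\<lambda>z. fst z * trapezoid (snd z))"
      unfolding cm_interval
      by (intro conjI ballI; (unfold trapezoid_def, intro continuous_intros u t)?)
         (auto simp flip: trapezoid_def intro!: mult_le_one mult_nonneg_nonneg trap)
    have c2: "continuous_map ?S unit_interval (\<lambda>z. (1 - fst z) * snd z + fst z * ?m (snd z))"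
      unfolding cm_interval
    proof (intro conjI ballI)
      fix z assume "z \<in> topspace ?S"
      then have "fst z \<in> {0..1}" "snd z \<in> {0..1}" by auto
      then show "0 \<le> (1 - fst z) * snd z + fst z * ?m (snd z)" "(1 - fst z) * snd z + fst z * ?m (snd z) \<le> 1"
        using convex_bound_le[of "snd z" 1 "?m (snd z)" "1 - fst z" "fst z"] by auto
    qed (intro continuous_intros u t)
    \<comment> \<open>A straight-line homotopy in the square, from the edge on which
      \<open>H\<close> is \<open>g\<close> to the other three sides.\<close>
    have "continuous_map ?S Y (\<lambda>z. H (fst z * trapezoid (snd z), (1 - fst z) * snd z + fst z * ?m (snd z)))"
      by (rule cm_comp[OF H cm_interval_square[OF c1 c2]])
    then have "path_component_of (loop_space Y y0) (restrict g {0..1}) (restrict (\<lambda>t. H (trapezoid t, 0)) {0..1})"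
    proof (rule path_component_loop_spaceI)
      fix t :: real assume t: "t \<in> {0..1}"
      show "H (0 * trapezoid t, (1 - 0) * t + 0 * ?m t) = g t" by (simp add: H0)
      \<comment> \<open>On the middle third \<open>H\<close> is at its constant end; on the last
        third the loop condition replaces the side at 1 by the side at 0.\<close>
      consider "t \<le> 1/3" | "1/3 \<le> t" "t \<le> 2/3" | "2/3 \<le> t" by linarith
      then show "H (1 * trapezoid t, (1 - 1) * t + 1 * ?m t) = H (trapezoid t, 0)"
      proof cases
        case 2
        then have "trapezoid t = 1" by (auto simp: trapezoid_def)
        then show ?thesis by (simp add: H1)
      next
        case 3
        then have "?m t = 1" by auto
        then show ?thesis using loop trap[OF t] by simp
      qed auto
    qed (simp_all add: H0 g01 trapezoid_def)
    moreover
    have o: "continuous_map ?S unit_interval (\<lambda>_. 0)" by (rule cm_const) simp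
    have c3: "continuous_map ?S unit_interval (\<lambda>z. (1 - fst z) * trapezoid (snd z))"
      unfolding cm_interval
      by (intro conjI ballI; (unfold trapezoid_def, intro continuous_intros u t)?)
         (auto simp flip: trapezoid_def intro!: mult_le_one mult_nonneg_nonneg trap)
    have "continuous_map ?S Y (\<lambda>z. H ((1 - fst z) * trapezoid (snd z), 0))"
      by (rule cm_comp[OF H cm_interval_square[OF c3 o]])
    then have "path_component_of (loop_space Y y0) (restrict (\<lambda>t. H (trapezoid t, 0)) {0..1}) (restrict (\<lambda>_. y0) {0..1})"
      by (rule path_component_loop_spaceI) (simp_all add: H0 g01 trapezoid_def)
    moreover have "restrict g {0..1} = g" using g01(3) by (simp add: extensional_restrict)
    ultimately show ?thesis unfolding const_loop_def by (metis path_component_of_trans)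
  qed
  show ?thesis
    unfolding path_connected_space_iff_path_component topspace_loop_space
    using con by (meson path_component_of_sym path_component_of_trans)
qed

text \<open>A free homotopy between two constant loops traces a path between their values.\<close>

lemma simply_connected_path:
  assumes Y: "simply_connected_space Y" and y: "y0 \<in> topspace Y" "y \<in> topspace Y"
  obtains \<gamma> where "continuous_map unit_interval Y \<gamma>" "\<gamma> 0 = y0" "\<gamma> 1 = y"
proof -
  have "pathin Y (\<lambda>_. y0)" "pathin Y (\<lambda>_. y)" using y by (simp_all add: pathin_def)
  then have "homotopic_with (\<lambda>r. r 1 = r 0) unit_interval Y (\<lambda>_. y0) (\<lambda>_. y)"
    using Y by (simp add: simply_connected_space_def)
  then obtain H where H: "continuous_map (prod_topology unit_interval unit_interval) Y H"
    and H0: "\<And>t. H (0, t) = y0" and H1: "\<And>t. H (1, t) = y" unfolding homotopic_with_def by auto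
  have "continuous_map unit_interval Y (\<lambda>s. H (s, 0))"
    by (rule cm_comp[OF H cm_interval_square[OF cm_id cm_const]]) simp
  then show ?thesis using that H0 H1 by simp
qed

lemma path_component_of_map:
  assumes "continuous_map X Y f" "path_component_of X x y"
  shows "path_component_of Y (f x) (f y)"
proof -
  obtain g where g: "pathin X g" "g 0 = x" "g 1 = y" using assms(2) by (auto simp: path_component_of_def)
  then have "pathin Y (f \<circ> g)" using assms(1) by (auto simp: pathin_def intro: continuous_map_compose)
  then show ?thesis using g unfolding path_component_of_def by (intro exI[of _ "f \<circ> g"]) simp
qed

lemma path_component_homotopic:
  assumes "homotopic_with (\<lambda>_. True) X Y f g" "x \<in> topspace X"
  shows "path_component_of Y (f x) (g x)"
proof -
  obtain H where H: "continuous_map (prod_topology unit_interval X) Y H"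
    and H0: "\<And>t. H (0, t) = f t" and H1: "\<And>t. H (1, t) = g t" using assms(1) unfolding homotopic_with_def by auto
  have "continuous_map unit_interval Y (\<lambda>s. H (s, x))"
    by (rule cm_comp[OF H]) (intro continuous_map_pairedI cm_id cm_const assms)
  then show ?thesis using H0 H1 unfolding path_component_of_def pathin_def by blast
qed

lemma trivialisationI:
  assumes b: "b \<in> topspace B" and "path_connected_space (loop_space B b)"
    and path: "\<And>y. y \<in> topspace B \<Longrightarrow> \<exists>\<gamma>. continuous_map unit_interval B \<gamma> \<and> \<gamma> 0 = b \<and> \<gamma> 1 = y"
  obtains lam where "trivialisation B b lam"
proof -
  obtain \<gamma> where \<gamma>: "\<And>y. y \<in> topspace B \<Longrightarrow> continuous_map unit_interval B (\<gamma> y) \<and> \<gamma> y 0 = b \<and> \<gamma> y 1 = y"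
    using path by metis
  have "trivialisation B b (\<lambda>y. if y = b then (\<lambda>_. b) else \<gamma> y)"
    by unfold_locales (use assms(1,2) \<gamma> in auto)
  then show ?thesis using that by blast
qed

text \<open>A point of the open cone is joined to the base point along its own cone line, and a
  point of \<open>Y\<close> by a path in \<open>Y\<close>.\<close>

lemma path_in_cone:
  fixes X :: "'a topology" and x0 :: 'a
  assumes f: "continuous_map X Y f" and fx0: "f x0 = y0"
    and CW: "pointed_CW_complex X x0" and x0: "x0 \<in> topspace X" and Y: "simply_connected_space Y"
    and z: "z \<in> topspace (mapping_cone X x0 Y y0 f)"
  shows "\<exists>\<gamma>. continuous_map unit_interval (mapping_cone X x0 Y y0 f) \<gamma> \<and> \<gamma> 0 = Inr y0 \<and> \<gamma> 1 = z"
proof -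
  have y0: "y0 \<in> topspace Y" using continuous_map_image_subset_topspace[OF f] x0 fx0 by blast
  from z consider x t where "z = Inl (x, t)" "x \<in> topspace X - {x0}" "t \<in> {0<..<1}" | y where "z = Inr y" "y \<in> topspace Y"
    unfolding topspace_mapping_cone[OF f y0] cone_points_def by blast
  then show ?thesis
  proof cases
    case 1
    obtain k :: "real \<Rightarrow> 'a \<Rightarrow> 'a" and V where k: "continuous_map (prod_topology X unit_interval) X (\<lambda>p. k (snd p) (fst p))"
      "\<And>x. x \<in> topspace X \<Longrightarrow> k 0 x = x" "\<And>s. s \<in> {0..1} \<Longrightarrow> k s x0 = x0"
      "openin X V" "x0 \<in> V" "\<And>x. x \<in> V \<Longrightarrow> k 1 x = x0" "Hausdorff_space X"
      by (rule CW_vertex_nondegenerate[OF CW]) blast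
    have "continuous_map unit_interval (prod_topology X unit_interval) (\<lambda>u. (x, u * t))"
    proof (intro continuous_map_pairedI cm_const)
      show "x \<in> topspace X" using 1 by simp
      show "continuous_map unit_interval unit_interval (\<lambda>u. u * t)"
        unfolding cm_interval using 1 by (auto intro!: continuous_intros mult_le_one cm_interval_real[OF cm_id])
    qed
    from cm_comp[OF cm_kap[OF f fx0 x0 k(7,1-6)] this]
    show ?thesis using 1 by (intro exI[of _ "\<lambda>u. cone_proj x0 y0 f (x, u * t)"]) (simp add: cone_proj_def)
  next
    case 2
    obtain \<gamma> where "continuous_map unit_interval Y \<gamma>" "\<gamma> 0 = y0" "\<gamma> 1 = y"
      by (rule simply_connected_path[OF Y y0 2(2)])
    then show ?thesis
      using 2 cm_comp[OF continuous_map_cone_inclusion[OF f y0]] by (intro exI[of _ "\<lambda>u. Inr (\<gamma> u)"]) simp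
  qed
qed

theorem theorem6p2:
  fixes p a b :: nat
    and X :: "'a topology" and x0 :: 'a
    and Y :: "'b topology" and y0 :: 'b
    and \<alpha> :: "'a \<Rightarrow> 'b"
  assumes "prime p" and "odd p"
    and "3 \<le> a" and "a < b" and "odd a" and "odd b"
    and "p_local_sphere p (b - 1) X x0"
    and "p_local_sphere p a Y y0"
    and "continuous_map X Y \<alpha>" and "\<alpha> x0 = y0"
    and "real p > (real b + 3) / 2"
  shows "\<not> inert X x0 Y y0 \<alpha>"
proof
  let ?A = "mapping_cone X x0 Y y0 \<alpha>"
  let ?F = "loop_space ?A (Inr y0)"
  assume "inert X x0 Y y0 \<alpha>"
  then obtain s where s: "continuous_map ?F (loop_space Y y0) s"
    and "homotopic_with (\<lambda>h. h (const_loop (Inr y0)) = const_loop (Inr y0)) ?F ?F (loop_map Inr \<circ> s) id"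
    unfolding inert_def has_right_homotopy_inverse_def by blast
  then have vs: "homotopic_with (\<lambda>_. True) ?F ?F (loop_map Inr \<circ> s) id" by (auto elim: homotopic_with_mono)
  obtain lX where lX: "p_localisation p (nsphere (b - 1)) X lX" "lX sphere_base = x0" and CW: "pointed_CW_complex X x0"
    using assms(7) by (auto simp: p_local_sphere_def)
  obtain lY where lY: "p_localisation p (nsphere a) Y lY" using assms(8) by (auto simp: p_local_sphere_def)
  have Y: "simply_connected_space Y" using lY by (simp add: p_localisation_def)
  have "sphere_base \<in> topspace (nsphere (b - 1))"
    unfolding nsphere sphere_base_def by (simp add: power2_eq_square if_distrib cong: if_cong)
  then have x0: "x0 \<in> topspace X"
    using lX continuous_map_image_subset_topspace by (fastforce simp: p_localisation_def)
  note \<alpha> = assms(9,10)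
  have y0: "y0 \<in> topspace Y" using continuous_map_image_subset_topspace[OF \<alpha>(1)] x0 \<alpha>(2) by blast
  have v: "continuous_map Y ?A Inr" by (rule continuous_map_cone_inclusion[OF \<alpha>(1) y0])
  \<comment> \<open>Every loop \<open>g\<close> in the cone is joined to the image of the loop
    \<open>s g\<close> of \<open>Y\<close>, whose loop space is path connected; so inertness yields
    the connectedness that the trivialisation requires.\<close>
  have "path_component_of ?F g (loop_map Inr (const_loop y0))" if g: "g \<in> topspace ?F" for g
  proof -
    have "s g \<in> topspace (loop_space Y y0)" using g continuous_map_image_subset_topspace[OF s] by blast
    moreover have "const_loop y0 \<in> topspace (loop_space Y y0)"
      unfolding topspace_loop_space loops_def const_loop_def pathin_def
      using y0 by (auto intro: continuous_map_eq[OF cm_const])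
    ultimately have "path_component_of (loop_space Y y0) (s g) (const_loop y0)"
      using path_connected_loop_space[OF Y y0] by (simp add: path_connected_space_iff_path_component)
    from path_component_of_map[OF continuous_map_loop_map[OF v] this]
    have "path_component_of ?F (loop_map Inr (s g)) (loop_map Inr (const_loop y0))" .
    moreover have "path_component_of ?F g (loop_map Inr (s g))"
      using path_component_of_sym[OF path_component_homotopic[OF vs g]] by simp
    ultimately show ?thesis by (rule path_component_of_trans[rotated])
  qed
  then have "path_connected_space ?F"
    unfolding path_connected_space_iff_path_component by (meson path_component_of_sym path_component_of_trans)
  then obtain lam where triv: "trivialisation ?A (Inr y0) lam"
    using trivialisationI[of "Inr y0" ?A] path_in_cone[OF \<alpha> CW x0 Y] y0 continuous_map_image_subset_topspace[OF v]
    by (metis imageI subsetD)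
  have HX: "trivial_group (homology_group i X)" if "i > 0" "i \<noteq> int (b - 1)" for i
    by (rule p_localisation_trivial[OF lX(1) that])
  have HY: "trivial_group (homology_group i Y)" if "i > 0" "i \<noteq> int a" for i
    by (rule p_localisation_trivial[OF lY that])
  \<comment> \<open>Below degree b only i = a can fail, through the fundamental class of
    \<open>Y\<close>; the class of \<open>X\<close> in degree b - 1 is felt only in degree
    b.\<close>
  have torsA: "torsion_homology i ?A" if i: "2 \<le> i" "i < b" "i \<noteq> a" for i
    unfolding torsion_homology_iff by (rule tors_group_cone[OF \<alpha> CW x0]; (rule HX HY)?) (use i in auto)
  \<comment> \<open>Strong induction over odd degrees. The column i = a leaves the loop degree q + 1
    - a, which is odd again and smaller than q; in every other column the base is torsion, since i
    \<le> q + 1 < b.\<close>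
  have torsF: "torsion_homology q ?F" if "odd q" "q + 2 \<le> b" for q
    using that
  proof (induction q rule: less_induct)
    case (less q)
    show ?case
    proof (rule trivialisation.torsion_homology_loops[OF triv])
      show "q \<ge> 1" using less.prems by (cases q) auto
      fix i assume i: "2 \<le> i" "i \<le> Suc q"
      show "torsion_homology i ?A \<or> torsion_homology (Suc q - i) ?F"
      proof (cases "i = a")
        case True
        then show ?thesis using less.IH[of "Suc q - i"] less.prems i assms(3,5) by auto
      qed (use torsA[of i] i less.prems in auto)
    qed
  qed
  have "torsion_homology (Suc (b - 1)) ?A"
  proof (rule torsion_homology_right_inverse[OF v y0 triv s vs])
    show "b - 1 \<ge> 1" using assms by auto
    show "torsion_homology (Suc (b - 1)) Y"
      unfolding torsion_homology_iff by (intro tors_group_trivial HY) (use assms(3,4) in auto)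
    fix i assume i: "1 \<le> i" "i < b - 1"
    show "torsion_homology i ?A \<or> torsion_homology (b - 1 - i) ?F"
    \<comment> \<open>An even i differs from a; for odd i the loop degree b - 1 - i is odd.\<close>
    proof (cases "even i")
      case True
      then have "i \<noteq> a" "2 \<le> i" using assms(5) i by (auto elim: evenE)
      then show ?thesis using torsA[of i] i by auto
    next
      case False
      then show ?thesis using torsF[of "b - 1 - i"] i assms(6) by auto
    qed
  qed
  then have "tors_group (homology_group (int b) ?A)" using assms(4) by (simp add: torsion_homology_iff)
  \<comment> \<open>Two odd numbers are never consecutive, hence \<open>Y\<close> has no homology in
    degree b - 1, and the homology of the cone in degree b maps onto that of \<open>X\<close> in
    degree b - 1.\<close>
  moreover have "b \<noteq> Suc a" using assms(5,6) by auto
  then have "trivial_group (homology_group (int b - 1) Y)"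
    by (intro HY) (use assms(3,4) in auto)
  ultimately have "tors_group (homology_group (int b - 1) X)"
    using tors_group_cone_source[OF \<alpha> CW x0] assms(3,4) by simp
  then show False
    using p_localisation_not_tors[OF assms(1) lX(1)] assms(3,4) by (simp add: of_nat_diff)
qed

end
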